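(* Let $M^n$ be a closed manifold and let $g(t)$, $t\in[0,T)$, be a solution of the normalized Ricci flow $\frac{\partial g}{\partial t}=\frac{2}{n}rg-2\,Ric(g)$ on $M^n$ with initial metric $g(0)=g_0$, where $r=r(t)=\frac{\int_M R\,d\mu}{\int_M d\mu}$. Let $\lambda(t)$ be an evolving eigenvalue of the Laplacian under the normalized flow, with associated normalized evolving eigenfunction $f=f_t$ (see context). Then for all $t\in[0,T)$ $$\frac{d\lambda}{dt}=-\frac{2}{n}r\lambda+\lambda\int_M f^2R\,d\mu-\int_M R|\nabla f|^2\,d\mu+2\int_M Ric(\nabla f,\nabla f)\,d\mu,$$ where all geometric quantities are those of $g(t)$.
   Context: $M^n$ is a closed (compact, connected, without boundary) smooth manifold of dimension $n$. For a Riemannian metric $g$, $Ric$ is the Ricci tensor, $R$ the scalar curvature, $d\mu$ the Riemannian measure, $\nabla$ the gradient/Levi-Civita connection, and $\Delta_g=\mathrm{Tr}_g\nabla^2$ the Laplacian on functions; $\lambda$ is an eigenvalue with eigenfunction $f$ if $\Delta_g f+\lambda f=0$, so the spectrum is $0=\lambda_0<\lambda_1\le\lambda_2\le\dots$. An evolving eigenvalue with normalized evolving eigenfunction along a family $g(t)$ means: a real function $\lambda(t)$ and smooth functions $f_t\in C^\infty(M)$, both depending in a continuously differentiable way on $t$ (that is, $\lambda$ is $C^1$ and $t\mapsto f_t$ is a $C^1$ map into $C^\infty(M)$, with one-sided derivatives at $t=0$), such that for every $t$: $\Delta_{g(t)}f_t+\lambda(t)f_t=0$, $\int_M f_t\,d\mu_t=0$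 and $\int_M f_t^2\,d\mu_t=1$. In particular $\lambda(t)>0$. The existence of such $C^1$ families is a standing assumption. *)

theory Defs
  imports "HOL-Analysis.Analysis"
begin

section \<open>Smooth maps on subsets of Euclidean spaces\<close>

text \<open>
  Derivatives are taken within \<open>S\<close>, so that the definitions cover open sets as well as sets
  \<open>[0,T) \<times> V\<close> with \<open>V\<close> open, where they are one-sided in the first variable at \<open>0\<close>.  On such sets
  derivatives within \<open>S\<close> are unique; on a set without that property \<open>frechet_derivative\<close> would
  make an arbitrary choice.
\<close>

primrec iter_partial ::
  "'a::euclidean_space set \<Rightarrow> 'a list \<Rightarrow> ('a \<Rightarrow> 'b::real_normed_vector) \<Rightarrow> 'a \<Rightarrow> 'b" where
  "iter_partial S [] f = f"
| "iter_partial S (v # vs) f = (\<lambda>x. frechet_derivative (iter_partial S vs f) (at x within S) v)"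

definition smooth_on :: "'a::euclidean_space set \<Rightarrow> ('a \<Rightarrow> 'b::real_normed_vector) \<Rightarrow> bool" where
  "smooth_on S f \<longleftrightarrow> (\<forall>vs. set vs \<subseteq> Basis \<longrightarrow> iter_partial S vs f differentiable_on S)"

section \<open>Closed smooth manifolds\<close>

text \<open>
  A chart is a pair of its domain and its coordinate map; the values of the coordinate map
  outside the domain are irrelevant.  The dimension is \<open>CARD('n)\<close>.
\<close>

type_synonym ('a, 'n) chart = "'a set \<times> ('a \<Rightarrow> (real, 'n) vec)"

definition chart_image :: "('a, 'n::finite) chart \<Rightarrow> (real^'n) set" where
  "chart_image c = snd c ` fst c"

definition chart_inv :: "('a, 'n::finite) chart \<Rightarrow> real^'n \<Rightarrow> 'a" where
  "chart_inv c = inv_into (fst c) (snd c)"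

definition transition :: "('a, 'n::finite) chart \<Rightarrow> ('a, 'n) chart \<Rightarrow> real^'n \<Rightarrow> real^'n" where
  "transition c d = snd d \<circ> chart_inv c"

definition smooth_atlas :: "'a topology \<Rightarrow> ('a, 'n::finite) chart set \<Rightarrow> bool" where
  "smooth_atlas X A \<longleftrightarrow>
     (\<Union>c\<in>A. fst c) = topspace X \<and>
     (\<forall>c\<in>A. openin X (fst c) \<and> open (chart_image c) \<and>
        homeomorphic_map (subtopology X (fst c)) (top_of_set (chart_image c)) (snd c)) \<and>
     (\<forall>c\<in>A. \<forall>d\<in>A. smooth_on (snd c ` (fst c \<inter> fst d)) (transition c d))"

text \<open>Second countability follows from compactness.  The atlas need not be maximal.\<close>

definition closed_manifold :: "'a topology \<Rightarrow> ('a, 'n::finite) chart set \<Rightarrow> bool" where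
  "closed_manifold X A \<longleftrightarrow>
     topspace X \<noteq> {} \<and> Hausdorff_space X \<and> compact_space X \<and> connected_space X \<and> smooth_atlas X A"

definition in_chart :: "('a \<Rightarrow> real) \<Rightarrow> ('a, 'n::finite) chart \<Rightarrow> real^'n \<Rightarrow> real" where
  "in_chart u c = u \<circ> chart_inv c"

definition smooth_fun :: "('a, 'n::finite) chart set \<Rightarrow> ('a \<Rightarrow> real) \<Rightarrow> bool" where
  "smooth_fun A u \<longleftrightarrow> (\<forall>c\<in>A. smooth_on (chart_image c) (in_chart u c))"

text \<open>
  Convergence in the usual Frechet topology of \<open>C\<^sup>\<infinity>(M)\<close>: all partial derivatives converge
  uniformly on compact subsets of every chart.
\<close>

definition smooth_tendsto ::
  "('a, 'n::finite) chart set \<Rightarrow> ('s \<Rightarrow> 'a \<Rightarrow> real) \<Rightarrow> ('a \<Rightarrow> real) \<Rightarrow> 's filter \<Rightarrow> bool" where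
  "smooth_tendsto A h u F \<longleftrightarrow>
     (\<forall>c\<in>A. \<forall>K vs. compact K \<and> K \<subseteq> chart_image c \<and> set vs \<subseteq> Basis \<longrightarrow>
        uniform_limit K (\<lambda>s. iter_partial (chart_image c) vs (in_chart (h s) c))
          (iter_partial (chart_image c) vs (in_chart u c)) F)"

definition C1_curve_real :: "real set \<Rightarrow> (real \<Rightarrow> real) \<Rightarrow> bool" where
  "C1_curve_real I l \<longleftrightarrow>
     (\<exists>l'. continuous_on I l' \<and> (\<forall>t\<in>I. (l has_real_derivative l' t) (at t within I)))"

definition C1_curve_smooth :: "('a, 'n::finite) chart set \<Rightarrow> real set \<Rightarrow> (real \<Rightarrow> 'a \<Rightarrow> real) \<Rightarrow> bool" where
  "C1_curve_smooth A I f \<longleftrightarrow>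
     (\<forall>t\<in>I. smooth_fun A (f t)) \<and>
     (\<exists>f'. (\<forall>t\<in>I. smooth_fun A (f' t)) \<and>
        (\<forall>t\<in>I. smooth_tendsto A (\<lambda>s p. (f s p - f t p) / (s - t)) (f' t) (at t within I)) \<and>
        (\<forall>t\<in>I. smooth_tendsto A f' (f' t) (at t within I)))"

section \<open>Riemannian metrics and their measures\<close>

text \<open>
  A metric is given by its component matrices: \<open>g c x $ i $ j\<close> is \<open>g\<^sub>i\<^sub>j\<close> at the point
  with coordinates \<open>x\<close> in the chart \<open>c\<close>, and the components in different charts are related by
  the transformation law of a covariant 2-tensor.  Values for \<open>x\<close> outside the image of \<open>c\<close>, or for
  \<open>c\<close> outside the atlas, are irrelevant.
\<close>

type_synonym ('a, 'n) metric = "('a, 'n) chart \<Rightarrow> (real, 'n) vec \<Rightarrow> ((real, 'n) vec, 'n) vec"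

definition riemannian_metric :: "('a, 'n::finite) chart set \<Rightarrow> ('a, 'n) metric \<Rightarrow> bool" where
  "riemannian_metric A g \<longleftrightarrow>
     (\<forall>c\<in>A. smooth_on (chart_image c) (g c) \<and>
        (\<forall>x\<in>chart_image c. transpose (g c x) = g c x \<and> (\<forall>v. v \<noteq> 0 \<longrightarrow> 0 < v \<bullet> (g c x *v v)))) \<and>
     (\<forall>c\<in>A. \<forall>d\<in>A. \<forall>p \<in> fst c \<inter> fst d.
        let J = jacobian (transition c d) (at (snd c p))
        in g c (snd c p) = transpose J ** g d (snd d p) ** J)"

definition is_riemannian_measure ::
  "'a topology \<Rightarrow> ('a, 'n::finite) chart set \<Rightarrow> ('a, 'n) metric \<Rightarrow> 'a measure \<Rightarrow> bool" where
  "is_riemannian_measure X A g \<mu> \<longleftrightarrow>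
     sets \<mu> = sets (sigma (topspace X) {U. openin X U}) \<and>
     (\<forall>c\<in>A. \<forall>B\<in>sets \<mu>. B \<subseteq> fst c \<longrightarrow>
        emeasure \<mu> B = (\<integral>\<^sup>+x \<in> snd c ` B. ennreal (sqrt (det (g c x))) \<partial>lborel))"

text \<open>
  On a closed manifold the local formulas agree on overlaps by the change of variables theorem,
  and they determine a unique Borel measure.
\<close>

definition riemannian_measure ::
  "'a topology \<Rightarrow> ('a, 'n::finite) chart set \<Rightarrow> ('a, 'n) metric \<Rightarrow> 'a measure" where
  "riemannian_measure X A g = (THE \<mu>. is_riemannian_measure X A g \<mu>)"

section \<open>Curvature, gradient and Laplacian in local coordinates\<close>

text \<open>In this section \<open>G\<close> is the matrix field of a metric in one fixed chart.\<close>

definition pderiv_at :: "'n::finite \<Rightarrow> (real^'n \<Rightarrow> real) \<Rightarrow> real^'n \<Rightarrow> real" where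
  "pderiv_at i u x = frechet_derivative u (at x) (axis i 1)"

definition christoffel ::
  "(real^'n::finite \<Rightarrow> real^'n^'n) \<Rightarrow> 'n \<Rightarrow> 'n \<Rightarrow> 'n \<Rightarrow> real^'n \<Rightarrow> real" where
  "christoffel G k i j x =
     (\<Sum>l\<in>UNIV. matrix_inv (G x) $ k $ l *
        (pderiv_at i (\<lambda>y. G y $ j $ l) x + pderiv_at j (\<lambda>y. G y $ i $ l) x
          - pderiv_at l (\<lambda>y. G y $ i $ j) x)) / 2"

text \<open>
  \<open>riemann G k i l j\<close> is the \<open>k\<close>-th component of \<open>Rm(\<partial>\<^sub>l, \<partial>\<^sub>j)\<partial>\<^sub>i\<close>, where
  \<open>Rm(X, Y)Z = \<nabla>\<^sub>X\<nabla>\<^sub>Y Z - \<nabla>\<^sub>Y\<nabla>\<^sub>X Z - \<nabla>\<^bsub>[X,Y]\<^esub> Z\<close>; with the contraction below, round spheres have positive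
  Ricci curvature.
\<close>

definition riemann ::
  "(real^'n::finite \<Rightarrow> real^'n^'n) \<Rightarrow> 'n \<Rightarrow> 'n \<Rightarrow> 'n \<Rightarrow> 'n \<Rightarrow> real^'n \<Rightarrow> real" where
  "riemann G k i l j x =
     pderiv_at l (christoffel G k j i) x - pderiv_at j (christoffel G k l i) x
     + (\<Sum>m\<in>UNIV. christoffel G k l m x * christoffel G m j i x
                 - christoffel G k j m x * christoffel G m l i x)"

definition ricci :: "(real^'n::finite \<Rightarrow> real^'n^'n) \<Rightarrow> real^'n \<Rightarrow> real^'n^'n" where
  "ricci G x = (\<chi> i j. \<Sum>k\<in>UNIV. riemann G k i k j x)"

definition trace_wrt :: "real^'n::finite^'n \<Rightarrow> real^'n^'n \<Rightarrow> real" where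
  "trace_wrt g S = (\<Sum>i\<in>UNIV. \<Sum>j\<in>UNIV. matrix_inv g $ i $ j * S $ i $ j)"

definition scalar_curv :: "(real^'n::finite \<Rightarrow> real^'n^'n) \<Rightarrow> real^'n \<Rightarrow> real" where
  "scalar_curv G x = trace_wrt (G x) (ricci G x)"

definition gradient :: "(real^'n::finite \<Rightarrow> real^'n^'n) \<Rightarrow> (real^'n \<Rightarrow> real) \<Rightarrow> real^'n \<Rightarrow> real^'n" where
  "gradient G u x = matrix_inv (G x) *v (\<chi> j. pderiv_at j u x)"

definition hessian :: "(real^'n::finite \<Rightarrow> real^'n^'n) \<Rightarrow> (real^'n \<Rightarrow> real) \<Rightarrow> real^'n \<Rightarrow> real^'n^'n" where
  "hessian G u x =
     (\<chi> i j. pderiv_at i (pderiv_at j u) x - (\<Sum>k\<in>UNIV. christoffel G k i j x * pderiv_at k u x))"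

definition laplacian :: "(real^'n::finite \<Rightarrow> real^'n^'n) \<Rightarrow> (real^'n \<Rightarrow> real) \<Rightarrow> real^'n \<Rightarrow> real" where
  "laplacian G u x = trace_wrt (G x) (hessian G u x)"

definition bilin :: "real^'n::finite^'n \<Rightarrow> real^'n \<Rightarrow> real^'n \<Rightarrow> real" where
  "bilin S v w = v \<bullet> (S *v w)"

section \<open>The corresponding functions on the manifold\<close>

text \<open>
  A coordinate expression is evaluated in an arbitrary chart around the point.  It is applied
  only to expressions whose value does not depend on the chart.
\<close>

definition at_point ::
  "('a, 'n::finite) chart set \<Rightarrow> (('a, 'n) chart \<Rightarrow> real^'n \<Rightarrow> real) \<Rightarrow> 'a \<Rightarrow> real" where
  "at_point A F p = (let c = (SOME c. c \<in> A \<and> p \<in> fst c) in F c (snd c p))"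

definition Scal :: "('a, 'n::finite) chart set \<Rightarrow> ('a, 'n) metric \<Rightarrow> 'a \<Rightarrow> real" where
  "Scal A g = at_point A (\<lambda>c. scalar_curv (g c))"

definition Laplace :: "('a, 'n::finite) chart set \<Rightarrow> ('a, 'n) metric \<Rightarrow> ('a \<Rightarrow> real) \<Rightarrow> 'a \<Rightarrow> real" where
  "Laplace A g u = at_point A (\<lambda>c. laplacian (g c) (in_chart u c))"

definition grad_norm_sq :: "('a, 'n::finite) chart set \<Rightarrow> ('a, 'n) metric \<Rightarrow> ('a \<Rightarrow> real) \<Rightarrow> 'a \<Rightarrow> real" where
  "grad_norm_sq A g u = at_point A (\<lambda>c x.
     bilin (g c x) (gradient (g c) (in_chart u c) x) (gradient (g c) (in_chart u c) x))"

definition Ric_grad :: "('a, 'n::finite) chart set \<Rightarrow> ('a, 'n) metric \<Rightarrow> ('a \<Rightarrow> real) \<Rightarrow> 'a \<Rightarrow> real" where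
  "Ric_grad A g u = at_point A (\<lambda>c x.
     bilin (ricci (g c) x) (gradient (g c) (in_chart u c) x) (gradient (g c) (in_chart u c) x))"

section \<open>Normalized Ricci flow and evolving eigenvalues\<close>

definition mean_scal :: "'a topology \<Rightarrow> ('a, 'n::finite) chart set \<Rightarrow> ('a, 'n) metric \<Rightarrow> real" where
  "mean_scal X A g =
     (\<integral>p. Scal A g p \<partial>riemannian_measure X A g) / (\<integral>p. 1 \<partial>riemannian_measure X A g)"

definition time_interval :: "ereal \<Rightarrow> real set" where
  "time_interval T = {t. 0 \<le> t \<and> ereal t < T}"

text \<open>A solution is a family of metrics that is jointly smooth in time and space up to time 0.\<close>

definition normalized_ricci_flow ::
  "'a topology \<Rightarrow> ('a, 'n::finite) chart set \<Rightarrow> ereal \<Rightarrow> ('a, 'n) metric \<Rightarrow> (real \<Rightarrow> ('a, 'n) metric) \<Rightarrow> bool" where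
  "normalized_ricci_flow X A T g\<^sub>0 g \<longleftrightarrow>
     (\<forall>t\<in>time_interval T. riemannian_metric A (g t)) \<and>
     (\<forall>c\<in>A. smooth_on (time_interval T \<times> chart_image c) (\<lambda>(t, x). g t c x)) \<and>
     (\<forall>c\<in>A. \<forall>x\<in>chart_image c. g 0 c x = g\<^sub>0 c x) \<and>
     (\<forall>t\<in>time_interval T. \<forall>c\<in>A. \<forall>x\<in>chart_image c.
        ((\<lambda>s. g s c x) has_vector_derivative
           (2 / real CARD('n) * mean_scal X A (g t)) *\<^sub>R g t c x - 2 *\<^sub>R ricci (g t c) x)
        (at t within time_interval T))"

definition evolving_eigenvalue ::
  "'a topology \<Rightarrow> ('a, 'n::finite) chart set \<Rightarrow> real set \<Rightarrow> (real \<Rightarrow> ('a, 'n) metric) \<Rightarrow>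
     (real \<Rightarrow> real) \<Rightarrow> (real \<Rightarrow> 'a \<Rightarrow> real) \<Rightarrow> bool" where
  "evolving_eigenvalue X A I g l f \<longleftrightarrow>
     C1_curve_real I l \<and> C1_curve_smooth A I f \<and>
     (\<forall>t\<in>I. (\<forall>p\<in>topspace X. Laplace A (g t) (f t) p + l t * f t p = 0) \<and>
        (\<integral>p. f t p \<partial>riemannian_measure X A (g t)) = 0 \<and>
        (\<integral>p. (f t p)\<^sup>2 \<partial>riemannian_measure X A (g t)) = 1)"

end

theory Submission
  imports Defs
begin

text \<open>
  Write \<open>Q\<^sub>s(u, v)\<close> for the integral of \<open>\<langle>\<nabla>u, \<nabla>v\<rangle>\<close> and \<open>M\<^sub>s(u, v)\<close> for the integral of \<open>u v\<close>, both with respect to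
  the metric and the measure at time \<open>s\<close>.  The weak form of the eigenvalue equation at time \<open>s\<close>, tested
  with \<open>f\<^sub>t\<close>, and at time \<open>t\<close>, tested with \<open>f\<^sub>s\<close>, give
  \<open>(Q\<^sub>s - Q\<^sub>t)(f\<^sub>s, f\<^sub>t) = (\<lambda>\<^sub>s - \<lambda>\<^sub>t) M\<^sub>s(f\<^sub>s, f\<^sub>t) + \<lambda>\<^sub>t (M\<^sub>s - M\<^sub>t)(f\<^sub>s, f\<^sub>t)\<close>.
  Dividing by \<open>s - t\<close> and letting \<open>s\<close> tend to \<open>t\<close>, only \<open>C\<^sup>1\<close> convergence of \<open>f\<^sub>s\<close> to \<open>f\<^sub>t\<close> is needed, and
  \<open>\<lambda>' = Q'(f, f) - \<lambda> M'(f, f)\<close>.  For \<open>h\<close> the time derivative of the metric, \<open>M'(f, f)\<close> is the integral of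
  \<open>1/2 (tr h) f\<^sup>2\<close> and \<open>Q'(f, f)\<close> that of \<open>1/2 (tr h) \<bar>\<nabla>f\<bar>\<^sup>2 - h(\<nabla>f, \<nabla>f)\<close>; substituting \<open>h = (2/n) r g - 2 Ric\<close>
  gives the formula.  Neither the Bianchi identity nor the variation of the Laplacian enters.
\<close>

section \<open>Derivatives of the determinant and of the inverse matrix\<close>

text \<open>Pointwise quantities are evaluated in an arbitrarily chosen chart and the measure is a
  definite description, so independence of the chart and existence and uniqueness of the measure
  come before any integration on the manifold. For the Laplacian no transformation of second
  derivatives or Christoffel symbols is computed: its divergence form yields an integration by parts
  whose right-hand side is visibly invariant, and a continuous function is determined by its
  integrals against bumps. A C1 partition of unity then cuts integrals over the manifold into
  Lebesgue integrals over fixed compact coordinate sets. Its weights do not move with the metric, so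
  dominated convergence can be applied piece by piece to the coordinate expressions.
  Differentiability of \<lambda> is a hypothesis; only the value of the derivative has to be found,
  and one sequence decreasing to t finds it, at t = 0 as at later times. Since both pairings use f_s
  and f_t, the difference quotients fall on the metric and on \<lambda>, never on the
  eigenfunctions.\<close>

lemma has_derivative_det_mat_1:
  "(det has_derivative (trace :: real^'n::finite^'n \<Rightarrow> real)) (at (mat 1))"
proof -
  let ?P = "{p. p permutes (UNIV::'n set)}"
  let ?I = "mat 1 :: real^'n^'n"
  have entry: "((\<lambda>X::real^'n^'n. X $ i $ j) has_derivative (\<lambda>H. H $ i $ j)) F" for i j F
    by (intro bounded_linear_imp_has_derivative bounded_linear_compose[OF bounded_linear_vec_nth bounded_linear_vec_nth])
  have "((\<lambda>X::real^'n^'n. \<Sum>p\<in>?P. of_int (sign p) * (\<Prod>i\<in>UNIV. X $ i $ p i)) has_derivative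
      (\<lambda>H. \<Sum>p\<in>?P. of_int (sign p) * (\<Sum>i\<in>UNIV. H $ i $ p i * (\<Prod>j\<in>UNIV - {i}. ?I $ j $ p j)))) (at ?I)"
    by (rule derivative_eq_intros entry refl | simp)+
  moreover have "(\<Sum>p\<in>?P. of_int (sign p) * (\<Sum>i\<in>UNIV. H $ i $ p i * (\<Prod>j\<in>UNIV - {i}. ?I $ j $ p j))) = trace H"
    for H :: "real^'n^'n"
  proof -
    \<comment> \<open>A permutation other than the identity moves at least two points. Whichever
      factor is differentiated, another off-diagonal entry of the identity matrix remains and
      annihilates the product, so only \<open>id\<close> contributes.\<close>
    have "(\<Sum>i\<in>UNIV. H $ i $ p i * (\<Prod>j\<in>UNIV - {i}. ?I $ j $ p j)) = 0" if p: "p permutes UNIV" "p \<noteq> id" for p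
    proof (rule sum.neutral, rule ballI)
      fix i :: 'n
      have "\<exists>j. j \<noteq> i \<and> p j \<noteq> j"
      proof (rule ccontr)
        assume *: "\<not> (\<exists>j. j \<noteq> i \<and> p j \<noteq> j)"
        then have "p i = i" using p(1) by (metis permutes_univ)
        with * p(2) show False by (auto simp: fun_eq_iff)
      qed
      then obtain j where "j \<in> UNIV - {i}" "?I $ j $ p j = 0" by (auto simp: mat_def)
      then have "(\<Prod>j\<in>UNIV - {i}. ?I $ j $ p j) = 0" by (meson finite prod_zero finite_Diff)
      then show "H $ i $ p i * (\<Prod>j\<in>UNIV - {i}. ?I $ j $ p j) = 0" by simp
    qed
    then have "(\<Sum>p\<in>?P. of_int (sign p) * (\<Sum>i\<in>UNIV. H $ i $ p i * (\<Prod>j\<in>UNIV - {i}. ?I $ j $ p j)))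
      = (\<Sum>p\<in>{id}. of_int (sign p) * (\<Sum>i\<in>UNIV. H $ i $ p i * (\<Prod>j\<in>UNIV - {i}. ?I $ j $ p j)))"
      by (intro sum.mono_neutral_right) (auto simp: permutes_id finite_permutations)
    also have "\<dots> = trace H" by (simp add: sign_id mat_def trace_def)
    finally show ?thesis .
  qed
  ultimately show ?thesis unfolding det_def[abs_def] by simp
qed

lemma matrix_inv_works:
  assumes "invertible A"
  shows "A ** matrix_inv A = mat 1" "matrix_inv A ** A = mat 1"
  using someI_ex[OF assms[unfolded invertible_def]] by (auto simp: matrix_inv_def)

lemma matrix_inv_unique:
  fixes A :: "real^'n::finite^'n"
  assumes "A ** B = mat 1"
  shows "matrix_inv A = B"
proof -
  have "B ** A = mat 1" using assms matrix_left_right_inverse by blast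
  then have "invertible A" using assms unfolding invertible_def by blast
  then have "B ** (A ** matrix_inv A) = B" by (simp add: matrix_inv_works)
  then show ?thesis by (simp add: matrix_mul_assoc \<open>B ** A = mat 1\<close>)
qed

lemma bounded_bilinear_matrix_mult: "bounded_bilinear ((**) :: real^'n::finite^'m::finite \<Rightarrow> real^'k::finite^'n \<Rightarrow> real^'k^'m)"
  unfolding bilinear_conv_bounded_bilinear[symmetric] bilinear_def
  by (auto intro!: linearI simp: matrix_matrix_mult_def vec_eq_iff sum.distrib algebra_simps sum_distrib_left)

lemma bounded_bilinear_matrix_vector: "bounded_bilinear ((*v) :: real^'n::finite^'m::finite \<Rightarrow> real^'n \<Rightarrow> real^'m)"
  unfolding bilinear_conv_bounded_bilinear[symmetric] bilinear_def
  by (auto intro!: linearI simp: matrix_vector_mult_def vec_eq_iff sum.distrib algebra_simps sum_distrib_left)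

lemmas continuous_on_matrix_mult = bounded_bilinear.continuous_on[OF bounded_bilinear_matrix_mult]
lemmas continuous_on_matrix_vector = bounded_bilinear.continuous_on[OF bounded_bilinear_matrix_vector]

lemma bounded_linear_trace: "bounded_linear (trace :: real^'n::finite^'n \<Rightarrow> real)"
  unfolding linear_conv_bounded_linear[symmetric]
  by (auto intro!: linearI simp: trace_def sum.distrib sum_distrib_left)

text \<open>Reduces to the identity matrix by writing det X as det A times det of A^-1 X.\<close>

lemma has_derivative_det:
  fixes A :: "real^'n::finite^'n"
  assumes "invertible A"
  shows "(det has_derivative (\<lambda>H. det A * trace (matrix_inv A ** H))) (at A)"
proof -
  let ?B = "matrix_inv A"
  have "((\<lambda>X. ?B ** X) has_derivative (\<lambda>H. ?B ** H)) (at A)"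
    by (intro bounded_linear_imp_has_derivative bounded_bilinear.bounded_linear_right[OF bounded_bilinear_matrix_mult])
  from has_derivative_compose[OF this, of det trace]
  have "((\<lambda>X. det (?B ** X)) has_derivative (\<lambda>H. trace (?B ** H))) (at A)"
    by (simp add: matrix_inv_works assms has_derivative_det_mat_1)
  then have "((\<lambda>X. det A * det (?B ** X)) has_derivative (\<lambda>H. det A * trace (?B ** H))) (at A)"
    by (intro derivative_intros)
  moreover have "det A * det (?B ** X) = det X" for X
    using matrix_inv_works(1)[OF assms] by (metis det_mul det_I mult.assoc mult.left_neutral)
  ultimately show ?thesis by simp
qed

lemma continuous_det: "continuous_on S (det :: real^'n::finite^'n \<Rightarrow> real)"
  unfolding det_def[abs_def] by (intro continuous_intros)

text \<open>The entries of the inverse become quotients of determinants, from which continuity of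
  inversion at an invertible matrix can be read off.\<close>

lemma matrix_inv_cramer:
  fixes A :: "real^'n::finite^'n"
  assumes "det A \<noteq> 0"
  shows "matrix_inv A = (\<chi> k l. det (\<chi> i j. if j = k then axis l 1 $ i else A $ i $ j) / det A)"
proof -
  have "A ** matrix_inv A = mat 1" using assms by (simp add: matrix_inv_works invertible_det_nz)
  then have "A *v (column l (matrix_inv A)) = axis l 1" for l
    by (auto simp: matrix_matrix_mult_def vec_eq_iff matrix_vector_mult_def column_def mat_def axis_def)
  then have "column l (matrix_inv A) = (\<chi> k. det(\<chi> i j. if j=k then axis l 1 $i else A$i$j) / det A)" for l
    using cramer[OF assms] by blast
  then show ?thesis by (simp add: vec_eq_iff column_def)
qed

lemma isCont_matrix_inv:
  fixes A :: "real^'n::finite^'n"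
  assumes "det A \<noteq> 0"
  shows "isCont matrix_inv A"
proof -
  have c: "isCont (det :: real^'n^'n \<Rightarrow> real) X" for X :: "real^'n^'n"
    using continuous_det by (rule continuous_on_interior[of UNIV]) simp
  have ent: "((\<lambda>X::real^'n^'n. X $ i $ j) \<longlongrightarrow> A $ i $ j) (at A)" for i j
    by (intro tendsto_vec_nth tendsto_ident_at)
  have "((\<lambda>X. (\<chi> i j. if j = k then axis l 1 $ i else X $ i $ j) :: real^'n^'n) \<longlongrightarrow>
      (\<chi> i j. if j = k then axis l 1 $ i else A $ i $ j)) (at A)" for k l
    by (rule vec_tendstoI, rule vec_tendstoI) (auto intro: ent)
  then have "((\<lambda>X. det ((\<chi> i j. if j = k then axis l 1 $ i else X $ i $ j) :: real^'n^'n)) \<longlongrightarrow>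
      det (\<chi> i j. if j = k then axis l 1 $ i else A $ i $ j)) (at A)" for k l
    by (rule isCont_tendsto_compose[OF c])
  moreover have dA: "(det \<longlongrightarrow> det A) (at A)" using c[of A] by (simp add: isCont_def)
  ultimately have "((\<lambda>X. \<chi> k l. det ((\<chi> i j. if j = k then axis l 1 $ i else X $ i $ j) :: real^'n^'n) / det X) \<longlongrightarrow>
      (\<chi> k l. det (\<chi> i j. if j = k then axis l 1 $ i else A $ i $ j) / det A)) (at A)"
    by (intro vec_tendstoI) (simp, intro tendsto_divide assms)
  moreover have "eventually (\<lambda>X. det X \<noteq> 0) (at A)"
    using dA assms by (rule tendsto_imp_eventually_ne)
  then have "eventually (\<lambda>X. (\<chi> k l. det ((\<chi> i j. if j = k then axis l 1 $ i else X $ i $ j)) / det X) = matrix_inv X) (at A)"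
    by eventually_elim (rule matrix_inv_cramer[symmetric])
  ultimately show ?thesis
    unfolding isCont_def matrix_inv_cramer[OF assms] by (rule Lim_transform_eventually)
qed

text \<open>From X^-1 - A^-1 = - X^-1 (X - A) A^-1 the error of the linear approximation is - (X^-1
  - A^-1) (X - A) A^-1. It is o(norm (X - A)) because inversion is already known to be
  continuous.\<close>

lemma has_derivative_matrix_inv:
  fixes A :: "real^'n::finite^'n"
  assumes "det A \<noteq> 0"
  shows "(matrix_inv has_derivative (\<lambda>H. - (matrix_inv A ** H ** matrix_inv A))) (at A)"
proof -
  let ?B = "matrix_inv A"
  interpret mm: bounded_bilinear "(**) :: real^'n^'n \<Rightarrow> real^'n^'n \<Rightarrow> real^'n^'n"
    by (rule bounded_bilinear_matrix_mult)
  obtain K where K: "\<And>X Y. norm ((X:: real^'n^'n) ** (Y:: real^'n^'n)) \<le> norm X * norm Y * K" "K > 0"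
    using mm.pos_bounded by metis
  have lim: "((\<lambda>X. norm (matrix_inv X - ?B) * K * (norm ?B * K)) \<longlongrightarrow> 0) (at A)"
    using isCont_matrix_inv[OF assms] unfolding isCont_def
    by (auto intro!: tendsto_eq_intros)
  have ev: "eventually (\<lambda>X. det X \<noteq> 0) (at A)"
    using continuous_det[of UNIV] assms
    by (metis UNIV_I continuous_on_def tendsto_imp_eventually_ne)
  then obtain e where e: "e > 0" "\<And>X. X \<noteq> A \<Longrightarrow> dist X A < e \<Longrightarrow> det X \<noteq> 0"
    unfolding eventually_at by auto
  show ?thesis
  proof (rule has_derivativeI_sandwich[OF e(1)])
    show "bounded_linear (\<lambda>H. - (?B ** H ** ?B))"
      by (intro bounded_linear_minus bounded_linear_compose[OF mm.bounded_linear_left mm.bounded_linear_right])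
  next
    show "((\<lambda>X. norm (matrix_inv X - ?B) * K * (norm ?B * K)) \<longlongrightarrow> 0) (at A)" by (rule lim)
  next
    fix X assume X: "X \<noteq> A" "dist X A < e"
    then have i: "matrix_inv X ** X = mat 1" "A ** ?B = mat 1"
      using e(2) assms by (auto intro!: matrix_inv_works simp: invertible_det_nz)
    then have "matrix_inv X - ?B = - (matrix_inv X ** ((X - A) ** ?B))"
      by (simp add: mm.diff_left mm.diff_right matrix_mul_assoc)
    then have "matrix_inv X - ?B - - (?B ** (X - A) ** ?B) = - ((matrix_inv X - ?B) ** ((X - A) ** ?B))"
      using mm.diff_left[of "matrix_inv X" ?B "(X - A) ** ?B"] by (simp add: matrix_mul_assoc)
    then have "norm (matrix_inv X - ?B - - (?B ** (X - A) ** ?B)) = norm ((matrix_inv X - ?B) ** ((X - A) ** ?B))"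
      by (simp only: norm_minus_cancel)
    also have "\<dots> \<le> norm (matrix_inv X - ?B) * norm ((X - A) ** ?B) * K" by (rule K)
    also have "\<dots> \<le> norm (matrix_inv X - ?B) * (norm (X - A) * norm ?B * K) * K"
      using K by (intro mult_right_mono mult_left_mono) auto
    finally show "norm (matrix_inv X - ?B - - (?B ** (X - A) ** ?B)) / norm (X - A)
        \<le> norm (matrix_inv X - ?B) * K * (norm ?B * K)"
      using X by (simp add: divide_simps mult_ac)
  qed
qed

section \<open>Positive definite matrices\<close>

definition pos_def :: "real^'n::finite^'n \<Rightarrow> bool" where
  "pos_def G \<longleftrightarrow> transpose G = G \<and> (\<forall>v. v \<noteq> 0 \<longrightarrow> 0 < v \<bullet> (G *v v))"

lemma det_pos_def_nonzero:
  fixes G :: "real^'n::finite^'n"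
  assumes "\<And>v. v \<noteq> 0 \<Longrightarrow> 0 < v \<bullet> (G *v v)"
  shows "det G \<noteq> 0"
proof
  assume "det G = 0"
  then have "\<not> invertible G" by (simp add: invertible_det_nz)
  then obtain v where "v \<noteq> 0" "G *v v = 0"
    using matrix_left_invertible_ker[of G] invertible_left_inverse by blast
  with assms[of v] show False by simp
qed

text \<open>The segment from the identity to \<open>G\<close> consists of matrices with positive
  quadratic form. The determinant never vanishes on it and equals 1 at one end, so it cannot change
  sign.\<close>

lemma pos_def_det_pos:
  fixes G :: "real^'n::finite^'n"
  assumes "pos_def G"
  shows "0 < det G"
proof (rule ccontr)
  assume neg: "\<not> 0 < det G"
  define P where "P s = (1 - s) *\<^sub>R mat 1 + s *\<^sub>R G" for s :: real
  have "continuous_on {0..1} (\<lambda>s. det (P s))"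
    unfolding P_def by (intro continuous_on_compose2[OF continuous_det[of UNIV]] continuous_intros) auto
  moreover have "det (P 1) \<le> 0" "0 \<le> det (P 0)" using neg by (auto simp: P_def)
  ultimately obtain s where s: "0 \<le> s" "s \<le> 1" "det (P s) = 0"
    using IVT2'[of "\<lambda>s. det (P s)" 1 0 0] by auto
  have "0 < v \<bullet> (P s *v v)" if "v \<noteq> 0" for v
  proof -
    have "v \<bullet> (P s *v v) = (1 - s) * (v \<bullet> v) + s * (v \<bullet> (G *v v))"
      by (simp add: P_def matrix_vector_mult_add_rdistrib scaleR_matrix_vector_assoc[symmetric] inner_add_right)
    moreover have "0 < v \<bullet> v" "0 < v \<bullet> (G *v v)" using that assms by (auto simp: pos_def_def)
    ultimately show ?thesis using s
      by (cases "s = 0") (auto intro!: add_nonneg_pos mult_nonneg_nonneg)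
  qed
  from det_pos_def_nonzero[OF this] s(3) show False by simp
qed

lemma pos_def_inv:
  assumes "pos_def G"
  shows "G ** matrix_inv G = mat 1" "matrix_inv G ** G = mat 1" "transpose (matrix_inv G) = matrix_inv G"
proof -
  have "invertible G" using pos_def_det_pos[OF assms] by (simp add: invertible_det_nz)
  then show "G ** matrix_inv G = mat 1" "matrix_inv G ** G = mat 1" by (rule matrix_inv_works)+
  then have "transpose (matrix_inv G ** G) = mat 1" by simp
  then have "G ** transpose (matrix_inv G) = mat 1" using assms by (simp add: matrix_transpose_mul pos_def_def)
  then show "transpose (matrix_inv G) = matrix_inv G" using matrix_inv_unique by metis
qed

lemma has_derivative_sqrt_det:
  assumes F: "(F has_derivative F') (at z within S)" and "pos_def (F z)"
  shows "((\<lambda>y. sqrt (det (F y))) has_derivative (\<lambda>v. sqrt (det (F z)) / 2 * trace (matrix_inv (F z) ** F' v))) (at z within S)"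
proof -
  have d: "0 < det (F z)" using assms by (simp add: pos_def_det_pos)
  then have "(det has_derivative (\<lambda>H. det (F z) * trace (matrix_inv (F z) ** H))) (at (F z))"
    by (intro has_derivative_det) (simp add: invertible_det_nz)
  from has_derivative_compose[OF F this]
  have "((\<lambda>y. sqrt (det (F y))) has_derivative (\<lambda>v. det (F z) * trace (matrix_inv (F z) ** F' v) * (inverse (sqrt (det (F z))) / 2))) (at z within S)"
    using d by (rule has_derivative_real_sqrt[rotated])
  moreover have "det (F z) * a * (inverse (sqrt (det (F z))) / 2) = sqrt (det (F z)) / 2 * a" for a
  proof -
    have "det (F z) * inverse (sqrt (det (F z))) = sqrt (det (F z))"
      using d by (simp add: field_simps)
    then show ?thesis by (metis (no_types, opaque_lifting) mult.assoc mult.commute times_divide_eq_left)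
  qed
  ultimately show ?thesis by (simp only:)
qed

lemma has_derivative_matrix_inv_comp:
  assumes F: "(F has_derivative F') (at z within S)" and "pos_def (F z)"
  shows "((\<lambda>y. matrix_inv (F y)) has_derivative (\<lambda>v. - (matrix_inv (F z) ** F' v ** matrix_inv (F z)))) (at z within S)"
  using has_derivative_compose[OF F has_derivative_matrix_inv] pos_def_det_pos[OF assms(2)] by simp

lemma continuous_on_matrix_inv:
  assumes "continuous_on S F" "\<And>z. z \<in> S \<Longrightarrow> pos_def (F z)"
  shows "continuous_on S (\<lambda>z. matrix_inv (F z))"
proof -
  have "continuous_on {G. pos_def G} (matrix_inv :: real^'b^'b \<Rightarrow> _)"
    using isCont_matrix_inv pos_def_det_pos by (intro continuous_at_imp_continuous_on) force
  from continuous_on_compose2[OF this assms(1)] show ?thesis using assms(2) by auto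
qed

lemma continuous_on_sqrt_det:
  fixes F :: "_ \<Rightarrow> real^'n::finite^'n"
  assumes "continuous_on S F"
  shows "continuous_on S (\<lambda>z. sqrt (det (F z)))"
  by (intro continuous_intros continuous_on_compose2[OF continuous_det assms]) auto

section \<open>Change of variables for arbitrary finite index types\<close>

text \<open>The change of variables theorem of the library needs a well-ordered index type; it is
  transported to an arbitrary finite index type along the following ordered copy.\<close>

typedef 'a ordered = "UNIV :: 'a set" morphisms unord ord ..

lemma bij_unord: "bij unord"
  by (metis UNIV_I bijI' unord_inject ord_inverse)

instance ordered :: (finite) finite
proof
  have "finite (unord ` (UNIV :: 'a ordered set))" by simp
  then show "finite (UNIV :: 'a ordered set)"
    using bij_unord by (metis bij_is_inj finite_imageD)
qed

definition index_nat :: "'a::finite ordered \<Rightarrow> nat" where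
  "index_nat = (SOME f. inj f)"

lemma inj_index_nat: "inj index_nat"
  unfolding index_nat_def using finite_imp_inj_to_nat_seg[of "UNIV :: 'a ordered set"]
  by (metis finite_class.finite_UNIV someI_ex)

instantiation ordered :: (finite) wellorder
begin

definition "x \<le> y \<longleftrightarrow> index_nat x \<le> index_nat y"
definition "x < y \<longleftrightarrow> index_nat x < index_nat y"

instance
proof
  fix P :: "'a ordered \<Rightarrow> bool" and a
  assume *: "\<And>x. (\<And>y. y < x \<Longrightarrow> P y) \<Longrightarrow> P x"
  show "P a"
    by (induction a rule: measure_induct_rule[of index_nat]) (rule *, simp add: less_ordered_def)
next
  fix x y :: "'a ordered"
  assume "x \<le> y" "y \<le> x"
  then have "index_nat x = index_nat y" by (simp add: less_eq_ordered_def)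
  then show "x = y" by (rule injD[OF inj_index_nat])
qed (auto simp: less_eq_ordered_def less_ordered_def)

end

text \<open>Conjugating a permutation by \<open>u\<close> preserves its sign and matches the Leibniz
  terms of the two matrices one by one.\<close>

lemma det_reindex:
  fixes A :: "real^'n::finite^'n" and u :: "'m::finite \<Rightarrow> 'n"
  assumes "bij u"
  shows "det (\<chi> i j. A $ u i $ u j) = det A"
proof -
  have inj: "inj u" "inj (inv u)" using assms by (auto simp: bij_is_inj bij_imp_bij_inv)
  have bb: "bij_betw u UNIV UNIV" "bij_betw (inv u) UNIV UNIV" using assms by (auto simp: bij_imp_bij_inv)
  have 1: "map_permutation UNIV (inv u) (map_permutation UNIV u p) = p" if "p permutes UNIV" for p
    by (rule map_permutation_compose_inv[OF bb(1) that]) (use inj in auto)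
  have 2: "map_permutation UNIV u (map_permutation UNIV (inv u) p) = p" if "p permutes UNIV" for p
    by (rule map_permutation_compose_inv[OF bb(2) that]) (use assms in \<open>auto simp: bij_is_surj surj_f_inv_f\<close>)
  have 3: "of_int (sign (map_permutation UNIV u p)) * (\<Prod>i\<in>UNIV. A $ i $ map_permutation UNIV u p i)
      = of_int (sign p) * (\<Prod>i\<in>UNIV. A $ u i $ u (p i))" if "p permutes UNIV" for p
  proof -
    have "(\<Prod>i\<in>UNIV. A $ i $ map_permutation UNIV u p i) = (\<Prod>i\<in>UNIV. A $ u i $ map_permutation UNIV u p (u i))"
      by (rule prod.reindex_bij_betw[OF bb(1), symmetric])
    then show ?thesis
      using that inj by (simp add: sign_map_permutation map_permutation_apply)
  qed
  show ?thesis
    unfolding det_def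
    by (rule sum.reindex_bij_witness[of _ "map_permutation UNIV (inv u)" "map_permutation UNIV u"])
       (use 1 2 3 bb in \<open>auto intro: map_permutation_permutes\<close>)
qed

lemma prod_Basis_cart: "(\<Prod>b\<in>(Basis :: (real^'n::finite) set). f b) = (\<Prod>i\<in>UNIV. f (axis i 1))"
proof -
  have B: "(Basis :: (real^'n) set) = range (\<lambda>i. axis i 1)" by (auto simp: Basis_vec_def)
  have "inj (\<lambda>i::'n. axis i (1::real))" by (auto simp: inj_on_def axis_eq_axis)
  from prod.reindex[OF this] show ?thesis unfolding B by (simp add: o_def)
qed

text \<open>Lebesgue measure is determined by its values on boxes. Relabelling coordinates turns a
  box into a box with the same side lengths in another order.\<close>

lemma lborel_distr_reindex:
  fixes u :: "'m::finite \<Rightarrow> 'n::finite"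
  assumes u: "bij u"
  shows "distr lborel borel (\<lambda>x::real^'n. (\<chi> i. x $ u i) :: real^'m) = lborel"
proof (rule lborel_eqI[symmetric])
  fix l v :: "real^'m"
  assume le: "\<And>b. b \<in> Basis \<Longrightarrow> l \<bullet> b \<le> v \<bullet> b"
  have le': "l $ i \<le> v $ i" for i
    using le[of "axis i 1"] by (auto simp: Basis_vec_def inner_axis)
  have m: "(\<lambda>x::real^'n. (\<chi> i. x $ u i) :: real^'m) \<in> measurable lborel borel"
    unfolding measurable_lborel2 by (rule borel_measurable_continuous_onI) (intro continuous_intros)
  have iu: "inv u (u i) = i" "u (inv u k) = k" for i k
    using u by (auto simp: bij_is_inj bij_is_surj surj_f_inv_f)
  let ?Q = "\<lambda>w::real^'m. (\<chi> k. w $ inv u k) :: real^'n"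
  have "(\<lambda>x::real^'n. (\<chi> i. x $ u i) :: real^'m) -` box l v = box (?Q l) (?Q v)"
    
    unfolding set_eq_iff vimage_eq mem_box_cart using iu by (simp; safe; metis)
  moreover have "emeasure lborel (box (?Q l) (?Q v)) = (\<Prod>i\<in>UNIV. v $ inv u i - l $ inv u i)"
  proof (subst emeasure_lborel_box)
    show "?Q l \<bullet> b \<le> ?Q v \<bullet> b" if "b \<in> Basis" for b
      using that le' by (auto simp: Basis_vec_def inner_axis)
  qed (simp add: prod_Basis_cart cart_eq_inner_axis[symmetric])
  moreover have "(\<Prod>i\<in>UNIV. v $ inv u i - l $ inv u i) = (\<Prod>i\<in>UNIV. v $ i - l $ i)"
    by (rule prod.reindex_bij_betw) (simp add: u bij_imp_bij_inv)
  ultimately show "emeasure (distr lborel borel (\<lambda>x::real^'n. \<chi> i. x $ u i)) (box l v) = (\<Prod>b\<in>Basis. (v - l) \<bullet> b)"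
    by (simp add: emeasure_distr[OF m] prod_Basis_cart cart_eq_inner_axis[symmetric])
qed simp

text \<open>The underlying theorem says that one function has gauge integral b exactly when the
  other does. For nonnegative measurable functions this passes to \<open>nn_integral\<close>: a
  finite value on either side carries over to the other, and otherwise both are infinite.\<close>

lemma nn_integral_cov_wellorder:
  fixes f :: "real^'m::{finite,wellorder} \<Rightarrow> real" and g h :: "real^'m::_ \<Rightarrow> real^'m::_"
  assumes der_g: "\<And>x. x \<in> S \<Longrightarrow> (g has_derivative g' x) (at x within S)"
    and der_h: "\<And>y. y \<in> T \<Longrightarrow> (h has_derivative h' y) (at y within T)"
    and f0: "\<And>y. y \<in> T \<Longrightarrow> 0 \<le> f y"
    and hg: "\<And>x. x \<in> S \<Longrightarrow> g x \<in> T \<and> h(g x) = x"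
    and gh: "\<And>y. y \<in> T \<Longrightarrow> h y \<in> S \<and> g(h y) = y"
    and id: "\<And>y. y \<in> T \<Longrightarrow> h' y \<circ> g'(h y) = id"
    and mT: "(\<lambda>y. if y \<in> T then f y else 0) \<in> borel_measurable borel"
    and mS: "(\<lambda>x. if x \<in> S then \<bar>det (matrix (g' x))\<bar> * f (g x) else 0) \<in> borel_measurable borel"
  shows "(\<integral>\<^sup>+y. ennreal (if y \<in> T then f y else 0) \<partial>lborel)
    = (\<integral>\<^sup>+x. ennreal (if x \<in> S then \<bar>det (matrix (g' x))\<bar> * f (g x) else 0) \<partial>lborel)"
    (is "integral\<^sup>N lborel (\<lambda>y. ennreal (?F y)) = integral\<^sup>N lborel (\<lambda>y. ennreal (?G y))")
proof -
  have iff: "(?G has_integral b) UNIV \<longleftrightarrow> (?F has_integral b) UNIV" for b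
    using cov_invertible_nonneg_eq[where b=b and h=h and f=f, OF der_g der_h f0 hg gh id] by (simp only: has_integral_restrict_UNIV)
  have F0: "0 \<le> ?F y" and G0: "0 \<le> ?G y" for y using f0 hg by auto
  show ?thesis
  proof (cases "integral\<^sup>N lborel (\<lambda>y. ennreal (?F y))" rule: ennreal_cases)
    case (real r)
    then have "(?F has_integral r) UNIV" by (intro nn_integral_has_integral mT F0) auto
    then have "(?G has_integral r) UNIV" using iff by blast
    then show ?thesis using nn_integral_has_integral_lborel[OF mS G0] real by simp
  next
    case top
    show ?thesis
    proof (cases "integral\<^sup>N lborel (\<lambda>y. ennreal (?G y))" rule: ennreal_cases)
      case (real r)
      then have "(?G has_integral r) UNIV" by (intro nn_integral_has_integral mS G0) auto
      then have "(?F has_integral r) UNIV" using iff by blast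
      then show ?thesis using nn_integral_has_integral_lborel[OF mT F0] real by simp
    qed (use top in simp)
  qed
qed

text \<open>\<open>P\<close> and \<open>Q\<close> relabel coordinates between the original and the
  ordered index type. Conjugating with them preserves Lebesgue measure and Jacobian determinants.
  \<open>S\<close> and \<open>T\<close> may be arbitrary sets with derivatives taken within them, so
  that coordinate images of Borel sets can be inserted later.\<close>

theorem nn_integral_change_of_variables:
  fixes f :: "real^'n::finite \<Rightarrow> real" and g h :: "real^'n \<Rightarrow> real^'n"
  assumes der_g: "\<And>x. x \<in> S \<Longrightarrow> (g has_derivative g' x) (at x within S)"
    and der_h: "\<And>y. y \<in> T \<Longrightarrow> (h has_derivative h' y) (at y within T)"
    and f0: "\<And>y. y \<in> T \<Longrightarrow> 0 \<le> f y"
    and hg: "\<And>x. x \<in> S \<Longrightarrow> g x \<in> T \<and> h(g x) = x"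
    and gh: "\<And>y. y \<in> T \<Longrightarrow> h y \<in> S \<and> g(h y) = y"
    and id: "\<And>y. y \<in> T \<Longrightarrow> h' y \<circ> g'(h y) = id"
    and mT: "(\<lambda>y. if y \<in> T then f y else 0) \<in> borel_measurable borel"
    and mS: "(\<lambda>x. if x \<in> S then \<bar>det (matrix (g' x))\<bar> * f (g x) else 0) \<in> borel_measurable borel"
  shows "(\<integral>\<^sup>+y. ennreal (if y \<in> T then f y else 0) \<partial>lborel)
    = (\<integral>\<^sup>+x. ennreal (if x \<in> S then \<bar>det (matrix (g' x))\<bar> * f (g x) else 0) \<partial>lborel)"
proof -
  define P :: "real^'n \<Rightarrow> real^'n ordered" where "P x = (\<chi> i. x $ unord i)" for x
  define Q :: "real^'n ordered \<Rightarrow> real^'n" where "Q y = (\<chi> i. y $ ord i)" for y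
  have [simp]: "Q (P x) = x" "P (Q y) = y" for x y
    by (auto simp: P_def Q_def vec_eq_iff ord_inverse unord_inverse)
  have lin: "bounded_linear P" "bounded_linear Q"
    unfolding linear_conv_bounded_linear[symmetric] by (auto intro!: linearI simp: P_def Q_def vec_eq_iff)
  have "bij (ord :: 'n \<Rightarrow> _)" by (metis UNIV_I bijI' unord_inverse ord_inject)
  from lborel_distr_reindex[OF this]
  have dQ: "distr lborel borel Q = lborel" unfolding Q_def[abs_def] .
  have [measurable]: "Q \<in> measurable lborel borel" "Q \<in> measurable borel borel"
    using linear_continuous_on[OF lin(2)] by (auto intro!: borel_measurable_continuous_onI)
  have tr: "(\<integral>\<^sup>+y. ennreal (F y) \<partial>lborel) = (\<integral>\<^sup>+y. ennreal (F (Q y)) \<partial>lborel)"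
    if [measurable]: "F \<in> borel_measurable borel" for F
    by (subst dQ[symmetric], subst nn_integral_distr) auto
  have mem: "Q y \<in> S \<longleftrightarrow> y \<in> P ` S" "Q y \<in> T \<longleftrightarrow> y \<in> P ` T" for y
    by (metis \<open>\<And>y. P (Q y) = y\<close> \<open>\<And>x. Q (P x) = x\<close> image_iff)+
  have der: "((\<lambda>x. P (k (Q x))) has_derivative (\<lambda>v. P (k' (Q x) (Q v)))) (at x within P ` R)"
    if "\<And>x. x \<in> R \<Longrightarrow> (k has_derivative k' x) (at x within R)" "x \<in> P ` R" for k k' R x
  proof -
    have "Q ` P ` R = R" "Q x \<in> R" using that(2) by (auto simp: image_image)
    then have "((\<lambda>x. k (Q x)) has_derivative (\<lambda>v. k' (Q x) (Q v))) (at x within P ` R)"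
      using has_derivative_in_compose[OF bounded_linear_imp_has_derivative[OF lin(2)], of k "k' (Q x)" x "P ` R"] that(1)
      by simp
    then show ?thesis by (rule bounded_linear.has_derivative[OF lin(1)])
  qed
  have det: "det (matrix (\<lambda>v. P (k (Q v)))) = det (matrix k)" for k
  proof -
    have "Q (axis j 1) = axis (unord j) 1" for j

      unfolding Q_def vec_eq_iff axis_def by (simp, metis ord_inverse unord_inverse UNIV_I)
    then have "matrix (\<lambda>v. P (k (Q v))) = (\<chi> i j. matrix k $ unord i $ unord j)"
      by (simp add: matrix_def P_def)
    then show ?thesis using det_reindex[OF bij_unord] by simp
  qed
  have det': "det (matrix (\<lambda>v. P (g' z (Q v)))) = det (matrix (g' z))" for z by (rule det)
  have m1: "(\<lambda>y. if y \<in> P ` T then f (Q y) else 0) \<in> borel_measurable borel"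
    using measurable_compose[OF \<open>Q \<in> measurable borel borel\<close> mT] by (simp add: mem)
  have m2: "(\<lambda>y. if y \<in> P ` S then \<bar>det (matrix (g' (Q y)))\<bar> * f (g (Q y)) else 0) \<in> borel_measurable borel"
    using measurable_compose[OF \<open>Q \<in> measurable borel borel\<close> mS] by (simp add: mem)
  have "(\<integral>\<^sup>+y. ennreal (if y \<in> P ` T then f (Q y) else 0) \<partial>lborel)
    = (\<integral>\<^sup>+x. ennreal (if x \<in> P ` S then \<bar>det (matrix (\<lambda>v. P (g' (Q x) (Q v))))\<bar> * f (Q (P (g (Q x)))) else 0) \<partial>lborel)"
  proof (rule nn_integral_cov_wellorder[where h="\<lambda>x. P (h (Q x))" and h'="\<lambda>x v. P (h' (Q x) (Q v))"])
    show "(\<lambda>v. P (h' (Q y) (Q v))) \<circ> (\<lambda>v. P (g' (Q (P (h (Q y)))) (Q v))) = id" if "y \<in> P ` T" for y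
      using that id by (auto simp: fun_eq_iff)
  qed (use der[OF der_g] der[OF der_h] f0 hg gh m1 m2 in \<open>auto simp: det' cong: if_cong\<close>)
  then show ?thesis
    unfolding tr[OF mT] tr[OF mS] by (simp add: mem det' cong: if_cong)
qed

section \<open>Continuously differentiable functions and integration by parts\<close>

text \<open>Continuity of the derivative is asked for one direction at a time. In finite dimension
  this agrees with continuity in operator norm, and no space of linear maps has to be
  introduced.\<close>

definition C1_on :: "'a::euclidean_space set \<Rightarrow> ('a \<Rightarrow> 'b::real_normed_vector) \<Rightarrow> bool" where
  "C1_on V f \<longleftrightarrow> (\<exists>D. (\<forall>x\<in>V. (f has_derivative D x) (at x)) \<and> (\<forall>v. continuous_on V (\<lambda>x. D x v)))"

lemma C1_onI:
  assumes "\<And>x. x \<in> V \<Longrightarrow> (f has_derivative D x) (at x)" "\<And>v. continuous_on V (\<lambda>x. D x v)"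
  shows "C1_on V f"
  using assms unfolding C1_on_def by blast

lemma C1_onE:
  assumes "C1_on V f"
  obtains D where "\<And>x. x \<in> V \<Longrightarrow> (f has_derivative D x) (at x)" "\<And>v. continuous_on V (\<lambda>x. D x v)"
  using assms unfolding C1_on_def by blast

lemma C1_on_iff:
  "C1_on V f \<longleftrightarrow> (\<forall>x\<in>V. f differentiable (at x)) \<and> (\<forall>v. continuous_on V (\<lambda>x. frechet_derivative f (at x) v))"
proof
  assume "C1_on V f"
  then obtain D where D: "\<And>x. x \<in> V \<Longrightarrow> (f has_derivative D x) (at x)" "\<And>v. continuous_on V (\<lambda>x. D x v)"
    by (rule C1_onE) blast
  have "D x = frechet_derivative f (at x)" if "x \<in> V" for x
    using D(1)[OF that] by (rule frechet_derivative_at)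
  then have "continuous_on V (\<lambda>x. frechet_derivative f (at x) v)" for v
    using D(2)[of v] by (simp cong: continuous_on_cong)
  then show "(\<forall>x\<in>V. f differentiable (at x)) \<and> (\<forall>v. continuous_on V (\<lambda>x. frechet_derivative f (at x) v))"
    using D(1) by (auto simp: differentiable_def)
next
  assume "(\<forall>x\<in>V. f differentiable (at x)) \<and> (\<forall>v. continuous_on V (\<lambda>x. frechet_derivative f (at x) v))"
  then show "C1_on V f"
    by (intro C1_onI[of V f "\<lambda>x. frechet_derivative f (at x)"]) (auto simp: frechet_derivative_works[symmetric])
qed

lemma C1_on_continuous: "C1_on V f \<Longrightarrow> continuous_on V f"
  unfolding C1_on_iff by (meson continuous_at_imp_continuous_on differentiable_imp_continuous_within)

lemma C1_on_cong:
  assumes "open V" "C1_on V f" "\<And>x. x \<in> V \<Longrightarrow> f x = g x"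
  shows "C1_on V g"
  using assms unfolding C1_on_def by (meson has_derivative_transform_within_open)

lemma C1_on_Un:
  assumes "open V" "open W" "C1_on V f" "C1_on W f"
  shows "C1_on (V \<union> W) f"
  using assms unfolding C1_on_iff by (auto intro: continuous_on_open_Un)

lemma C1_on_const: "C1_on V (\<lambda>x. c)"
  by (rule C1_onI[of _ _ "\<lambda>x v. 0"]) auto

lemma C1_on_zero:
  assumes "open V" "\<And>x. x \<in> V \<Longrightarrow> f x = 0"
  shows "C1_on V f"
  by (rule C1_on_cong[OF assms(1) C1_on_const]) (simp add: assms)

lemma C1_on_add:
  assumes "C1_on V f" "C1_on V g"
  shows "C1_on V (\<lambda>x. f x + g x)"
proof -
  obtain D E where D: "\<And>x. x \<in> V \<Longrightarrow> (f has_derivative D x) (at x)" "\<And>v. continuous_on V (\<lambda>x. D x v)"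
    and E: "\<And>x. x \<in> V \<Longrightarrow> (g has_derivative E x) (at x)" "\<And>v. continuous_on V (\<lambda>x. E x v)"
    using assms unfolding C1_on_def by blast
  show ?thesis
    by (rule C1_onI, rule has_derivative_add[OF D(1) E(1)]) (auto intro: continuous_on_add D E)
qed

lemma C1_on_sum:
  assumes "\<And>i. i \<in> I \<Longrightarrow> C1_on V (f i)"
  shows "C1_on V (\<lambda>x. \<Sum>i\<in>I. f i x)"
  using assms by (induction I rule: infinite_finite_induct) (auto intro: C1_on_const C1_on_add)

lemma C1_on_bounded_bilinear:
  assumes "bounded_bilinear B" "C1_on V f" "C1_on V g"
  shows "C1_on V (\<lambda>x. B (f x) (g x))"
proof -
  obtain D E where D: "\<And>x. x \<in> V \<Longrightarrow> (f has_derivative D x) (at x)" "\<And>v. continuous_on V (\<lambda>x. D x v)"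
    and E: "\<And>x. x \<in> V \<Longrightarrow> (g has_derivative E x) (at x)" "\<And>v. continuous_on V (\<lambda>x. E x v)"
    using assms(2,3) unfolding C1_on_def by blast
  show ?thesis
    by (rule C1_onI, rule bounded_bilinear.FDERIV[OF assms(1) D(1) E(1)], assumption, assumption)
       (intro continuous_on_add bounded_bilinear.continuous_on[OF assms(1)] D E C1_on_continuous assms)
qed

lemma C1_on_bounded_linear:
  assumes "bounded_linear L" "C1_on V f"
  shows "C1_on V (\<lambda>x. L (f x))"
proof -
  obtain D where D: "\<And>x. x \<in> V \<Longrightarrow> (f has_derivative D x) (at x)" "\<And>v. continuous_on V (\<lambda>x. D x v)"
    using assms(2) unfolding C1_on_def by blast
  show ?thesis
    by (rule C1_onI, rule bounded_linear.has_derivative[OF assms(1) D(1)], assumption)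
       (intro bounded_linear.continuous_on[OF assms(1)] D)
qed

lemmas C1_on_mult = C1_on_bounded_bilinear[OF bounded_bilinear_mult]
lemmas C1_on_vec_nth = C1_on_bounded_linear[OF bounded_linear_vec_nth]

lemma C1_on_compose:
  fixes \<phi> :: "'b::euclidean_space \<Rightarrow> 'c::real_normed_vector"
  assumes "C1_on W \<phi>" "C1_on V \<tau>" "\<And>x. x \<in> V \<Longrightarrow> \<tau> x \<in> W"
  shows "C1_on V (\<lambda>x. \<phi> (\<tau> x))"
proof -
  obtain D E where D: "\<And>x. x \<in> W \<Longrightarrow> (\<phi> has_derivative D x) (at x)" "\<And>v. continuous_on W (\<lambda>x. D x v)"
    and E: "\<And>x. x \<in> V \<Longrightarrow> (\<tau> has_derivative E x) (at x)" "\<And>v. continuous_on V (\<lambda>x. E x v)"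
    using assms(1,2) unfolding C1_on_def by blast
  \<comment> \<open>The direction \<open>E x v\<close> varies with \<open>x\<close>, whereas
    continuity of \<open>D\<close> is known for fixed directions only. Expanding in a basis leaves
    fixed directions with continuous coefficients.\<close>
  have eq: "D (\<tau> x) (E x v) = (\<Sum>b\<in>Basis. (E x v \<bullet> b) *\<^sub>R D (\<tau> x) b)" if "x \<in> V" for x v
  proof -
    have "linear (D (\<tau> x))" using D(1) assms(3) that has_derivative_linear by blast
    then show ?thesis
      by (subst euclidean_representation[of "E x v", symmetric]) (simp only: linear_sum linear_scale)
  qed
  have "continuous_on V (\<lambda>x. \<Sum>b\<in>Basis. (E x v \<bullet> b) *\<^sub>R D (\<tau> x) b)" for v
    by (intro continuous_intros E continuous_on_compose2[OF D(2) C1_on_continuous[OF assms(2)]])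
       (use assms(3) in auto)
  then show ?thesis
    by (intro C1_onI[of V _ "\<lambda>x v. D (\<tau> x) (E x v)"] has_derivative_compose[OF E(1) D(1)])
       (auto simp: eq assms(3) cong: continuous_on_cong)
qed

lemma C1_on_divide:
  fixes f g :: "'a::euclidean_space \<Rightarrow> real"
  assumes "C1_on V f" "C1_on V g" "\<And>x. x \<in> V \<Longrightarrow> g x \<noteq> 0"
  shows "C1_on V (\<lambda>x. f x / g x)"
proof -
  have "C1_on (- {0}) (inverse :: real \<Rightarrow> real)"
    by (rule C1_onI, rule has_derivative_inverse') (auto intro!: continuous_intros)
  from C1_on_compose[OF this assms(2)] show ?thesis
    using C1_on_mult[OF assms(1)] assms(3) by (simp add: divide_inverse)
qed

lemma C1_on_inner_diff_sq: "C1_on V (\<lambda>x. (x - a) \<bullet> (x - a))"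
  by (rule C1_onI[of _ _ "\<lambda>x v. (x - a) \<bullet> v + v \<bullet> (x - a)"]) (auto intro!: derivative_eq_intros continuous_intros)

text \<open>The radial profile of the bump functions. Squaring removes the corner of the positive
  part at 0, where the difference quotient is bounded by the absolute value of
  \<open>s\<close>.\<close>

lemma C1_on_pos_part_square: "C1_on V (\<lambda>s::real. (max 0 s)\<^sup>2)"
proof -
  have "((\<lambda>s::real. (max 0 s)\<^sup>2) has_derivative (\<lambda>v. 2 * max 0 x * v)) (at x)" for x :: real
  proof -
    consider "x > 0" | "x < 0" | "x = 0" by linarith
    then show ?thesis
    proof cases
      case 1
      have "((\<lambda>s. s\<^sup>2) has_derivative (\<lambda>v. 2 * max 0 x * v)) (at x)"
        using 1 by (auto intro!: derivative_eq_intros)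
      then show ?thesis
        by (rule has_derivative_transform_within_open[of _ _ _ _ "{0<..}"]) (use 1 in auto)
    next
      case 2
      have "((\<lambda>s. 0) has_derivative (\<lambda>v. 2 * max 0 x * v)) (at x)"
        using 2 by (auto intro!: derivative_eq_intros)
      then show ?thesis
        by (rule has_derivative_transform_within_open[of _ _ _ _ "{..<0}"]) (use 2 in auto)
    next
      case 3
      have "((\<lambda>s::real. (max 0 s)\<^sup>2) has_derivative (\<lambda>v. 0)) (at 0)"
      proof (rule has_derivativeI_sandwich[of 1])
        show "((\<lambda>s::real. \<bar>s\<bar>) \<longlongrightarrow> 0) (at 0)" by (auto intro!: tendsto_eq_intros)
        show "norm ((max 0 y)\<^sup>2 - (max 0 0)\<^sup>2 - 0) / norm (y - 0) \<le> \<bar>y\<bar>" if "y \<noteq> 0" for y :: real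
          using that by (auto simp: max_def power2_eq_square divide_simps)
      qed auto
      then show ?thesis using 3 by simp
    qed
  qed
  then show ?thesis by (intro C1_onI) (auto intro!: continuous_intros)
qed

lemma pderiv_at_eq:
  assumes "(u has_derivative D) (at x)"
  shows "pderiv_at i u x = D (axis i 1)"
  unfolding pderiv_at_def using frechet_derivative_at[OF assms] by simp

lemma C1_on_pderiv_continuous: "C1_on V u \<Longrightarrow> continuous_on V (pderiv_at i u)"
  unfolding C1_on_iff pderiv_at_def by simp

text \<open>The components of the differential of \<open>u\<close>, a covector; applying the inverse
  metric turns it into the gradient.\<close>

definition diff_vec :: "(real^'n::finite \<Rightarrow> real) \<Rightarrow> real^'n \<Rightarrow> real^'n" where
  "diff_vec u x = (\<chi> j. pderiv_at j u x)"

lemma linear_eq_sum_axis: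
  fixes D :: "real^'n::finite \<Rightarrow> 'b::real_vector"
  assumes "linear D"
  shows "D v = (\<Sum>i\<in>UNIV. (v $ i) *\<^sub>R D (axis i 1))"
  by (subst basis_expansion[of v, symmetric])
     (simp only: linear_sum[OF assms] linear_scale[OF assms] scalar_mult_eq_scaleR)

lemma has_derivative_diff_vec:
  assumes "(u has_derivative D) (at x)"
  shows "D v = v \<bullet> diff_vec u x" 
  using linear_eq_sum_axis[OF has_derivative_linear[OF assms], of v] pderiv_at_eq[OF assms]
  by (simp add: diff_vec_def inner_vec_def)

lemma C1_on_diff_vec_continuous: "C1_on V u \<Longrightarrow> continuous_on V (diff_vec u)"
  unfolding diff_vec_def[abs_def] by (intro continuous_on_vec_lambda C1_on_pderiv_continuous)

lemma smooth_on_imp_C1_on: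
  assumes "open V" "smooth_on V f"
  shows "C1_on V f"
proof -
  have d: "f differentiable (at x)" if "x \<in> V" for x
    using assms that unfolding smooth_on_def differentiable_on_def
    by (metis at_within_open empty_iff empty_set iter_partial.simps(1) subsetI)
  have "continuous_on V (\<lambda>x. frechet_derivative f (at x) b)" if "b \<in> Basis" for b
  proof -
    have "iter_partial V [b] f differentiable_on V"
      using assms(2) that unfolding smooth_on_def by (metis empty_set list.simps(15) empty_subsetI insert_subset)
    then have "continuous_on V (iter_partial V [b] f)" by (rule differentiable_imp_continuous_on)
    then show ?thesis
      by (rule continuous_on_cong[THEN iffD1, rotated 2]) (use assms(1) in \<open>auto simp: at_within_open[of _ V]\<close>)
  qed
  moreover have "frechet_derivative f (at x) v = (\<Sum>b\<in>Basis. (v \<bullet> b) *\<^sub>R frechet_derivative f (at x) b)"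
    if "x \<in> V" for x v
  proof -
    have L: "linear (frechet_derivative f (at x))" by (rule linear_frechet_derivative[OF d[OF that]])
    show ?thesis
      by (subst euclidean_representation[of v, symmetric]) (simp only: linear_sum[OF L] linear_scale[OF L])
  qed
  moreover have "continuous_on V (\<lambda>x. \<Sum>b\<in>Basis. (v \<bullet> b) *\<^sub>R frechet_derivative f (at x) b)" for v
    by (intro continuous_on_sum continuous_on_scaleR continuous_on_const calculation(1))
  ultimately have "continuous_on V (\<lambda>x. frechet_derivative f (at x) v)" for v
    by (metis (no_types, lifting) continuous_on_cong)
  with d show ?thesis by (simp add: C1_on_iff)
qed

lemma iter_partial_append: "iter_partial S (us @ vs) f = iter_partial S us (iter_partial S vs f)"
  by (induction us) auto

lemma smooth_on_imp_C1_on_pderiv: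
  assumes "open V" "smooth_on V u"
  shows "C1_on V (pderiv_at j u)"
proof -
  have b: "axis j 1 \<in> (Basis :: (real^'a) set)" by (auto simp: Basis_vec_def)
  have "smooth_on V (iter_partial V [axis j 1] u)"
    unfolding smooth_on_def iter_partial_append[symmetric]
    using assms(2) b by (auto simp: smooth_on_def)
  from C1_on_cong[OF assms(1) smooth_on_imp_C1_on[OF assms(1) this]]
  show ?thesis using assms(1) by (simp add: pderiv_at_def[abs_def] at_within_open[of _ V])
qed

lemma integrable_compact_support:
  fixes f :: "'a::euclidean_space \<Rightarrow> real"
  assumes "compact K" "continuous_on K f" "\<And>x. x \<notin> K \<Longrightarrow> f x = 0"
  shows "integrable lborel f"
proof -
  have "(\<lambda>x. indicator K x *\<^sub>R f x) = f" using assms(3) by (auto simp: indicator_def fun_eq_iff)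
  with borel_integrable_compact[OF assms(1,2)] show ?thesis by simp
qed

text \<open>Translation invariance of the integral, differentiated at translation by zero.\<close>

lemma integral_pderiv_compact_support:
  fixes \<psi> :: "real^'n::finite \<Rightarrow> real"
  assumes C1: "C1_on UNIV \<psi>" and K: "compact K" "\<And>x. x \<notin> K \<Longrightarrow> \<psi> x = 0"
  shows "integrable lborel (pderiv_at k \<psi>)" "integral\<^sup>L lborel (pderiv_at k \<psi>) = 0"
proof -
  have cp: "continuous_on UNIV (pderiv_at k \<psi>)" by (rule C1_on_pderiv_continuous[OF C1])
  have cpsi: "continuous_on UNIV \<psi>" by (rule C1_on_continuous[OF C1])
  have der: "(\<psi> has_derivative (\<lambda>v. v \<bullet> diff_vec \<psi> x)) (at x)" for x
  proof -
    obtain D where D: "(\<psi> has_derivative D) (at x)" using C1 unfolding C1_on_def by blast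
    then show ?thesis by (rule has_derivative_eq_rhs) (simp add: fun_eq_iff has_derivative_diff_vec[OF D])
  qed
  have p0: "pderiv_at k \<psi> x = 0" if "x \<notin> K" for x
  proof -
    have "(\<psi> has_derivative (\<lambda>v. 0)) (at x)"
      by (rule has_derivative_transform_within_open[of "\<lambda>x. 0" _ _ _ "- K"])
         (use that K compact_imp_closed in \<open>auto intro: open_Compl\<close>)
    then show ?thesis by (rule pderiv_at_eq)
  qed
  show int: "integrable lborel (pderiv_at k \<psi>)"
    by (rule integrable_compact_support[OF K(1) continuous_on_subset[OF cp]]) (auto simp: p0)
  obtain M where M: "\<And>x. \<bar>pderiv_at k \<psi> x\<bar> \<le> M" "M \<ge> 0"
  proof -
    have "bounded (pderiv_at k \<psi> ` K)"
      by (intro compact_imp_bounded compact_continuous_image continuous_on_subset[OF cp] K) auto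
    then obtain M where "\<And>x. x \<in> K \<Longrightarrow> \<bar>pderiv_at k \<psi> x\<bar> \<le> M" by (auto simp: bounded_iff)
    then have "\<bar>pderiv_at k \<psi> x\<bar> \<le> max M 0" for x using p0[of x] by (cases "x \<in> K") fastforce+
    then show ?thesis using that by (metis max.cobounded2)
  qed
  obtain R where R: "\<And>x. x \<in> K \<Longrightarrow> norm x \<le> R" using compact_imp_bounded[OF K(1)] by (auto simp: bounded_iff)
  let ?e = "axis k 1 :: real^'n"
  define h where "h m = inverse (real (Suc m))" for m
  have h: "0 < h m" "h m \<le> 1" "h \<longlonglongrightarrow> 0" for m
    unfolding h_def using LIMSEQ_inverse_real_of_nat by (auto simp: divide_simps)
  define q where "q m x = (\<psi> (h m *\<^sub>R ?e + x) - \<psi> x) / h m" for m x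
  have ipsi: "integrable lborel \<psi>"
    by (rule integrable_compact_support[OF K(1) continuous_on_subset[OF cpsi] K(2)]) auto
  have sh: "integrable lborel (\<lambda>x. \<psi> (c + x)) \<and> integral\<^sup>L lborel (\<lambda>x. \<psi> (c + x)) = integral\<^sup>L lborel \<psi>" for c
  proof -
    have [measurable]: "\<psi> \<in> borel_measurable borel" using cpsi by (rule borel_measurable_continuous_onI)
    have "integrable (distr lborel borel ((+) c)) \<psi>" using ipsi by (simp add: lborel_distr_plus)
    then have "integrable lborel (\<lambda>x. \<psi> (c + x))" by (subst (asm) integrable_distr_eq) auto
    moreover have "integral\<^sup>L (distr lborel borel ((+) c)) \<psi> = integral\<^sup>L lborel (\<lambda>x. \<psi> (c + x))"
      by (rule integral_distr) auto
    ultimately show ?thesis by (simp add: lborel_distr_plus)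
  qed
  have q0: "integral\<^sup>L lborel (q m) = 0" for m
    unfolding q_def[abs_def] using sh[of "h m *\<^sub>R ?e"] ipsi by simp
  have mvt: "\<bar>q m x\<bar> \<le> M" for m x
  proof -
    have "norm (\<psi> (x + h m *\<^sub>R ?e) - \<psi> x) \<le> M * norm (h m *\<^sub>R ?e) "
    proof -
      have "((\<lambda>s. \<psi> (x + s *\<^sub>R ?e)) has_derivative (\<lambda>r. (r *\<^sub>R ?e) \<bullet> diff_vec \<psi> (x + s *\<^sub>R ?e))) (at s within {0..h m})" for s
        by (rule has_derivative_compose[OF _ der]) (auto intro!: derivative_eq_intros)
      then have d: "((\<lambda>s. \<psi> (x + s *\<^sub>R ?e)) has_derivative (\<lambda>r. r * pderiv_at k \<psi> (x + s *\<^sub>R ?e))) (at s within {0..h m})" for s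
        by (simp add: inner_axis' diff_vec_def)
      have "norm (\<psi> (x + h m *\<^sub>R ?e) - \<psi> (x + 0 *\<^sub>R ?e)) \<le> M * norm (h m - 0)"
      proof (rule differentiable_bound[OF convex_closed_interval d])
        show "onorm (\<lambda>r. r * pderiv_at k \<psi> (x + s *\<^sub>R ?e)) \<le> M" for s
          by (rule onorm_le) (use M(1)[of "x + s *\<^sub>R ?e"] in \<open>simp add: abs_mult mult.commute[of M] mult_left_mono\<close>)
      qed (use h(1)[of m] in auto)
      then show ?thesis by simp
    qed
    then show ?thesis using h(1)[of m] by (simp add: q_def add.commute divide_simps)
  qed
  \<comment> \<open>The steps \<open>h m\<close> are at most 1, so every quotient vanishes outside
    the ball of radius \<open>R + 1\<close>. Together with the mean value bound \<open>M\<close>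
    this gives one integrable dominating function.\<close>
  have qs: "q m x = 0" if "x \<notin> cball 0 (R + 1)" for m x
  proof -
    have "norm (h m *\<^sub>R ?e) \<le> 1" using h(1,2)[of m] by simp
    then have "norm (h m *\<^sub>R ?e + x) > R" using that norm_triangle_ineq2[of x "- (h m *\<^sub>R ?e)"]
      by (simp add: add.commute)
    then have "h m *\<^sub>R ?e + x \<notin> K" "x \<notin> K" using that R by (force, force)
    then show ?thesis by (simp add: q_def K(2))
  qed
  have "(\<lambda>m. integral\<^sup>L lborel (q m)) \<longlonglongrightarrow> integral\<^sup>L lborel (pderiv_at k \<psi>)"
  proof (rule integral_dominated_convergence[where w="\<lambda>x. M * indicator (cball 0 (R + 1)) x"])
    show "pderiv_at k \<psi> \<in> borel_measurable lborel" using int by auto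
    show "q m \<in> borel_measurable lborel" for m
      unfolding q_def[abs_def] using sh ipsi by (intro borel_measurable_divide borel_measurable_diff) auto
    show "integrable lborel (\<lambda>x. M * indicator (cball 0 (R + 1)) x :: real)"
      using emeasure_bounded_finite[OF bounded_cball] by (intro integrable_mult_right integrable_real_indicator) auto
    show "AE x in lborel. norm (q m x) \<le> M * indicator (cball 0 (R + 1)) x" for m
      using mvt[of m] qs[of _ m] by (intro AE_I2) (auto simp: indicator_def split: if_splits)
    show "AE x in lborel. (\<lambda>m. q m x) \<longlonglongrightarrow> pderiv_at k \<psi> x"
    proof (rule AE_I2)
      fix x
      have "((\<lambda>s. \<psi> (s *\<^sub>R ?e + x)) has_derivative (\<lambda>r. (r *\<^sub>R ?e) \<bullet> diff_vec \<psi> (0 *\<^sub>R ?e + x))) (at 0)"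
        by (rule has_derivative_compose[OF _ der]) (auto intro!: derivative_eq_intros)
      then have "((\<lambda>s. \<psi> (s *\<^sub>R ?e + x)) has_real_derivative pderiv_at k \<psi> x) (at 0)"
        by (simp add: inner_axis' diff_vec_def has_field_derivative_def mult.commute[of _ "pderiv_at k \<psi> x"])
      then have lim: "(\<lambda>s. (\<psi> (s *\<^sub>R ?e + x) - \<psi> x) / s) \<midarrow>0\<rightarrow> pderiv_at k \<psi> x"
        by (simp add: DERIV_def)
      have "filterlim h (at 0) sequentially"
        using h by (auto simp: filterlim_at intro!: always_eventually) (metis less_irrefl)
      from filterlim_compose[OF lim this] show "(\<lambda>m. q m x) \<longlonglongrightarrow> pderiv_at k \<psi> x"
        unfolding q_def .
    qed
  qed
  then show "integral\<^sup>L lborel (pderiv_at k \<psi>) = 0" by (simp add: q0 LIMSEQ_const_iff)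
qed

section \<open>The Laplacian in divergence form\<close>

lemma trace_matrix_mult: "trace (B ** H) = (\<Sum>i\<in>UNIV. \<Sum>j\<in>UNIV. B $ i $ j * H $ j $ i)"
  for B H :: "real^'n::finite^'n"
  by (simp add: trace_def matrix_matrix_mult_def)

lemma symmetric_entry: "transpose B = B \<Longrightarrow> B $ i $ j = B $ j $ i"
proof -
  assume "transpose B = B"
  then have "B $ i $ j = transpose B $ i $ j" by simp
  then show ?thesis by (simp add: transpose_def)
qed

lemma trace_wrt_eq:
  assumes "transpose (matrix_inv g) = matrix_inv g"
  shows "trace_wrt g S = trace (matrix_inv g ** S)"
proof -
  have "trace_wrt g S = (\<Sum>i\<in>UNIV. \<Sum>j\<in>UNIV. matrix_inv g $ j $ i * S $ i $ j)"
    unfolding trace_wrt_def by (intro sum.cong refl) (simp add: symmetric_entry[OF assms])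
  also have "\<dots> = trace (matrix_inv g ** S)"
    unfolding trace_matrix_mult by (rule sum.swap)
  finally show ?thesis .
qed

text \<open>Here \<open>B\<close> is the inverse metric, \<open>H l\<close> the l-th partial
  derivative of the metric and \<open>d\<close> a differential. The left side is the Christoffel
  part of the Laplacian; the right side is, up to sign and the density factor, what arises from
  differentiating the inverse metric and the density. The first two derivative terms contract to the
  same number because \<open>B\<close> is symmetric, so their halves add up.\<close>

lemma christoffel_contraction:
  fixes B :: "real^'n::finite^'n" and H :: "'n \<Rightarrow> real^'n^'n" and d :: "real^'n"
  assumes sym: "transpose B = B"
  shows "(\<Sum>i\<in>UNIV. \<Sum>j\<in>UNIV. B $ i $ j * (\<Sum>k\<in>UNIV.
            ((\<Sum>l\<in>UNIV. B $ k $ l * (H i $ j $ l + H j $ i $ l - H l $ i $ j)) / 2) * d $ k))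
       = (\<Sum>k\<in>UNIV. (B *v (H k *v (B *v d))) $ k) - (\<Sum>k\<in>UNIV. trace (B ** H k) * (B *v d) $ k) / 2"
proof -
  define c where "c = B *v d"
  have c: "(\<Sum>k\<in>UNIV. (\<Sum>l\<in>UNIV. B $ k $ l * Y l) / 2 * d $ k) = (\<Sum>l\<in>UNIV. c $ l * Y l) / 2" for Y
  proof -
    have "(\<Sum>k\<in>UNIV. (\<Sum>l\<in>UNIV. B $ k $ l * Y l) / 2 * d $ k) = (\<Sum>k\<in>UNIV. \<Sum>l\<in>UNIV. B $ l $ k * d $ k * Y l) / 2"
      by (simp add: sum_distrib_left sum_distrib_right sum_divide_distrib symmetric_entry[OF sym] mult_ac)
    also have "\<dots> = (\<Sum>l\<in>UNIV. \<Sum>k\<in>UNIV. B $ l $ k * d $ k * Y l) / 2" by (subst sum.swap) simp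
    also have "\<dots> = (\<Sum>l\<in>UNIV. c $ l * Y l) / 2"
      by (simp add: c_def matrix_vector_mult_def sum_distrib_right)
    finally show ?thesis .
  qed
  define Z where "Z = (\<Sum>i\<in>UNIV. \<Sum>j\<in>UNIV. B $ i $ j * (\<Sum>l\<in>UNIV. c $ l * H i $ j $ l))"
  have Z: "Z = (\<Sum>k\<in>UNIV. (B *v (H k *v c)) $ k)"
    by (simp add: Z_def matrix_vector_mult_def mult.commute)
  have Z2: "(\<Sum>i\<in>UNIV. \<Sum>j\<in>UNIV. B $ i $ j * (\<Sum>l\<in>UNIV. c $ l * H j $ i $ l)) = Z"
    unfolding Z_def by (subst sum.swap) (simp add: symmetric_entry[OF sym])
  have "(\<Sum>i\<in>UNIV. \<Sum>j\<in>UNIV. B $ i $ j * (\<Sum>l\<in>UNIV. c $ l * H l $ i $ j))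
      = (\<Sum>i\<in>UNIV. \<Sum>j\<in>UNIV. \<Sum>l\<in>UNIV. B $ j $ i * H l $ i $ j * c $ l)"
    by (simp add: sum_distrib_left symmetric_entry[OF sym] mult_ac)
  also have "\<dots> = (\<Sum>i\<in>UNIV. \<Sum>l\<in>UNIV. \<Sum>j\<in>UNIV. B $ j $ i * H l $ i $ j * c $ l)"
    by (rule sum.cong[OF refl]) (rule sum.swap)
  also have "\<dots> = (\<Sum>l\<in>UNIV. \<Sum>i\<in>UNIV. \<Sum>j\<in>UNIV. B $ j $ i * H l $ i $ j * c $ l)" by (rule sum.swap)
  also have "\<dots> = (\<Sum>l\<in>UNIV. \<Sum>j\<in>UNIV. \<Sum>i\<in>UNIV. B $ j $ i * H l $ i $ j * c $ l)"
    by (rule sum.cong[OF refl]) (rule sum.swap)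
  also have "\<dots> = (\<Sum>l\<in>UNIV. trace (B ** H l) * c $ l)"
    by (simp add: trace_matrix_mult sum_distrib_right)
  finally have Z3: "(\<Sum>i\<in>UNIV. \<Sum>j\<in>UNIV. B $ i $ j * (\<Sum>l\<in>UNIV. c $ l * H l $ i $ j)) = (\<Sum>l\<in>UNIV. trace (B ** H l) * c $ l)" .
  have "(\<Sum>i\<in>UNIV. \<Sum>j\<in>UNIV. B $ i $ j * (\<Sum>k\<in>UNIV.
            ((\<Sum>l\<in>UNIV. B $ k $ l * (H i $ j $ l + H j $ i $ l - H l $ i $ j)) / 2) * d $ k))
     = (\<Sum>i\<in>UNIV. \<Sum>j\<in>UNIV. (B $ i $ j * (\<Sum>l\<in>UNIV. c $ l * H i $ j $ l)) / 2
         + (B $ i $ j * (\<Sum>l\<in>UNIV. c $ l * H j $ i $ l)) / 2 - (B $ i $ j * (\<Sum>l\<in>UNIV. c $ l * H l $ i $ j)) / 2)"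
    unfolding c by (intro sum.cong refl) (simp add: sum.distrib sum_subtractf algebra_simps add_divide_distrib diff_divide_distrib)
  also have "\<dots> = Z / 2 + Z / 2 - (\<Sum>l\<in>UNIV. trace (B ** H l) * c $ l) / 2"
    unfolding sum.distrib sum_subtractf sum_divide_distrib[symmetric] Z2 Z3 Z_def[symmetric] ..
  finally show ?thesis using Z by (simp add: c_def)
qed

abbreviation vol :: "(real^'n::finite \<Rightarrow> real^'n^'n) \<Rightarrow> real^'n \<Rightarrow> real" where
  "vol G x \<equiv> sqrt (det (G x))"

text \<open>The gradient weighted with the Riemannian density. Its Euclidean divergence is the
  density times the Laplacian.\<close>

definition grad_field :: "(real^'n::finite \<Rightarrow> real^'n^'n) \<Rightarrow> (real^'n \<Rightarrow> real) \<Rightarrow> real^'n \<Rightarrow> real^'n" where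
  "grad_field G u x = vol G x *\<^sub>R (matrix_inv (G x) *v diff_vec u x)"

lemma has_derivative_grad_field:
  assumes G: "(G has_derivative H) (at x)" and pd: "pos_def (G x)"
    and u: "(diff_vec u has_derivative E) (at x)"
  shows "(grad_field G u has_derivative (\<lambda>v.
      vol G x *\<^sub>R (matrix_inv (G x) *v E v + (- (matrix_inv (G x) ** H v ** matrix_inv (G x))) *v diff_vec u x)
      + (vol G x / 2 * trace (matrix_inv (G x) ** H v)) *\<^sub>R (matrix_inv (G x) *v diff_vec u x))) (at x)"
  unfolding grad_field_def[abs_def]
  by (intro has_derivative_scaleR has_derivative_sqrt_det bounded_bilinear.FDERIV[OF bounded_bilinear_matrix_vector]
      has_derivative_matrix_inv_comp assms)

lemma C1_on_matrix:
  assumes "C1_on V G" "\<And>x. x \<in> V \<Longrightarrow> pos_def (G x)"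
  shows C1_on_vol: "C1_on V (vol G)" and C1_on_matrix_inv: "C1_on V (\<lambda>x. matrix_inv (G x))"
proof -
  obtain D where D: "\<And>x. x \<in> V \<Longrightarrow> (G has_derivative D x) (at x)" "\<And>v. continuous_on V (\<lambda>x. D x v)"
    using assms(1) unfolding C1_on_def by blast
  note c = C1_on_continuous[OF assms(1)]
  show "C1_on V (vol G)"
    by (rule C1_onI, rule has_derivative_sqrt_det[OF D(1)])
       (auto intro!: assms(2) continuous_intros continuous_on_sqrt_det c D(2) continuous_on_matrix_inv
         bounded_linear.continuous_on[OF bounded_linear_trace] continuous_on_matrix_mult)
  show "C1_on V (\<lambda>x. matrix_inv (G x))"
    by (rule C1_onI, rule has_derivative_matrix_inv_comp[OF D(1)])
       (auto intro!: assms(2) continuous_intros c D(2) continuous_on_matrix_inv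
         continuous_on_matrix_mult)
qed

lemma C1_on_diff_vec:
  assumes "\<And>j. C1_on V (pderiv_at j u)"
  shows "C1_on V (diff_vec u)"
proof -
  have "diff_vec u = (\<lambda>x. \<Sum>j\<in>UNIV. pderiv_at j u x *\<^sub>R axis j 1)"
    unfolding diff_vec_def by (subst basis_expansion[symmetric]) (simp add: scalar_mult_eq_scaleR)
  then show ?thesis
    by (simp only:) (intro C1_on_sum C1_on_bounded_bilinear[OF bounded_bilinear_scaleR] C1_on_const assms)
qed

lemma C1_on_grad_field:
  assumes "C1_on V G" "\<And>x. x \<in> V \<Longrightarrow> pos_def (G x)" "\<And>j. C1_on V (pderiv_at j u)"
  shows "C1_on V (grad_field G u)"
  unfolding grad_field_def[abs_def]
  by (intro C1_on_bounded_bilinear[OF bounded_bilinear_scaleR] C1_on_bounded_bilinear[OF bounded_bilinear_matrix_vector]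
      C1_on_matrix[OF assms(1,2)] C1_on_diff_vec assms)

text \<open>By the product rule the divergence splits into a second-order term, which is the traced
  coordinate Hessian, and the derivatives of the inverse metric and of the density. The latter two
  are minus the Christoffel term by \<open>christoffel_contraction\<close>.\<close>

lemma divergence_grad_field:
  assumes G: "G differentiable (at x)" and pd: "pos_def (G x)"
    and u: "diff_vec u differentiable (at x)"
  shows "(\<Sum>k\<in>UNIV. pderiv_at k (\<lambda>y. grad_field G u y $ k) x) = vol G x * laplacian G u x"
proof -
  obtain H E where H: "(G has_derivative H) (at x)" and E: "(diff_vec u has_derivative E) (at x)"
    using G u unfolding differentiable_def by blast
  let ?B = "matrix_inv (G x)" and ?d = "diff_vec u x"
  define K where "K k = H (axis k 1)" for k
  have K: "pderiv_at k (\<lambda>y. G y $ i $ j) x = K k $ i $ j" for i j k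
    unfolding K_def by (rule pderiv_at_eq) (intro bounded_linear.has_derivative[OF bounded_linear_vec_nth] H)
  have E2: "pderiv_at k (pderiv_at j u) x = E (axis k 1) $ j" for j k
    using bounded_linear.has_derivative[OF bounded_linear_vec_nth E, of j]
    by (intro pderiv_at_eq) (simp add: diff_vec_def)
  have sym: "transpose ?B = ?B" by (rule pos_def_inv[OF pd])
  have "pderiv_at k (\<lambda>y. grad_field G u y $ k) x = vol G x * ((?B *v E (axis k 1)) $ k)
      - vol G x * ((?B *v (K k *v (?B *v ?d))) $ k) + vol G x / 2 * (trace (?B ** K k) * (?B *v ?d) $ k)" for k
    by (subst pderiv_at_eq[OF bounded_linear.has_derivative[OF bounded_linear_vec_nth has_derivative_grad_field[OF H pd E]]])
       (simp add: K_def[symmetric] matrix_vector_mul_assoc algebra_simps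
          minus_mult_left matrix_mul_assoc bounded_bilinear.minus_left[OF bounded_bilinear_matrix_vector])
  note comp = this
  have "(\<Sum>k\<in>UNIV. pderiv_at k (\<lambda>y. grad_field G u y $ k) x)
      = vol G x * ((\<Sum>k\<in>UNIV. (?B *v E (axis k 1)) $ k) - ((\<Sum>k\<in>UNIV. (?B *v (K k *v (?B *v ?d))) $ k)
        - (\<Sum>k\<in>UNIV. trace (?B ** K k) * (?B *v ?d) $ k) / 2))"
    unfolding comp by (simp add: sum.distrib sum_subtractf sum_distrib_left sum_divide_distrib algebra_simps)
  also have "(\<Sum>k\<in>UNIV. (?B *v E (axis k 1)) $ k) = (\<Sum>i\<in>UNIV. \<Sum>j\<in>UNIV. ?B $ i $ j * pderiv_at i (pderiv_at j u) x)"
    by (simp add: E2 matrix_vector_mult_def)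
  also note christoffel_contraction[OF sym, of K ?d, symmetric]
  also have "(\<Sum>i\<in>UNIV. \<Sum>j\<in>UNIV. ?B $ i $ j * pderiv_at i (pderiv_at j u) x) - (\<Sum>i\<in>UNIV. \<Sum>j\<in>UNIV. ?B $ i $ j * (\<Sum>k\<in>UNIV.
            ((\<Sum>l\<in>UNIV. ?B $ k $ l * (K i $ j $ l + K j $ i $ l - K l $ i $ j)) / 2) * ?d $ k)) = laplacian G u x"
    by (simp add: laplacian_def trace_wrt_def hessian_def christoffel_def K diff_vec_def sum_subtractf[symmetric] right_diff_distrib)
  finally show ?thesis .
qed

text \<open>The divergence of \<phi> times the weighted gradient integrates to zero, since this
  field has compact support.\<close>

lemma laplacian_by_parts:
  fixes \<phi> u :: "real^'n::finite \<Rightarrow> real"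
  assumes V: "open V" and K: "compact K" "K \<subseteq> V" "\<And>x. x \<notin> K \<Longrightarrow> \<phi> x = 0" and \<phi>: "C1_on V \<phi>"
    and G: "C1_on V G" "\<And>x. x \<in> V \<Longrightarrow> pos_def (G x)" and u: "\<And>j. C1_on V (pderiv_at j u)"
  shows "integral\<^sup>L lborel (\<lambda>x. \<phi> x * (vol G x * laplacian G u x))
    = - integral\<^sup>L lborel (\<lambda>x. diff_vec \<phi> x \<bullet> grad_field G u x)"
proof -
  have cl: "open (- K)" using K(1) by (simp add: compact_imp_closed open_Compl)
  have UN: "UNIV = V \<union> - K" using K(2) by auto
  have out: "diff_vec \<phi> x = 0" if "x \<notin> K" for x
  proof -
    have "(\<phi> has_derivative (\<lambda>v. 0)) (at x)"
      by (rule has_derivative_transform_within_open[of "\<lambda>x. 0" _ _ _ "- K"]) (use cl that K in auto)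
    from pderiv_at_eq[OF this] show ?thesis by (simp add: diff_vec_def vec_eq_iff)
  qed
  have X: "C1_on V (grad_field G u)" by (rule C1_on_grad_field[OF G u])
  define \<psi> where "\<psi> k x = \<phi> x * grad_field G u x $ k" for k x
  \<comment> \<open>The product is C1 on \<open>V\<close> and zero on the complement of
    \<open>K\<close>; these two open sets cover the whole space.\<close>
  have C1\<psi>: "C1_on UNIV (\<psi> k)" for k
    unfolding UN \<psi>_def
    by (intro C1_on_Un V cl C1_on_mult[OF \<phi>] C1_on_vec_nth X C1_on_zero) (simp add: K)
  have zero: "\<psi> k x = 0" if "x \<notin> K" for k x using that K by (simp add: \<psi>_def)
  have sum: "(\<Sum>k\<in>UNIV. pderiv_at k (\<psi> k) x) = diff_vec \<phi> x \<bullet> grad_field G u x + \<phi> x * (vol G x * laplacian G u x)" for x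
  proof (cases "x \<in> V")
    case True
    have d: "\<phi> differentiable (at x)" "grad_field G u differentiable (at x)" "G differentiable (at x)" "diff_vec u differentiable (at x)"
      using \<phi> X G(1) C1_on_diff_vec[OF u] True unfolding C1_on_iff by blast+
    obtain D E where D: "(\<phi> has_derivative D) (at x)" and E: "(grad_field G u has_derivative E) (at x)"
      using d unfolding differentiable_def by blast
    have Ek: "((\<lambda>y. grad_field G u y $ k) has_derivative (\<lambda>v. E v $ k)) (at x)" for k
      by (rule bounded_linear.has_derivative[OF bounded_linear_vec_nth E])
    have "pderiv_at k (\<psi> k) x = pderiv_at k \<phi> x * grad_field G u x $ k + \<phi> x * pderiv_at k (\<lambda>y. grad_field G u y $ k) x" for k
      unfolding \<psi>_def pderiv_at_eq[OF D] pderiv_at_eq[OF Ek]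
      by (subst pderiv_at_eq[OF has_derivative_mult[OF D Ek]]) simp
    then show ?thesis
      by (simp add: sum.distrib inner_vec_def diff_vec_def sum_distrib_left[symmetric] divergence_grad_field[OF d(3) G(2)[OF True] d(4)])
  next
    case False
    then have "x \<notin> K" using K by auto
    have "pderiv_at k (\<psi> k) x = 0" for k
    proof -
      have "(\<psi> k has_derivative (\<lambda>v. 0)) (at x)"
        by (rule has_derivative_transform_within_open[of "\<lambda>x. 0" _ _ _ "- K"]) (use cl \<open>x \<notin> K\<close> zero in auto)
      from pderiv_at_eq[OF this] show ?thesis .
    qed
    then show ?thesis using out K \<open>x \<notin> K\<close> by simp
  qed
  have i1: "integrable lborel (\<lambda>x. \<Sum>k\<in>UNIV. pderiv_at k (\<psi> k) x)" "integral\<^sup>L lborel (\<lambda>x. \<Sum>k\<in>UNIV. pderiv_at k (\<psi> k) x) = 0"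
    using integral_pderiv_compact_support[OF C1\<psi> K(1) zero] by (auto simp: integral_sum)
  have i2: "integrable lborel (\<lambda>x. diff_vec \<phi> x \<bullet> grad_field G u x)"
  proof (rule integrable_compact_support[OF K(1)])
    show "continuous_on K (\<lambda>x. diff_vec \<phi> x \<bullet> grad_field G u x)"
      by (intro continuous_intros continuous_on_subset[OF C1_on_diff_vec_continuous[OF \<phi>] K(2)]
          continuous_on_subset[OF C1_on_continuous[OF X] K(2)])
  qed (simp add: out)
  have "integral\<^sup>L lborel (\<lambda>x. \<phi> x * (vol G x * laplacian G u x))
      = integral\<^sup>L lborel (\<lambda>x. (\<Sum>k\<in>UNIV. pderiv_at k (\<psi> k) x) - diff_vec \<phi> x \<bullet> grad_field G u x)"
    by (simp add: sum)
  also have "\<dots> = - integral\<^sup>L lborel (\<lambda>x. diff_vec \<phi> x \<bullet> grad_field G u x)"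
    by (subst Bochner_Integration.integral_diff[OF i1(1) i2]) (simp add: i1(2))
  finally show ?thesis .
qed

section \<open>Existence and uniqueness of the Riemannian measure\<close>

locale closed_mfd =
  fixes X :: "'a topology" and A :: "('a, 'n::finite) chart set"
  assumes closed_manifold: "closed_manifold X A"
begin

lemma cover: "(\<Union>c\<in>A. fst c) = topspace X"
  and openin_chart: "c \<in> A \<Longrightarrow> openin X (fst c)"
  and open_chart_image: "c \<in> A \<Longrightarrow> open (chart_image c)"
  and homeo_chart: "c \<in> A \<Longrightarrow> homeomorphic_map (subtopology X (fst c)) (top_of_set (chart_image c)) (snd c)"
  and smooth_transition: "c \<in> A \<Longrightarrow> d \<in> A \<Longrightarrow> smooth_on (snd c ` (fst c \<inter> fst d)) (transition c d)"
  and nonempty: "topspace X \<noteq> {}" and Hausdorff: "Hausdorff_space X" and compact: "compact_space X"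
  using closed_manifold unfolding closed_manifold_def smooth_atlas_def by blast+

lemma chart_subset: "c \<in> A \<Longrightarrow> fst c \<subseteq> topspace X"
  using cover by blast

lemma topspace_chart: "c \<in> A \<Longrightarrow> topspace (subtopology X (fst c)) = fst c"
  using chart_subset by (simp add: Int_absorb1)

lemma inj_chart: "c \<in> A \<Longrightarrow> inj_on (snd c) (fst c)"
  using homeomorphic_imp_injective_map[OF homeo_chart] topspace_chart by metis

lemma chart_inv_left [simp]: "c \<in> A \<Longrightarrow> p \<in> fst c \<Longrightarrow> chart_inv c (snd c p) = p"
  using inj_chart by (simp add: chart_inv_def)

lemma chart_inv_right [simp]: "x \<in> chart_image c \<Longrightarrow> snd c (chart_inv c x) = x"
  by (simp add: chart_inv_def chart_image_def f_inv_into_f)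

lemma chart_inv_in [simp]: "x \<in> chart_image c \<Longrightarrow> chart_inv c x \<in> fst c"
  by (simp add: chart_inv_def chart_image_def inv_into_into)

lemma chart_image_in [simp]: "p \<in> fst c \<Longrightarrow> snd c p \<in> chart_image c"
  by (simp add: chart_image_def)

lemma open_image:
  assumes "c \<in> A" "openin X W"
  shows "open (snd c ` (fst c \<inter> W))"
proof -
  have "openin (subtopology X (fst c)) (fst c \<inter> W)"
    using assms(2) by (metis inf_commute openin_subtopology)
  then have "openin (top_of_set (chart_image c)) (snd c ` (fst c \<inter> W))"
    using homeomorphic_imp_open_map[OF homeo_chart[OF assms(1)]] by (simp add: open_map_def)
  then show ?thesis using open_chart_image[OF assms(1)] openin_open_trans by blast
qed

lemma open_overlap: "c \<in> A \<Longrightarrow> d \<in> A \<Longrightarrow> open (snd c ` (fst c \<inter> fst d))"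
  by (intro open_image openin_chart)

lemma openin_chart_preimage:
  assumes "c \<in> A" "open W"
  shows "openin X {p \<in> fst c. snd c p \<in> W}"
proof -
  have "openin (subtopology X (fst c)) {p \<in> topspace (subtopology X (fst c)). snd c p \<in> chart_image c \<inter> W}"
    by (rule openin_continuous_map_preimage[OF homeomorphic_imp_continuous_map[OF homeo_chart[OF assms(1)]]])
       (use assms(2) in \<open>auto simp: openin_open\<close>)
  moreover have "{p \<in> topspace (subtopology X (fst c)). snd c p \<in> chart_image c \<inter> W} = {p \<in> fst c. snd c p \<in> W}"
    unfolding topspace_chart[OF assms(1)] by (auto simp: chart_image_def)
  ultimately show ?thesis using openin_trans_full[OF _ openin_chart[OF assms(1)]] by metis
qed

lemma continuous_chart_inv:
  assumes "c \<in> A"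
  shows "continuous_map (top_of_set (chart_image c)) X (chart_inv c)"
proof -
  have "continuous_map (top_of_set (chart_image c)) (subtopology X (fst c)) (chart_inv c)"
    unfolding continuous_map_def
  proof (intro conjI allI impI funcsetI)
    fix U assume U: "openin (subtopology X (fst c)) U"
    then have "U \<subseteq> fst c" using openin_subset topspace_chart[OF assms] by metis
    then have "{x \<in> topspace (top_of_set (chart_image c)). chart_inv c x \<in> U} = snd c ` U"
      using assms by (force simp: image_iff subset_iff)
    then show "openin (top_of_set (chart_image c)) {x \<in> topspace (top_of_set (chart_image c)). chart_inv c x \<in> U}"
      using homeomorphic_imp_open_map[OF homeo_chart[OF assms]] U by (simp add: open_map_def)
  qed (use topspace_chart[OF assms] in auto)
  then show ?thesis by (rule continuous_map_into_fulltopology)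
qed

text \<open>Compact sets are closed because the manifold is Hausdorff. Hence a function supported
  over \<open>K\<close> vanishes on an open set of the manifold, and its extension by zero stays C1
  in every other chart.\<close>

lemma closedin_chart_compact:
  assumes "c \<in> A" "compact K" "K \<subseteq> chart_image c"
  shows "closedin X {p \<in> fst c. snd c p \<in> K}"
proof -
  have "compactin (top_of_set (chart_image c)) K" using assms by (simp add: compactin_subtopology)
  from image_compactin[OF this continuous_chart_inv[OF assms(1)]]
  have "compactin X (chart_inv c ` K)" .
  moreover have "chart_inv c ` K = {p \<in> fst c. snd c p \<in> K}"
    using assms by (force simp: image_iff subset_iff)
  ultimately show ?thesis using compactin_imp_closedin[OF Hausdorff] by simp
qed

definition patch :: "('a, 'n) chart \<times> (real^'n) \<times> real \<Rightarrow> 'a set" where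
  "patch b = (case b of (c, a, \<rho>) \<Rightarrow> {p \<in> fst c. snd c p \<in> ball a \<rho>})"

text \<open>The closed balls, and not merely the open ones, lie in the chart images. This bounds
  continuous functions on each patch and gives the bumps compact support inside their
  charts.\<close>

lemma finite_patches:
  obtains I where "finite I"
    "\<And>c a \<rho>. (c, a, \<rho>) \<in> I \<Longrightarrow> c \<in> A \<and> 0 < \<rho> \<and> cball a \<rho> \<subseteq> chart_image c"
    "(\<Union>b\<in>I. patch b) = topspace X"
proof -
  define J where "J = {(c, a, \<rho>). c \<in> A \<and> 0 < \<rho> \<and> cball a \<rho> \<subseteq> chart_image c}"
  have op: "openin X (patch b)" if "b \<in> J" for b
      proof -
    obtain c a \<rho> where b: "b = (c, a, \<rho>)" by (cases b)
    then have "c \<in> A" using that by (simp add: J_def)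
    from openin_chart_preimage[OF this open_ball] show ?thesis by (simp add: patch_def b)
  qed
  have "\<exists>b\<in>J. p \<in> patch b" if p: "p \<in> topspace X" for p
  proof -
    obtain c where c: "c \<in> A" "p \<in> fst c" using p cover by blast
    then obtain \<rho> where "\<rho> > 0" "cball (snd c p) \<rho> \<subseteq> chart_image c"
      using open_chart_image open_contains_cball chart_image_in by metis
    then show ?thesis using c by (intro bexI[of _ "(c, snd c p, \<rho>)"]) (auto simp: J_def patch_def)
  qed
  moreover have "patch b \<subseteq> topspace X" if "b \<in> J" for b using openin_subset[OF op[OF that]] .
  ultimately have "\<Union>(patch ` J) = topspace X" by blast
  then obtain \<F> where F: "finite \<F>" "\<F> \<subseteq> patch ` J" "\<Union>\<F> = topspace X"
    using compact op unfolding compact_space by (metis (no_types, lifting) imageE)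
  then obtain I where "finite I" "I \<subseteq> J" "\<F> = patch ` I" by (meson finite_subset_image)
  show ?thesis
  proof (rule that)
    show "finite I" "(\<Union>b\<in>I. patch b) = topspace X" using F \<open>\<F> = _\<close> \<open>finite I\<close> by simp_all
    show "c \<in> A \<and> 0 < \<rho> \<and> cball a \<rho> \<subseteq> chart_image c" if "(c, a, \<rho>) \<in> I" for c a \<rho>
      using \<open>I \<subseteq> J\<close> that by (auto simp: J_def)
  qed
qed

abbreviation BX :: "'a measure" where "BX \<equiv> sigma (topspace X) {U. openin X U}"

lemma space_BX [simp]: "space BX = topspace X"
  by (rule space_measure_of) (auto dest: openin_subset)

lemma openin_sets [intro]: "openin X U \<Longrightarrow> U \<in> sets BX"
  using openin_subset by (subst sets_measure_of) (auto intro: sigma_sets.Basic)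

lemma sets_BX_subset: "B \<in> sets BX \<Longrightarrow> B \<subseteq> topspace X"
  using sets.sets_into_space by fastforce

text \<open>The value outside the chart image only serves to make \<open>total_inv\<close> a measurable map on the whole space.\<close>

definition total_inv :: "('a, 'n) chart \<Rightarrow> real^'n \<Rightarrow> 'a" where
  "total_inv c x = (if x \<in> chart_image c then chart_inv c x else (SOME p. p \<in> topspace X))"

lemma total_inv_in: "c \<in> A \<Longrightarrow> total_inv c x \<in> topspace X"
  using chart_subset[of c] nonempty chart_inv_in[of x c] unfolding total_inv_def some_in_eq[symmetric] by auto

lemma measurable_total_inv:
  assumes c: "c \<in> A"
  shows "total_inv c \<in> measurable borel BX"
proof (rule measurable_measure_of)
  show "{U. openin X U} \<subseteq> Pow (topspace X)" by (auto dest: openin_subset)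
  show "total_inv c \<in> space borel \<rightarrow> topspace X" using total_inv_in[OF c] by auto
  fix W assume "W \<in> {U. openin X U}"
  then have W: "openin X W" by simp
  have "total_inv c -` W = snd c ` (fst c \<inter> W) \<union> (if (SOME p. p \<in> topspace X) \<in> W then - chart_image c else {})"
    using c by (force simp: total_inv_def image_iff split: if_splits)
  moreover have "snd c ` (fst c \<inter> W) \<in> sets borel" "chart_image c \<in> sets borel"
    using open_image[OF c W] open_chart_image[OF c] by auto
  ultimately show "total_inv c -` W \<inter> space borel \<in> sets borel" by auto
qed

lemma chart_image_borel:
  assumes c: "c \<in> A" and B: "B \<in> sets BX" "B \<subseteq> fst c"
  shows "snd c ` B \<in> sets borel"
proof -
  have "snd c ` B = total_inv c -` B \<inter> chart_image c"
    using c B(2) by (force simp: total_inv_def image_iff)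
  moreover have "total_inv c -` B \<in> sets borel"
    using measurable_sets[OF measurable_total_inv[OF c] B(1)] by simp
  ultimately show ?thesis using open_chart_image[OF c] by auto
qed

lemma disjoint_refinement:
  assumes "finite F" "\<And>c. c \<in> F \<Longrightarrow> U c \<in> sets M"
  shows "\<exists>D. disjoint_family_on D F \<and> (\<forall>c\<in>F. D c \<subseteq> U c \<and> D c \<in> sets M) \<and> (\<Union>c\<in>F. D c) = (\<Union>c\<in>F. U c)"
  using assms
proof (induction F rule: finite_induct)
  case empty
  then show ?case by (simp add: disjoint_family_on_def)
next
  case (insert c F)
  then obtain D where D: "disjoint_family_on D F" "\<And>d. d \<in> F \<Longrightarrow> D d \<subseteq> U d \<and> D d \<in> sets M" "(\<Union>c\<in>F. D c) = (\<Union>c\<in>F. U c)"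
    by auto
  define D' where "D' = D(c := U c - (\<Union>d\<in>F. U d))"
  have eq: "D' d = D d" if "d \<in> F" for d using that insert.hyps by (auto simp: D'_def)
  have "disjoint_family_on D' (insert c F)"
    unfolding disjoint_family_on_insert[OF insert.hyps(2)]
    using D(1,3) eq by (auto simp: D'_def disjoint_family_on_def)
  moreover have "\<forall>d\<in>insert c F. D' d \<subseteq> U d \<and> D' d \<in> sets M"
    using D(2) eq insert by (auto simp: D'_def intro!: sets.Diff sets.finite_UN)
  moreover have "(\<Union>d\<in>insert c F. D' d) = (\<Union>d\<in>insert c F. U d)"
  proof -
    have "(\<Union>d\<in>F. D' d) = (\<Union>d\<in>F. D d)" using eq by simp
    then show ?thesis using D(3) by (auto simp: D'_def)
  qed
  ultimately show ?case by blast
qed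

lemma disjoint_family_on_Int: "disjoint_family_on D F \<Longrightarrow> disjoint_family_on (\<lambda>d. B \<inter> D d) F"
  unfolding disjoint_family_on_def by blast

lemma finite_atlas:
  obtains F where "finite F" "F \<subseteq> A" "(\<Union>c\<in>F. fst c) = topspace X"
proof -
  obtain I where I: "finite I" "\<And>c a \<rho>. (c, a, \<rho>) \<in> I \<Longrightarrow> c \<in> A \<and> 0 < \<rho> \<and> cball a \<rho> \<subseteq> chart_image c"
    "(\<Union>b\<in>I. patch b) = topspace X" by (rule finite_patches) blast
  have s: "fst ` I \<subseteq> A" using I(2) by fastforce
  have "topspace X \<subseteq> (\<Union>c\<in>fst ` I. fst c)"
    unfolding I(3)[symmetric] by (fastforce simp: patch_def)
  then have "(\<Union>c\<in>fst ` I. fst c) = topspace X" using s chart_subset by blast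
  with that[of "fst ` I"] I(1) s show ?thesis by blast
qed

text \<open>Both existence and uniqueness of the measure are assembled from these disjoint pieces,
  each of which lies in a single chart.\<close>

lemma finite_Borel_partition:
  obtains F D where "finite F" "F \<subseteq> A" "disjoint_family_on D F" "\<And>c. c \<in> F \<Longrightarrow> D c \<subseteq> fst c \<and> D c \<in> sets BX"
    "(\<Union>c\<in>F. D c) = topspace X"
proof -
  obtain F where F: "finite F" "F \<subseteq> A" "(\<Union>c\<in>F. fst c) = topspace X" by (rule finite_atlas)
  have "\<And>c. c \<in> F \<Longrightarrow> fst c \<in> sets BX" using F(2) openin_chart by blast
  from disjoint_refinement[of F fst BX, OF F(1) this] that[OF F(1,2)] F(3) show ?thesis by metis
qed

end

lemma has_derivative_inverse_maps:
  assumes "open U" "x \<in> U" "\<And>z. z \<in> U \<Longrightarrow> h (g z) = z"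
    "(g has_derivative G) (at x)" "(h has_derivative H) (at (g x))"
  shows "H \<circ> G = id"
proof -
  have "((\<lambda>z. h (g z)) has_derivative (\<lambda>v. H (G v))) (at x)"
    by (rule has_derivative_compose[OF assms(4,5)])
  moreover have "((\<lambda>z. h (g z)) has_derivative (\<lambda>v. v)) (at x)"
    by (rule has_derivative_transform_within_open[OF has_derivative_ident assms(1,2)]) (simp add: assms(3))
  ultimately have "(\<lambda>v. H (G v)) = (\<lambda>v. v)" by (rule has_derivative_unique)
  then show ?thesis by (auto simp: fun_eq_iff)
qed

section \<open>Transition maps and their Jacobians\<close>

context closed_mfd
begin

lemma overlap_iff: "c \<in> A \<Longrightarrow> x \<in> snd c ` (fst c \<inter> fst d) \<longleftrightarrow> x \<in> chart_image c \<and> chart_inv c x \<in> fst d"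
  by (force simp: image_iff chart_image_def)

lemma transition_in: "c \<in> A \<Longrightarrow> d \<in> A \<Longrightarrow> x \<in> snd c ` (fst c \<inter> fst d) \<Longrightarrow> transition c d x \<in> snd d ` (fst c \<inter> fst d)"
  by (auto simp: transition_def)

lemma transition_inverse: "c \<in> A \<Longrightarrow> d \<in> A \<Longrightarrow> x \<in> snd c ` (fst c \<inter> fst d) \<Longrightarrow> transition d c (transition c d x) = x"
  by (auto simp: transition_def)

lemma C1_on_transition: "c \<in> A \<Longrightarrow> d \<in> A \<Longrightarrow> C1_on (snd c ` (fst c \<inter> fst d)) (transition c d)"
  by (intro smooth_on_imp_C1_on open_overlap smooth_transition)

abbreviation Jac :: "('a, 'n) chart \<Rightarrow> ('a, 'n) chart \<Rightarrow> 'a \<Rightarrow> real^'n^'n" where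
  "Jac c d p \<equiv> jacobian (transition c d) (at (snd c p))"

lemma transition_derivative:
  assumes "c \<in> A" "d \<in> A" "x \<in> snd c ` (fst c \<inter> fst d)"
  shows "(transition c d has_derivative (\<lambda>v. jacobian (transition c d) (at x) *v v)) (at x)"
  using C1_on_transition[OF assms(1,2)] assms(3) unfolding C1_on_iff jacobian_works by blast

lemma jacobian_inverse:
  assumes "c \<in> A" "d \<in> A" "x \<in> snd c ` (fst c \<inter> fst d)"
  shows "(\<lambda>v. jacobian (transition d c) (at (transition c d x)) *v v) \<circ> (\<lambda>v. jacobian (transition c d) (at x) *v v) = id"
proof (rule has_derivative_inverse_maps[OF open_overlap[OF assms(1,2)] assms(3)])
  show "(transition d c has_derivative (\<lambda>v. jacobian (transition d c) (at (transition c d x)) *v v)) (at (transition c d x))"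
    using assms transition_in[OF assms] by (intro transition_derivative) (auto simp: Int_commute)
qed (use assms in \<open>auto intro: transition_inverse transition_derivative\<close>)

end

section \<open>Construction of the volume measure of a metric\<close>

locale riem_mfd = closed_mfd X A for X :: "'a topology" and A :: "('a, 'n::finite) chart set" +
  fixes g :: "('a, 'n) metric"
  assumes metric: "riemannian_metric A g"
begin

lemma pos_def_metric: "c \<in> A \<Longrightarrow> x \<in> chart_image c \<Longrightarrow> pos_def (g c x)"
  using metric by (auto simp: riemannian_metric_def pos_def_def)

lemma C1_on_metric: "c \<in> A \<Longrightarrow> C1_on (chart_image c) (g c)"
  using metric open_chart_image smooth_on_imp_C1_on unfolding riemannian_metric_def by blast

lemma metric_transform:
  assumes "c \<in> A" "d \<in> A" "p \<in> fst c" "p \<in> fst d"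
  shows "g c (snd c p) = transpose (Jac c d p) ** g d (snd d p) ** Jac c d p"
proof -
  have "\<forall>c\<in>A. \<forall>d\<in>A. \<forall>p\<in>fst c \<inter> fst d. g c (snd c p) = transpose (Jac c d p) ** g d (snd d p) ** Jac c d p"
    using metric unfolding riemannian_metric_def Let_def by (rule conjunct2)
  then show ?thesis using assms by blast
qed

lemma continuous_vol: "c \<in> A \<Longrightarrow> continuous_on (chart_image c) (vol (g c))"
  by (intro C1_on_continuous C1_on_vol C1_on_metric pos_def_metric)

lemma vol_pos: "c \<in> A \<Longrightarrow> x \<in> chart_image c \<Longrightarrow> 0 < vol (g c) x"
  using pos_def_det_pos[OF pos_def_metric, of c x] by simp

lemma vol_transform:
  assumes "c \<in> A" "d \<in> A" "p \<in> fst c" "p \<in> fst d"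
  shows "vol (g c) (snd c p) = \<bar>det (Jac c d p)\<bar> * vol (g d) (snd d p)"
  using metric_transform[OF assms] by (simp add: det_mul det_transpose real_sqrt_mult real_sqrt_abs2 mult_ac)

text \<open>The density vanishes outside the chart image, so the arbitrary point to which
  \<open>total_inv\<close> sends the complement receives no mass.\<close>

definition dens :: "('a, 'n) chart \<Rightarrow> real^'n \<Rightarrow> real" where
  "dens c x = (if x \<in> chart_image c then vol (g c) x else 0)"

lemma measurable_dens [measurable]: "c \<in> A \<Longrightarrow> dens c \<in> borel_measurable borel"
  unfolding dens_def[abs_def]
  by (intro borel_measurable_continuous_on_if continuous_vol) (simp_all add: open_chart_image)

lemma dens_nonneg [simp]: "c \<in> A \<Longrightarrow> 0 \<le> dens c x"
  using vol_pos[of c x] by (auto simp: dens_def)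

text \<open>A measure on all Borel sets of the manifold that sees only the part inside the chart.
  This makes the contributions of different charts summable and comparable.\<close>

definition chart_measure :: "('a, 'n) chart \<Rightarrow> 'a measure" where
  "chart_measure c = distr (density lborel (\<lambda>x. ennreal (dens c x))) BX (total_inv c)"

lemma sets_chart_measure [simp]: "sets (chart_measure c) = sets BX"
  by (simp add: chart_measure_def)

lemma emeasure_chart_measure:
  assumes c: "c \<in> A" and B: "B \<in> sets BX"
  shows "emeasure (chart_measure c) B = (\<integral>\<^sup>+x. ennreal (if x \<in> snd c ` (B \<inter> fst c) then vol (g c) x else 0) \<partial>lborel)"
proof -
  have m: "total_inv c \<in> measurable (density lborel (\<lambda>x. ennreal (dens c x))) BX"
    using measurable_total_inv[OF c] by simp
  have s: "total_inv c -` B \<in> sets borel" using measurable_sets[OF measurable_total_inv[OF c] B] by simp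
  have "emeasure (chart_measure c) B = (\<integral>\<^sup>+x. ennreal (dens c x) * indicator (total_inv c -` B) x \<partial>lborel)"
    unfolding chart_measure_def using s c by (simp add: emeasure_distr[OF m B] emeasure_density)
  also have "\<dots> = (\<integral>\<^sup>+x. ennreal (if x \<in> snd c ` (B \<inter> fst c) then vol (g c) x else 0) \<partial>lborel)"
  proof (rule nn_integral_cong)
    fix x
    have "x \<in> snd c ` (B \<inter> fst c) \<longleftrightarrow> x \<in> chart_image c \<and> total_inv c x \<in> B"
      using c by (force simp: total_inv_def image_iff)
    then show "ennreal (dens c x) * indicator (total_inv c -` B) x = ennreal (if x \<in> snd c ` (B \<inter> fst c) then vol (g c) x else 0)"
      by (simp add: dens_def indicator_def)
  qed
  finally show ?thesis .
qed

lemma emeasure_chart_measure_restrict: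
  assumes "c \<in> A" "B \<in> sets BX"
  shows "emeasure (chart_measure c) (B \<inter> fst c) = emeasure (chart_measure c) B"
proof -
  have "B \<inter> fst c \<in> sets BX" using assms openin_chart openin_sets by blast
  then show ?thesis using assms by (simp add: emeasure_chart_measure)
qed

lemma is_riemannian_measure_iff:
  "is_riemannian_measure X A g \<mu> \<longleftrightarrow>
     sets \<mu> = sets BX \<and> (\<forall>c\<in>A. \<forall>B\<in>sets BX. B \<subseteq> fst c \<longrightarrow> emeasure \<mu> B = emeasure (chart_measure c) B)"
proof -
  have "(\<integral>\<^sup>+x\<in>snd c ` B. ennreal (vol (g c) x) \<partial>lborel) = emeasure (chart_measure c) B"
    if "c \<in> A" "B \<in> sets BX" "B \<subseteq> fst c" for c B
    using that by (auto simp: emeasure_chart_measure Int_absorb2 indicator_def intro!: nn_integral_cong)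
  then show ?thesis unfolding is_riemannian_measure_def by (metis (no_types, lifting))
qed

text \<open>Change of variables along the transition map. Its Jacobian factor is exactly the ratio
  of the two densities by \<open>vol_transform\<close>.\<close>

lemma chart_measure_overlap:
  assumes c: "c \<in> A" and d: "d \<in> A" and B: "B \<in> sets BX" "B \<subseteq> fst c" "B \<subseteq> fst d"
  shows "emeasure (chart_measure c) B = emeasure (chart_measure d) B"
proof -
  let ?J = "\<lambda>c d x. jacobian (transition c d) (at x)"
  have sub: "snd c ` B \<subseteq> snd c ` (fst c \<inter> fst d)" "snd d ` B \<subseteq> snd d ` (fst d \<inter> fst c)"
    using B by auto
  have img: "transition c d (snd c p) = snd d p" "transition d c (snd d p) = snd c p" if "p \<in> B" for p
    using that B c d by (auto simp: transition_def)
  have V: "snd c ` B \<subseteq> chart_image c" "snd d ` B \<subseteq> chart_image d" using B by (auto simp: chart_image_def)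
  have mat: "matrix ((*v) M) = M" for M :: "real^'n^'n" by (rule matrix_of_matrix_vector_mul)
  have vt: "\<bar>det (?J c d x)\<bar> * vol (g d) (transition c d x) = vol (g c) x" if "x \<in> snd c ` B" for x
  proof -
    obtain p where p: "p \<in> B" "x = snd c p" using \<open>x \<in> snd c ` B\<close> by blast
    then have "p \<in> fst c" "p \<in> fst d" "transition c d x = snd d p" using img B by blast+
    then show ?thesis using vol_transform[OF c d, of p] p(2) by simp
  qed
  have meas: "(\<lambda>x. if x \<in> snd e ` B then vol (g e) x else 0) \<in> borel_measurable borel" if e: "e \<in> A" "B \<subseteq> fst e" "snd e ` B \<subseteq> chart_image e" for e
    by (intro borel_measurable_continuous_on_if chart_image_borel e B(1) continuous_on_const
        continuous_on_subset[OF continuous_vol[OF e(1)] e(3)])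
  have "(\<integral>\<^sup>+y. ennreal (if y \<in> snd d ` B then vol (g d) y else 0) \<partial>lborel)
    = (\<integral>\<^sup>+x. ennreal (if x \<in> snd c ` B then \<bar>det (matrix ((*v) (?J c d x)))\<bar> * vol (g d) (transition c d x) else 0) \<partial>lborel)"
  proof (rule nn_integral_change_of_variables[where h="transition d c" and h'="\<lambda>y. (*v) (?J d c y)"])
    show "(transition c d has_derivative (*v) (?J c d x)) (at x within snd c ` B)" if "x \<in> snd c ` B" for x
      by (rule has_derivative_at_withinI[OF transition_derivative[OF c d subsetD[OF sub(1) that]]])
    show "(transition d c has_derivative (*v) (?J d c y)) (at y within snd d ` B)" if "y \<in> snd d ` B" for y
      by (rule has_derivative_at_withinI[OF transition_derivative[OF d c subsetD[OF sub(2) that]]])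
    show "0 \<le> vol (g d) y" if "y \<in> snd d ` B" for y using vol_pos[OF d, of y] V that by force
    show "(*v) (?J d c y) \<circ> (*v) (?J c d (transition d c y)) = id" if "y \<in> snd d ` B" for y
    proof -
      obtain p where p: "p \<in> B" "y = snd d p" using \<open>y \<in> snd d ` B\<close> by blast
      show ?thesis using jacobian_inverse[OF c d subsetD[OF sub(1) imageI[OF p(1)]]] img[OF p(1)] p(2) by simp
    qed
    show "(\<lambda>y. if y \<in> snd d ` B then vol (g d) y else 0) \<in> borel_measurable borel" by (intro meas d B V)
    have "(\<lambda>x. if x \<in> snd c ` B then \<bar>det (matrix ((*v) (?J c d x)))\<bar> * vol (g d) (transition c d x) else 0)
        = (\<lambda>x. if x \<in> snd c ` B then vol (g c) x else 0)"
      by (rule ext) (simp only: mat vt cong: if_cong)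
    then show "(\<lambda>x. if x \<in> snd c ` B then \<bar>det (matrix ((*v) (?J c d x)))\<bar> * vol (g d) (transition c d x) else 0) \<in> borel_measurable borel"
      using meas[OF c B(2) V(1)] by simp
  qed (use img in auto)
  also have "\<dots> = (\<integral>\<^sup>+x. ennreal (if x \<in> snd c ` B then vol (g c) x else 0) \<partial>lborel)"
    by (simp only: mat vt cong: if_cong)
  finally show ?thesis using B by (simp add: emeasure_chart_measure c d Int_absorb2)
qed

text \<open>Each piece of a finite Borel partition is measured in its own chart. For a set inside
  some chart \<open>c\<close>, \<open>chart_measure_overlap\<close> replaces all of these charts by
  \<open>c\<close>, and additivity recovers the prescribed value.\<close>

lemma ex_riemannian_measure: "\<exists>\<mu>. is_riemannian_measure X A g \<mu>"
proof -
  obtain F D where F: "finite F" "F \<subseteq> A" and D: "disjoint_family_on D F" "\<And>c. c \<in> F \<Longrightarrow> D c \<subseteq> fst c \<and> D c \<in> sets BX"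
    "(\<Union>c\<in>F. D c) = topspace X" by (rule finite_Borel_partition) blast
  define m where "m B = (\<Sum>c\<in>F. emeasure (chart_measure c) (B \<inter> D c))" for B
  define \<mu> where "\<mu> = measure_of (topspace X) (sets BX) m"
  have sub: "sets BX \<subseteq> Pow (topspace X)" using sets_BX_subset by blast
  have sets: "sets \<mu> = sets BX"
    unfolding \<mu>_def using sub by (metis sets_measure_of space_BX sets.sigma_sets_eq)
  have em: "emeasure \<mu> B = m B" if "B \<in> sets BX" for B
  proof (rule emeasure_measure_of_sigma[of "topspace X" "sets BX" m B, folded \<mu>_def])
    show "sigma_algebra (topspace X) (sets BX)" using sets.sigma_algebra_axioms[of BX] by simp
    show "positive (sets BX) m" by (simp add: positive_def m_def)
    show "countably_additive (sets BX) m"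
    proof (rule countably_additiveI)
      fix E :: "nat \<Rightarrow> 'a set" assume E: "range E \<subseteq> sets BX" "disjoint_family E" "(\<Union>i. E i) \<in> sets BX"
      have "(\<Sum>i. m (E i)) = (\<Sum>c\<in>F. \<Sum>i. emeasure (chart_measure c) (E i \<inter> D c))"
        unfolding m_def by (rule suminf_sum) auto
      also have "\<dots> = (\<Sum>c\<in>F. emeasure (chart_measure c) (\<Union>i. E i \<inter> D c))"
      proof (intro sum.cong refl suminf_emeasure)
        show "range (\<lambda>i. E i \<inter> D c) \<subseteq> sets (chart_measure c)" if "c \<in> F" for c
          using E(1) D(2)[OF that] by auto
        show "disjoint_family (\<lambda>i. E i \<inter> D c)" for c using E(2) by (auto simp: disjoint_family_on_def)
      qed
      also have "\<dots> = m (\<Union>i. E i)" by (simp add: m_def)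
      finally show "(\<Sum>i. m (E i)) = m (\<Union>i. E i)" .
    qed
  qed (use that in auto)
  have "is_riemannian_measure X A g \<mu>"
    unfolding is_riemannian_measure_iff
  proof (intro conjI ballI impI sets)
    fix c B assume c: "c \<in> A" and B: "B \<in> sets BX" "B \<subseteq> fst c"
    have "emeasure \<mu> B = (\<Sum>d\<in>F. emeasure (chart_measure c) (B \<inter> D d))"
      unfolding em[OF B(1)] m_def
      by (intro sum.cong refl chart_measure_overlap) (use c B D(2) F(2) in auto)
    also have "\<dots> = emeasure (chart_measure c) (\<Union>d\<in>F. B \<inter> D d)"
      using D(2) B F(1) by (intro sum_emeasure disjoint_family_on_Int[OF D(1)]) auto
    also have "(\<Union>d\<in>F. B \<inter> D d) = B" using D(3) sets_BX_subset[OF B(1)] by auto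
    finally show "emeasure \<mu> B = emeasure (chart_measure c) B" .
  qed
  then show ?thesis by blast
qed

text \<open>A Borel set is a finite disjoint union of sets that lie in one chart each, and on those
  the value is prescribed.\<close>

lemma riemannian_measure_unique:
  assumes "is_riemannian_measure X A g \<mu>" "is_riemannian_measure X A g \<nu>"
  shows "\<mu> = \<nu>"
proof (rule measure_eqI)
  show "sets \<mu> = sets \<nu>" using assms by (simp add: is_riemannian_measure_iff)
  fix B assume "B \<in> sets \<mu>"
  then have B: "B \<in> sets BX" using assms by (simp add: is_riemannian_measure_iff)
  obtain F D where F: "finite F" "F \<subseteq> A" and D: "disjoint_family_on D F" "\<And>c. c \<in> F \<Longrightarrow> D c \<subseteq> fst c \<and> D c \<in> sets BX"
    "(\<Union>c\<in>F. D c) = topspace X" by (rule finite_Borel_partition) blast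
  have "emeasure \<xi> B = (\<Sum>d\<in>F. emeasure (chart_measure d) (B \<inter> D d))" if \<xi>: "is_riemannian_measure X A g \<xi>" for \<xi>
  proof -
    have s: "sets \<xi> = sets BX" using \<xi> by (simp add: is_riemannian_measure_iff)
    have "(\<Sum>d\<in>F. emeasure \<xi> (B \<inter> D d)) = emeasure \<xi> (\<Union>d\<in>F. B \<inter> D d)"
      using D(2) B F(1) s by (intro sum_emeasure disjoint_family_on_Int[OF D(1)]) auto
    moreover have "(\<Union>d\<in>F. B \<inter> D d) = B" using D(3) sets_BX_subset[OF B] by auto
    moreover have "emeasure \<xi> (B \<inter> D d) = emeasure (chart_measure d) (B \<inter> D d)" if "d \<in> F" for d
      using \<xi> D(2)[OF that] B F(2) that unfolding is_riemannian_measure_iff by (metis inf.coboundedI2 sets.Int subsetD)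
    ultimately show ?thesis by simp
  qed
  then show "emeasure \<mu> B = emeasure \<nu> B" using assms by simp
qed

abbreviation \<mu> :: "'a measure" where "\<mu> \<equiv> riemannian_measure X A g"

lemma riemannian_measure: "is_riemannian_measure X A g \<mu>"
  unfolding riemannian_measure_def
  using ex_riemannian_measure riemannian_measure_unique by (metis theI)

lemma sets_measure [simp]: "sets \<mu> = sets BX"
  and emeasure_measure: "c \<in> A \<Longrightarrow> B \<in> sets BX \<Longrightarrow> B \<subseteq> fst c \<Longrightarrow> emeasure \<mu> B = emeasure (chart_measure c) B"
  using riemannian_measure by (auto simp: is_riemannian_measure_iff)

lemma space_measure [simp]: "space \<mu> = topspace X"
  using sets_eq_imp_space_eq[OF sets_measure] by simp

lemma borel_measurable_measure [simp]: "borel_measurable \<mu> = borel_measurable BX"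
  by (rule measurable_cong_sets) auto

text \<open>Identifies the pushed-forward coordinate volume with the restriction of the measure to
  the chart. This is what turns integrals supported in a chart into Lebesgue integrals.\<close>

lemma chart_measure_eq_density:
  assumes c: "c \<in> A"
  shows "chart_measure c = density \<mu> (\<lambda>p. ennreal (indicator (fst c) p))"
proof (rule measure_eqI)
  fix B assume "B \<in> sets (chart_measure c)"
  then have B: "B \<in> sets BX" by simp
  have U: "fst c \<in> sets BX" using openin_chart[OF c] by blast
  have "emeasure (density \<mu> (\<lambda>p. ennreal (indicator (fst c) p))) B = emeasure \<mu> (B \<inter> fst c)"
    using B U by (simp add: emeasure_density ennreal_indicator indicator_inter_arith[symmetric] mult.commute[of "indicator (fst c) _"] Int_commute)
  also have "\<dots> = emeasure (chart_measure c) B"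
    using B U c by (simp add: emeasure_measure emeasure_chart_measure_restrict)
  finally show "emeasure (chart_measure c) B = emeasure (density \<mu> (\<lambda>p. ennreal (indicator (fst c) p))) B" by simp
qed simp

lemma integral_supported_in_chart:
  fixes h :: "'a \<Rightarrow> real"
  assumes c: "c \<in> A" and h: "h \<in> borel_measurable BX" and supp: "\<And>p. p \<in> topspace X \<Longrightarrow> p \<notin> fst c \<Longrightarrow> h p = 0"
  shows "integral\<^sup>L \<mu> h = (LBINT x. (if x \<in> chart_image c then h (chart_inv c x) * vol (g c) x else 0))"
proof -
  have U: "fst c \<in> sets BX" using openin_chart[OF c] by blast
  have m: "total_inv c \<in> measurable (density lborel (\<lambda>x. ennreal (dens c x))) BX"
    using measurable_total_inv[OF c] by simp
  have "integral\<^sup>L \<mu> h = integral\<^sup>L \<mu> (\<lambda>p. indicator (fst c) p *\<^sub>R h p)"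
    by (rule Bochner_Integration.integral_cong) (use supp in \<open>auto simp: indicator_def\<close>)
  also have "\<dots> = integral\<^sup>L (chart_measure c) h"
    unfolding chart_measure_eq_density[OF c] using h U by (subst integral_density) auto
  also have "\<dots> = integral\<^sup>L (density lborel (\<lambda>x. ennreal (dens c x))) (\<lambda>x. h (total_inv c x))"
    unfolding chart_measure_def by (rule integral_distr[OF m h])
  also have "\<dots> = (LBINT x. dens c x *\<^sub>R h (total_inv c x))"
    using c h measurable_total_inv[OF c] by (intro integral_density) (auto intro: measurable_compose)
  also have "\<dots> = (LBINT x. (if x \<in> chart_image c then h (chart_inv c x) * vol (g c) x else 0))"
    by (rule Bochner_Integration.integral_cong) (auto simp: dens_def total_inv_def)
  finally show ?thesis .
qed

end

section \<open>Independence of the chart\<close>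

lemma pderiv_at_cong:
  assumes "open V" "x \<in> V" "\<And>y. y \<in> V \<Longrightarrow> f y = h y"
  shows "pderiv_at i f x = pderiv_at i h x"
proof -
  have "(f has_derivative D) (at x) \<longleftrightarrow> (h has_derivative D) (at x)" for D
    using assms(3) has_derivative_transform_within_open[OF _ assms(1,2), of f D UNIV h]
      has_derivative_transform_within_open[OF _ assms(1,2), of h D UNIV f] by force
  then show ?thesis unfolding pderiv_at_def frechet_derivative_def by simp
qed

lemma diff_vec_cong:
  assumes "open V" "x \<in> V" "\<And>y. y \<in> V \<Longrightarrow> f y = h y"
  shows "diff_vec f x = diff_vec h x"
  unfolding diff_vec_def using pderiv_at_cong[OF assms] by simp

lemma diff_vecI:
  assumes "(u has_derivative (\<lambda>v. v \<bullet> w)) (at x)"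
  shows "diff_vec u x = w"
  unfolding diff_vec_def pderiv_at_eq[OF assms] by (simp add: inner_axis' vec_eq_iff)

lemma diff_vec_derivative:
  assumes "u differentiable (at x)"
  shows "(u has_derivative (\<lambda>v. v \<bullet> diff_vec u x)) (at x)"
proof -
  obtain D where D: "(u has_derivative D) (at x)" using assms by (auto simp: differentiable_def)
  then show ?thesis by (rule has_derivative_eq_rhs) (simp add: fun_eq_iff has_derivative_diff_vec[OF D])
qed

lemma diff_vec_sum:
  assumes "\<And>i. i \<in> I \<Longrightarrow> f i differentiable (at x)"
  shows "diff_vec (\<lambda>y. \<Sum>i\<in>I. f i y) x = (\<Sum>i\<in>I. diff_vec (f i) x)"
proof (rule diff_vecI)
  have "((\<lambda>y. \<Sum>i\<in>I. f i y) has_derivative (\<lambda>v. \<Sum>i\<in>I. v \<bullet> diff_vec (f i) x)) (at x)"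
    by (intro has_derivative_sum diff_vec_derivative assms)
  then show "((\<lambda>y. \<Sum>i\<in>I. f i y) has_derivative (\<lambda>v. v \<bullet> (\<Sum>i\<in>I. diff_vec (f i) x))) (at x)"
    by (simp add: inner_sum_right)
qed

lemma inner_matrix_vector: "(M *v a) \<bullet> b = a \<bullet> (transpose M *v b)" for M :: "real^'n::finite^'m::finite"
  by (metis dot_lmul_matrix inner_commute vector_transpose_matrix transpose_transpose)

lemma bilin_congruence: "bilin (transpose J ** S ** J) a b = bilin S (J *v a) (J *v b)"
  for J :: "real^'n::finite^'n"
  unfolding bilin_def by (simp add: inner_matrix_vector matrix_vector_mul_assoc matrix_mul_assoc)

text \<open>The congruence gives a right inverse G' J G^-1 of the transpose of J. For square
  matrices the factors may be exchanged, and the result exhibits J G^-1 J^T as a right inverse of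
  G'.\<close>

lemma matrix_inv_congruence:
  fixes J :: "real^'n::finite^'n"
  assumes "pos_def G" "pos_def G'" "G = transpose J ** G' ** J"
  shows "J ** matrix_inv G ** transpose J = matrix_inv G'"
proof -
  have "det G = (det J)\<^sup>2 * det G'" unfolding assms(3) by (simp add: det_mul det_transpose power2_eq_square)
  then have "det J \<noteq> 0" using pos_def_det_pos[OF assms(1)] by auto
  then have J: "invertible J" by (simp add: invertible_det_nz)
  have "transpose J ** (G' ** (J ** matrix_inv G)) = mat 1"
    using pos_def_inv(1)[OF assms(1)] unfolding assms(3)[symmetric] by (simp add: matrix_mul_assoc assms(3)[symmetric])
  then have "(G' ** (J ** matrix_inv G)) ** transpose J = mat 1" by (simp add: matrix_left_right_inverse)
  then show ?thesis by (intro matrix_inv_unique[symmetric]) (simp add: matrix_mul_assoc)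
qed

lemma trace_wrt_congruence:
  fixes J :: "real^'n::finite^'n"
  assumes "pos_def G" "pos_def G'" "G = transpose J ** G' ** J"
  shows "trace_wrt G (transpose J ** S ** J) = trace_wrt G' S"
proof -
  have "trace_wrt G (transpose J ** S ** J) = trace ((matrix_inv G ** transpose J ** S) ** J)"
    by (simp add: trace_wrt_eq[OF pos_def_inv(3)[OF assms(1)]] matrix_mul_assoc)
  also have "\<dots> = trace (J ** (matrix_inv G ** transpose J ** S))" by (rule trace_mul_sym)
  also have "\<dots> = trace (matrix_inv G' ** S)"
    using matrix_inv_congruence[OF assms] by (simp add: matrix_mul_assoc)
  finally show ?thesis by (simp add: trace_wrt_eq[OF pos_def_inv(3)[OF assms(2)]])
qed

context closed_mfd
begin

lemma at_point_eq:
  assumes "\<And>c d. c \<in> A \<Longrightarrow> d \<in> A \<Longrightarrow> p \<in> fst c \<Longrightarrow> p \<in> fst d \<Longrightarrow> F c (snd c p) = F d (snd d p)"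
    and "c \<in> A" "p \<in> fst c"
  shows "at_point A F p = F c (snd c p)"
proof -
  have "(SOME c. c \<in> A \<and> p \<in> fst c) \<in> A \<and> p \<in> fst (SOME c. c \<in> A \<and> p \<in> fst c)"
    by (rule someI[of "\<lambda>c. c \<in> A \<and> p \<in> fst c"]) (use assms in auto)
  then show ?thesis unfolding at_point_def Let_def using assms by blast
qed

definition cont_fun :: "('a \<Rightarrow> real) \<Rightarrow> bool" where
  "cont_fun h \<longleftrightarrow> (\<forall>c\<in>A. continuous_on (chart_image c) (in_chart h c))"

definition C1_fun :: "('a \<Rightarrow> real) \<Rightarrow> bool" where
  "C1_fun h \<longleftrightarrow> (\<forall>c\<in>A. C1_on (chart_image c) (in_chart h c))"

lemma C1_fun_cont_fun: "C1_fun h \<Longrightarrow> cont_fun h"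
  unfolding C1_fun_def cont_fun_def using C1_on_continuous by blast

lemma smooth_fun_C1_fun: "smooth_fun A h \<Longrightarrow> C1_fun h"
  unfolding C1_fun_def smooth_fun_def using smooth_on_imp_C1_on open_chart_image by blast

lemma cont_fun_mult: "cont_fun h \<Longrightarrow> cont_fun k \<Longrightarrow> cont_fun (\<lambda>p. h p * k p)"
  unfolding cont_fun_def in_chart_def o_def by (intro ballI continuous_on_mult) auto

lemma C1_fun_mult: "C1_fun h \<Longrightarrow> C1_fun k \<Longrightarrow> C1_fun (\<lambda>p. h p * k p)"
  unfolding C1_fun_def in_chart_def o_def by (intro ballI C1_on_mult) auto

lemma C1_fun_sum: "(\<And>i. i \<in> I \<Longrightarrow> C1_fun (h i)) \<Longrightarrow> C1_fun (\<lambda>p. \<Sum>i\<in>I. h i p)"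
  unfolding C1_fun_def in_chart_def o_def by (intro ballI C1_on_sum) auto

lemma C1_fun_divide:
  assumes "C1_fun h" "C1_fun k" "\<And>p. p \<in> topspace X \<Longrightarrow> k p \<noteq> 0"
  shows "C1_fun (\<lambda>p. h p / k p)"
  unfolding C1_fun_def in_chart_def o_def
proof
  fix c assume c: "c \<in> A"
  have "k (chart_inv c x) \<noteq> 0" if "x \<in> chart_image c" for x
    using assms(3) chart_subset[OF c] chart_inv_in[OF that] by blast
  then show "C1_on (chart_image c) (\<lambda>x. h (chart_inv c x) / k (chart_inv c x))"
    using assms(1,2) c by (intro C1_on_divide) (auto simp: C1_fun_def in_chart_def o_def)
qed

lemma measurable_cont_fun:
  assumes h: "cont_fun h"
  shows "h \<in> borel_measurable BX"
proof (rule borel_measurableI)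
  fix S :: "real set" assume S: "open S"
  have "openin X {p \<in> fst c. snd c p \<in> in_chart h c -` S \<inter> chart_image c}" if c: "c \<in> A" for c
  proof (rule openin_chart_preimage[OF c])
    show "open (in_chart h c -` S \<inter> chart_image c)"
      using h c S open_chart_image[OF c] continuous_on_open_vimage[of "chart_image c" "in_chart h c"]
      unfolding cont_fun_def by blast
  qed
  moreover have "h -` S \<inter> space BX = (\<Union>c\<in>A. {p \<in> fst c. snd c p \<in> in_chart h c -` S \<inter> chart_image c})" (is "?L = ?R")
  proof (intro set_eqI iffI)
    fix p assume p: "p \<in> ?L"
    then have "p \<in> (\<Union>c\<in>A. fst c)" unfolding cover by simp
    then obtain c where c: "c \<in> A" "p \<in> fst c" by blast
    with p show "p \<in> ?R" by (intro UN_I[OF c(1)]) (simp add: in_chart_def)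
  next
    fix p assume "p \<in> ?R"
    then obtain c where c: "c \<in> A" "p \<in> fst c" "in_chart h c (snd c p) \<in> S" by auto
    then show "p \<in> ?L" using chart_subset[OF c(1)] by (auto simp: in_chart_def)
  qed
  ultimately show "h -` S \<inter> space BX \<in> sets BX" by (metis (no_types, lifting) openin_sets openin_Union imageE)
qed

lemma bounded_cont_fun:
  assumes h: "cont_fun h"
  shows "\<exists>M\<ge>0. \<forall>p\<in>topspace X. \<bar>h p\<bar> \<le> M"
proof -
  obtain I where I: "finite I" "\<And>c a \<rho>. (c, a, \<rho>) \<in> I \<Longrightarrow> c \<in> A \<and> 0 < \<rho> \<and> cball a \<rho> \<subseteq> chart_image c"
    "(\<Union>b\<in>I. patch b) = topspace X" by (rule finite_patches) blast
  have "\<exists>M. \<forall>p\<in>patch b. \<bar>h p\<bar> \<le> M" if b: "b \<in> I" for b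
  proof -
    obtain c a \<rho> where e: "b = (c, a, \<rho>)" by (cases b)
    then have c: "c \<in> A" "cball a \<rho> \<subseteq> chart_image c" using I(2) b by auto
    have "bounded (in_chart h c ` cball a \<rho>)"
      using h c by (intro compact_imp_bounded compact_continuous_image) (auto simp: cont_fun_def intro: continuous_on_subset)
    then obtain M where M: "\<And>x. x \<in> cball a \<rho> \<Longrightarrow> \<bar>in_chart h c x\<bar> \<le> M" unfolding bounded_iff by (metis image_eqI real_norm_def)
    have "\<bar>h p\<bar> \<le> M" if "p \<in> patch b" for p
    proof -
      have "p \<in> fst c" "snd c p \<in> cball a \<rho>" using that by (auto simp: patch_def e)
      then show ?thesis using M[of "snd c p"] c by (simp add: in_chart_def)
    qed
    then show ?thesis by blast
  qed
  then obtain M where M: "\<And>b p. b \<in> I \<Longrightarrow> p \<in> patch b \<Longrightarrow> \<bar>h p\<bar> \<le> M b" by metis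
  have "\<bar>h p\<bar> \<le> (\<Sum>b\<in>I. \<bar>M b\<bar>)" if "p \<in> topspace X" for p
  proof -
    obtain b where b: "b \<in> I" "p \<in> patch b" using \<open>p \<in> topspace X\<close> I(3) by blast
    have "\<bar>h p\<bar> \<le> \<bar>M b\<bar>" using M[OF b] by linarith
    also have "\<dots> \<le> (\<Sum>b\<in>I. \<bar>M b\<bar>)" using I(1) b(1) by (intro member_le_sum) auto
    finally show ?thesis .
  qed
  then show ?thesis by (intro exI[of _ "\<Sum>b\<in>I. \<bar>M b\<bar>"]) (auto intro: sum_nonneg)
qed

text \<open>A multiple of the squared positive part of a paraboloid, positive exactly on the
  coordinate ball when the radius is positive. Test functions are differentiated once in the weak
  form, so C1 regularity across the bounding sphere suffices.\<close>

definition bump :: "('a, 'n) chart \<times> (real^'n) \<times> real \<Rightarrow> 'a \<Rightarrow> real" where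
  "bump b p = (case b of (c, a, \<rho>) \<Rightarrow>
     if p \<in> fst c then (max 0 (\<rho>\<^sup>2 - (snd c p - a) \<bullet> (snd c p - a)))\<^sup>2 else 0)"

lemma bump_nonneg [simp]: "0 \<le> bump b p"
  by (cases b) (simp add: bump_def)

lemma inner_diff_less_iff:
  fixes x a :: "real^'n"
  assumes "0 < \<rho>"
  shows "(x - a) \<bullet> (x - a) < \<rho>\<^sup>2 \<longleftrightarrow> x \<in> ball a \<rho>"
proof -
  have "(norm (x - a))\<^sup>2 < \<rho>\<^sup>2 \<longleftrightarrow> norm (x - a) < \<rho>"
    using assms power_less_imp_less_base[of "norm (x - a)" 2 \<rho>] power_strict_mono[of "norm (x - a)" \<rho> 2] by auto
  then show ?thesis by (simp only: power2_norm_eq_inner mem_ball dist_norm norm_minus_commute[of a x])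
qed

lemma bump_pos:
  assumes "b = (c, a, \<rho>)" "0 < \<rho>"
  shows "0 < bump b p \<longleftrightarrow> p \<in> patch b"
  using inner_diff_less_iff[OF assms(2), of "snd c p" a] by (auto simp: bump_def patch_def assms(1) max_def)

text \<open>In another chart \<open>d\<close> two open sets cover the image: the overlap with
  \<open>c\<close>, where the formula is composed with the transition map, and the complement of the
  closed set over the ball, where the bump is zero.\<close>

lemma C1_fun_bump:
  assumes c: "c \<in> A" and \<rho>: "0 < \<rho>" "cball a \<rho> \<subseteq> chart_image c"
  shows "C1_fun (bump (c, a, \<rho>))"
  unfolding C1_fun_def
proof
  fix d assume d: "d \<in> A"
  let ?O = "snd d ` (fst d \<inter> fst c)" and ?K = "{p \<in> fst c. snd c p \<in> cball a \<rho>}"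
  let ?W = "snd d ` (fst d \<inter> (topspace X - ?K))"
  have "openin X (topspace X - ?K)"
    using closedin_chart_compact[OF c compact_cball \<rho>(2)] by (rule openin_diff[OF openin_topspace])
  then have W: "open ?W" by (rule open_image[OF d])
  have O: "open ?O" by (rule open_overlap[OF d c])
  have un: "chart_image d = ?O \<union> ?W" using chart_subset[OF d] by (auto simp: chart_image_def)
  have "C1_on ?O (\<lambda>x. (max 0 (\<rho>\<^sup>2 - (transition d c x - a) \<bullet> (transition d c x - a)))\<^sup>2)"
  proof (rule C1_on_compose[OF C1_on_pos_part_square[of UNIV]])
    have "C1_on UNIV (\<lambda>y::real^'n. \<rho>\<^sup>2 + (-1) * ((y - a) \<bullet> (y - a)))"
      by (intro C1_on_add C1_on_mult C1_on_const C1_on_inner_diff_sq)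
    from C1_on_compose[OF this C1_on_transition[OF d c]]
    show "C1_on ?O (\<lambda>x. \<rho>\<^sup>2 - (transition d c x - a) \<bullet> (transition d c x - a))" by simp
  qed simp
  then have 1: "C1_on ?O (in_chart (bump (c, a, \<rho>)) d)"
    by (rule C1_on_cong[OF O]) (use d in \<open>auto simp: in_chart_def bump_def transition_def\<close>)
  have "in_chart (bump (c, a, \<rho>)) d x = 0" if "x \<in> ?W" for x
  proof -
    obtain p where p: "p \<in> fst d" "p \<notin> ?K" "x = snd d p" using \<open>x \<in> ?W\<close> by blast
    then have "\<not> p \<in> patch (c, a, \<rho>)" by (auto simp: patch_def)
    then have "bump (c, a, \<rho>) p = 0" using bump_pos[OF refl \<rho>(1)] bump_nonneg by (metis less_le)
    then show ?thesis using p d by (simp add: in_chart_def)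
  qed
  then have 2: "C1_on ?W (in_chart (bump (c, a, \<rho>)) d)" by (rule C1_on_zero[OF W])
  show "C1_on (chart_image d) (in_chart (bump (c, a, \<rho>)) d)"
    unfolding un by (rule C1_on_Un[OF O W 1 2])
qed

lemma diff_vec_transform:
  assumes c: "c \<in> A" and d: "d \<in> A" and p: "p \<in> fst c" "p \<in> fst d" and u: "C1_fun u"
  shows "diff_vec (in_chart u c) (snd c p) = transpose (Jac c d p) *v diff_vec (in_chart u d) (snd d p)"
proof (rule diff_vecI)
  let ?x = "snd c p" and ?O = "snd c ` (fst c \<inter> fst d)" and ?J = "Jac c d p"
  have x: "?x \<in> ?O" using p by auto
  have y: "transition c d ?x = snd d p" using p c by (simp add: transition_def)
  have "in_chart u d differentiable (at (snd d p))"
    using u d p(2) unfolding C1_fun_def C1_on_iff by (metis chart_image_in)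
  from diff_vec_derivative[OF this]
  have "((\<lambda>z. in_chart u d (transition c d z)) has_derivative (\<lambda>v. (?J *v v) \<bullet> diff_vec (in_chart u d) (snd d p))) (at ?x)"
    by (intro has_derivative_compose[OF transition_derivative[OF c d x]]) (simp add: y)
  then have "(in_chart u c has_derivative (\<lambda>v. (?J *v v) \<bullet> diff_vec (in_chart u d) (snd d p))) (at ?x)"
    by (rule has_derivative_transform_within_open[OF _ open_overlap[OF c d] x])
       (use c d in \<open>auto simp: in_chart_def transition_def\<close>)
  then show "(in_chart u c has_derivative (\<lambda>v. v \<bullet> (transpose ?J *v diff_vec (in_chart u d) (snd d p)))) (at ?x)"
    by (simp add: inner_matrix_vector)
qed

text \<open>Allows the Laplacian computed in one chart to be integrated before it is known to be
  independent of the chart.\<close>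

lemma measurable_chart_fun:
  assumes c: "c \<in> A" and \<psi>: "continuous_on (chart_image c) \<psi>"
  shows "(\<lambda>p. if p \<in> fst c then \<psi> (snd c p) else (0::real)) \<in> borel_measurable BX"
proof (rule borel_measurableI)
  fix S :: "real set" assume S: "open S"
  have "openin X {p \<in> fst c. snd c p \<in> \<psi> -` S \<inter> chart_image c}"
  proof (rule openin_chart_preimage[OF c])
    show "open (\<psi> -` S \<inter> chart_image c)"
      using \<psi> S open_chart_image[OF c] continuous_on_open_vimage by blast
  qed
  moreover have "fst c \<in> sets BX" using openin_chart[OF c] by blast
  ultimately have "{p \<in> fst c. snd c p \<in> \<psi> -` S \<inter> chart_image c} \<union> (if 0 \<in> S then space BX - fst c else {}) \<in> sets BX"
    by auto
  moreover have "(\<lambda>p. if p \<in> fst c then \<psi> (snd c p) else 0) -` S \<inter> space BX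
     = {p \<in> fst c. snd c p \<in> \<psi> -` S \<inter> chart_image c} \<union> (if 0 \<in> S then space BX - fst c else {})"
    using chart_subset[OF c] by (auto split: if_splits)
  ultimately show "(\<lambda>p. if p \<in> fst c then \<psi> (snd c p) else 0) -` S \<inter> space BX \<in> sets BX" by simp
qed

end

section \<open>The Laplacian on the manifold and its weak form\<close>

lemma integral_nonzero_if_pos_on_open:
  fixes F :: "'a::euclidean_space \<Rightarrow> real"
  assumes "\<And>x. 0 \<le> F x" "\<And>x. x \<in> W \<Longrightarrow> 0 < F x" "open W" "W \<noteq> {}" "integrable lborel F"
  shows "integral\<^sup>L lborel F \<noteq> 0"
proof
  assume "integral\<^sup>L lborel F = 0"
  then have "AE x in lborel. F x = 0"
    using integral_nonneg_eq_0_iff_AE[OF assms(5)] assms(1) by simp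
  then have "AE x in lborel. x \<notin> W" by eventually_elim (use assms(2) in force)
  then have "W \<in> null_sets lborel"
    using AE_iff_null_sets[of W lborel] assms(3) by simp
  then have "negligible W" by (metis negligible_iff_null_sets null_sets_completionI)
  then show False using open_not_negligible[OF assms(3,4)] by blast
qed

context closed_mfd
begin

lemma cont_funI:
  assumes "\<And>c. c \<in> A \<Longrightarrow> continuous_on (chart_image c) (\<psi> c)"
    and "\<And>c p. c \<in> A \<Longrightarrow> p \<in> fst c \<Longrightarrow> h p = \<psi> c (snd c p)"
  shows "cont_fun h"
  unfolding cont_fun_def
proof
  fix c assume c: "c \<in> A"
  have "in_chart h c x = \<psi> c x" if "x \<in> chart_image c" for x
    using assms(2)[OF c chart_inv_in[OF that]] that by (simp add: in_chart_def)
  then show "continuous_on (chart_image c) (in_chart h c)"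
    using assms(1)[OF c] by (simp cong: continuous_on_cong)
qed

text \<open>\<open>in_chart\<close> has arbitrary values outside the chart image. Replacing them by
  zero makes a function with compact support in the chart a compactly supported function on all of
  coordinate space.\<close>

definition ext :: "('a, 'n) chart \<Rightarrow> ('a \<Rightarrow> real) \<Rightarrow> real^'n \<Rightarrow> real" where
  "ext c h x = (if x \<in> chart_image c then h (chart_inv c x) else 0)"

lemma ext_in_chart: "x \<in> chart_image c \<Longrightarrow> ext c h x = in_chart h c x"
  by (simp add: ext_def in_chart_def)

lemma diff_vec_ext: "c \<in> A \<Longrightarrow> x \<in> chart_image c \<Longrightarrow> diff_vec (ext c h) x = diff_vec (in_chart h c) x"
  by (rule diff_vec_cong[OF open_chart_image], assumption, assumption) (rule ext_in_chart)

end

context riem_mfd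
begin

text \<open>Each of the finitely many patches has volume at most the maximum of the density on the
  closed ball times the Lebesgue volume of that ball.\<close>

lemma finite_measure: "finite_measure \<mu>"
proof
  obtain I where I: "finite I" "\<And>c a \<rho>. (c, a, \<rho>) \<in> I \<Longrightarrow> c \<in> A \<and> 0 < \<rho> \<and> cball a \<rho> \<subseteq> chart_image c"
    "(\<Union>b\<in>I. patch b) = topspace X" by (rule finite_patches) blast
  have fin: "patch b \<in> sets BX \<and> emeasure \<mu> (patch b) \<noteq> \<infinity>" if b: "b \<in> I" for b
  proof -
    obtain c a \<rho> where e: "b = (c, a, \<rho>)" by (cases b)
    then have c: "c \<in> A" "cball a \<rho> \<subseteq> chart_image c" using I(2) b by auto
    have P: "patch b \<in> sets BX" "patch b \<subseteq> fst c" "snd c ` patch b \<subseteq> cball a \<rho>"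
      using openin_chart_preimage[OF c(1) open_ball, of a \<rho>] by (auto simp: patch_def e)
    have "bounded (vol (g c) ` cball a \<rho>)"
      using c by (intro compact_imp_bounded compact_continuous_image continuous_on_subset[OF continuous_vol]) auto
    then obtain M where M: "\<And>x. x \<in> cball a \<rho> \<Longrightarrow> \<bar>vol (g c) x\<bar> \<le> M"
      unfolding bounded_iff by (metis image_eqI real_norm_def)
    have "emeasure \<mu> (patch b) = (\<integral>\<^sup>+x. ennreal (if x \<in> snd c ` (patch b \<inter> fst c) then vol (g c) x else 0) \<partial>lborel)"
      using P c by (simp add: emeasure_measure emeasure_chart_measure)
    also have "\<dots> \<le> (\<integral>\<^sup>+x. ennreal M * indicator (cball a \<rho>) x \<partial>lborel)"
    proof (rule nn_integral_mono)
      fix x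
      show "ennreal (if x \<in> snd c ` (patch b \<inter> fst c) then vol (g c) x else 0) \<le> ennreal M * indicator (cball a \<rho>) x"
      proof (cases "x \<in> snd c ` (patch b \<inter> fst c)")
        case True
        then have "x \<in> cball a \<rho>" using P(3) by blast
        then show ?thesis using M[of x] True by (simp add: ennreal_leI)
      qed simp
    qed
    also have "\<dots> = ennreal M * emeasure lborel (cball a \<rho>)" by (rule nn_integral_cmult_indicator) simp
    also have "\<dots> < \<infinity>" using emeasure_bounded_finite[OF bounded_cball, of a \<rho>] by (simp add: ennreal_mult_less_top)
    finally show ?thesis using P(1) by simp
  qed
  have "emeasure \<mu> (\<Union>b\<in>I. patch b) \<le> (\<Sum>b\<in>I. emeasure \<mu> (patch b))"
    using fin by (intro emeasure_subadditive_finite I(1)) auto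
  also have "\<dots> < \<infinity>" using fin I(1) by (simp add: less_top)
  finally show "emeasure \<mu> (space \<mu>) \<noteq> \<infinity>" using I(3) by simp
qed

lemma integrable_cont_fun:
  assumes "cont_fun h"
  shows "integrable \<mu> h"
proof -
  interpret finite_measure \<mu> by (rule finite_measure)
  obtain M where "\<And>p. p \<in> topspace X \<Longrightarrow> \<bar>h p\<bar> \<le> M" using bounded_cont_fun[OF assms] by blast
  then show ?thesis
    using measurable_cont_fun[OF assms] by (intro integrable_const_bound[of _ M]) auto
qed

text \<open>The inner product of the gradients of \<open>u\<close> and \<open>v\<close>, written as
  the inverse metric applied to differentials. The dependence on the metric then sits in a single
  matrix, and only first derivatives of the functions occur.\<close>

definition inner_grad :: "('a \<Rightarrow> real) \<Rightarrow> ('a \<Rightarrow> real) \<Rightarrow> 'a \<Rightarrow> real" where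
  "inner_grad u v = at_point A (\<lambda>c x. diff_vec (in_chart u c) x \<bullet> (matrix_inv (g c x) *v diff_vec (in_chart v c) x))"

lemma matrix_inv_metric_transform:
  assumes "c \<in> A" "d \<in> A" "p \<in> fst c" "p \<in> fst d"
  shows "Jac c d p ** matrix_inv (g c (snd c p)) ** transpose (Jac c d p)
      = matrix_inv (g d (snd d p))"
  by (rule matrix_inv_congruence[OF _ _ metric_transform[OF assms]]) (use assms in \<open>auto intro: pos_def_metric\<close>)

lemma inner_grad_eq:
  assumes u: "C1_fun u" and v: "C1_fun v" and c: "c \<in> A" "p \<in> fst c"
  shows "inner_grad u v p = diff_vec (in_chart u c) (snd c p) \<bullet> (matrix_inv (g c (snd c p)) *v diff_vec (in_chart v c) (snd c p))"
  unfolding inner_grad_def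
proof (rule at_point_eq[OF _ c])
  fix c d assume cd: "c \<in> A" "d \<in> A" "p \<in> fst c" "p \<in> fst d"
  show "diff_vec (in_chart u c) (snd c p) \<bullet> (matrix_inv (g c (snd c p)) *v diff_vec (in_chart v c) (snd c p))
      = diff_vec (in_chart u d) (snd d p) \<bullet> (matrix_inv (g d (snd d p)) *v diff_vec (in_chart v d) (snd d p))"
    unfolding diff_vec_transform[OF cd u] diff_vec_transform[OF cd v] matrix_inv_metric_transform[OF cd, symmetric]
    by (simp only: inner_matrix_vector transpose_transpose matrix_vector_mul_assoc matrix_mul_assoc)
qed

lemma continuous_inner_grad_chart:
  assumes "C1_fun u" "C1_fun v" "c \<in> A"
  shows "continuous_on (chart_image c) (\<lambda>x. diff_vec (in_chart u c) x \<bullet> (matrix_inv (g c x) *v diff_vec (in_chart v c) x))"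
  using assms
  by (intro continuous_on_inner continuous_on_matrix_vector C1_on_diff_vec_continuous
      continuous_on_matrix_inv C1_on_continuous[OF C1_on_metric] pos_def_metric) (auto simp: C1_fun_def)

lemma cont_fun_inner_grad: "C1_fun u \<Longrightarrow> C1_fun v \<Longrightarrow> cont_fun (inner_grad u v)"
  by (rule cont_funI[OF continuous_inner_grad_chart inner_grad_eq])

lemma inner_grad_sum:
  assumes I: "\<And>i. i \<in> I \<Longrightarrow> C1_fun (w i)" and u: "C1_fun u" and v: "C1_fun v"
    and eq: "\<And>p. p \<in> topspace X \<Longrightarrow> v p = (\<Sum>i\<in>I. w i p)" and p: "p \<in> topspace X"
  shows "inner_grad v u p = (\<Sum>i\<in>I. inner_grad (w i) u p)"
proof -
  have "p \<in> (\<Union>c\<in>A. fst c)" unfolding cover by (rule p)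
  then obtain c where c: "c \<in> A" "p \<in> fst c" by blast
  have d: "in_chart (w i) c differentiable (at (snd c p))" if "i \<in> I" for i
    using I[OF that] c unfolding C1_fun_def C1_on_iff by (metis chart_image_in)
  have "diff_vec (in_chart v c) (snd c p) = diff_vec (\<lambda>x. \<Sum>i\<in>I. in_chart (w i) c x) (snd c p)"
  proof (rule diff_vec_cong[OF open_chart_image[OF c(1)]])
    fix y assume "y \<in> chart_image c"
    then have "chart_inv c y \<in> topspace X" using chart_subset[OF c(1)] by auto
    then show "in_chart v c y = (\<Sum>i\<in>I. in_chart (w i) c y)" by (simp add: in_chart_def eq)
  qed (use c in simp)
  also have "\<dots> = (\<Sum>i\<in>I. diff_vec (in_chart (w i) c) (snd c p))" by (rule diff_vec_sum[OF d])
  finally show ?thesis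
    using c u v I by (simp add: inner_grad_eq inner_sum_left)
qed

abbreviation lap :: "('a, 'n) chart \<Rightarrow> ('a \<Rightarrow> real) \<Rightarrow> real^'n \<Rightarrow> real" where
  "lap c u \<equiv> laplacian (g c) (in_chart u c)"

lemma C1_on_pderiv_smooth: "smooth_fun A u \<Longrightarrow> c \<in> A \<Longrightarrow> C1_on (chart_image c) (pderiv_at j (in_chart u c))"
  unfolding smooth_fun_def by (intro smooth_on_imp_C1_on_pderiv open_chart_image) auto

text \<open>Continuity is read off from the divergence form: partial derivatives of a C1 vector
  field, divided by the positive continuous density.\<close>

lemma continuous_lap:
  assumes u: "smooth_fun A u" and c: "c \<in> A"
  shows "continuous_on (chart_image c) (lap c u)"
proof -
  let ?V = "chart_image c"
  have X: "C1_on ?V (grad_field (g c) (in_chart u c))"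
    by (rule C1_on_grad_field[OF C1_on_metric[OF c] pos_def_metric[OF c] C1_on_pderiv_smooth[OF u c]])
  have "lap c u x = (\<Sum>k\<in>UNIV. pderiv_at k (\<lambda>y. grad_field (g c) (in_chart u c) y $ k) x) / vol (g c) x" if x: "x \<in> ?V" for x
  proof -
    have "g c differentiable (at x)" "diff_vec (in_chart u c) differentiable (at x)"
      using C1_on_metric[OF c] C1_on_diff_vec[OF C1_on_pderiv_smooth[OF u c]] x unfolding C1_on_iff by blast+
    from divergence_grad_field[OF this(1) pos_def_metric[OF c x] this(2)] show ?thesis
      using vol_pos[OF c x] by (simp add: field_simps)
  qed
  moreover have "continuous_on ?V (\<lambda>x. (\<Sum>k\<in>UNIV. pderiv_at k (\<lambda>y. grad_field (g c) (in_chart u c) y $ k) x) / vol (g c) x)"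
    using vol_pos[OF c]
    by (intro continuous_on_divide continuous_on_sum continuous_vol[OF c] C1_on_pderiv_continuous C1_on_vec_nth X) force
  ultimately show ?thesis by (simp cong: continuous_on_cong)
qed

text \<open>The test function lives in one chart, so the Laplacian is taken as the expression of
  that chart extended by zero. The right-hand side mentions no chart, and the comparison of charts
  rests on this.\<close>

lemma integral_lap_by_parts:
  assumes c: "c \<in> A" and K: "compact K" "K \<subseteq> chart_image c" and \<phi>: "C1_fun \<phi>"
    and supp: "\<And>p. p \<in> topspace X \<Longrightarrow> \<not> (p \<in> fst c \<and> snd c p \<in> K) \<Longrightarrow> \<phi> p = 0" and u: "smooth_fun A u"
  shows "integral\<^sup>L \<mu> (\<lambda>p. \<phi> p * (if p \<in> fst c then lap c u (snd c p) else 0)) = - integral\<^sup>L \<mu> (inner_grad \<phi> u)"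
proof -
  let ?V = "chart_image c"
  have u1: "C1_fun u" by (rule smooth_fun_C1_fun[OF u])
  have out: "ext c \<phi> x = 0" if "x \<notin> K" for x
    using that supp[of "chart_inv c x"] chart_subset[OF c] by (force simp: ext_def)
  have e1: "C1_on ?V (ext c \<phi>)"
    by (rule C1_on_cong[OF open_chart_image[OF c], of "in_chart \<phi> c"])
       (use \<phi> c in \<open>simp_all add: C1_fun_def ext_in_chart\<close>)
  have cl: "open (- K)" using K(1) by (simp add: compact_imp_closed open_Compl)
  have dout: "diff_vec (ext c \<phi>) x = 0" if "x \<notin> K" for x
  proof (rule diff_vecI)
    show "(ext c \<phi> has_derivative (\<lambda>v. v \<bullet> 0)) (at x)"
      by (rule has_derivative_transform_within_open[of "\<lambda>x. 0" _ _ _ "- K"]) (use cl that out in auto)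
  qed
  have "integral\<^sup>L \<mu> (\<lambda>p. \<phi> p * (if p \<in> fst c then lap c u (snd c p) else 0))
    = (LBINT x. (if x \<in> ?V then \<phi> (chart_inv c x) * (if chart_inv c x \<in> fst c then lap c u (snd c (chart_inv c x)) else 0) * vol (g c) x else 0))"
    by (rule integral_supported_in_chart[OF c borel_measurable_times[OF measurable_cont_fun[OF C1_fun_cont_fun[OF \<phi>]]
          measurable_chart_fun[OF c continuous_lap[OF u c]]]]) simp
  also have "\<dots> = (LBINT x. ext c \<phi> x * (vol (g c) x * lap c u x))"
    by (rule Bochner_Integration.integral_cong) (auto simp: ext_def)
  also have "\<dots> = - (LBINT x. diff_vec (ext c \<phi>) x \<bullet> grad_field (g c) (in_chart u c) x)"
    by (rule laplacian_by_parts[OF open_chart_image[OF c] K out e1 C1_on_metric[OF c] pos_def_metric[OF c] C1_on_pderiv_smooth[OF u c]])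
  also have "(LBINT x. diff_vec (ext c \<phi>) x \<bullet> grad_field (g c) (in_chart u c) x)
      = (LBINT x. (if x \<in> ?V then inner_grad \<phi> u (chart_inv c x) * vol (g c) x else 0))"
  proof (rule Bochner_Integration.integral_cong)
    fix x
    show "diff_vec (ext c \<phi>) x \<bullet> grad_field (g c) (in_chart u c) x = (if x \<in> ?V then inner_grad \<phi> u (chart_inv c x) * vol (g c) x else 0)"
    proof (cases "x \<in> ?V")
      case True
      then show ?thesis
        using inner_grad_eq[OF \<phi> u1 c chart_inv_in[OF True]] c by (simp add: grad_field_def diff_vec_ext)
    next
      case False
      then have "x \<notin> K" using K(2) by blast
      then show ?thesis using False dout by simp
    qed
  qed simp
  also have "\<dots> = integral\<^sup>L \<mu> (inner_grad \<phi> u)"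
  proof (rule integral_supported_in_chart[OF c, symmetric])
    show "inner_grad \<phi> u \<in> borel_measurable BX" by (intro measurable_cont_fun cont_fun_inner_grad \<phi> u1)
    fix p assume p: "p \<in> topspace X" "p \<notin> fst c"
    then have "p \<in> (\<Union>d\<in>A. fst d)" unfolding cover by simp
    then obtain d where d: "d \<in> A" "p \<in> fst d" by blast
    \<comment> \<open>A point outside the chart has a neighbourhood that misses the closed set over
      \<open>K\<close>. There \<phi> is identically zero, hence so is its differential at the
      point.\<close>
    let ?W = "snd d ` (fst d \<inter> (topspace X - {p \<in> fst c. snd c p \<in> K}))"
    have W: "open ?W" by (intro open_image[OF d(1)] openin_diff openin_topspace closedin_chart_compact c K)
    have zero: "0 = in_chart \<phi> d y" if "y \<in> ?W" for y
    proof -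
      obtain q where "q \<in> fst d" "q \<in> topspace X" "\<not> (q \<in> fst c \<and> snd c q \<in> K)" "y = snd d q"
        using \<open>y \<in> ?W\<close> by blast
      then show ?thesis using supp[of q] d by (simp add: in_chart_def)
    qed
    have "diff_vec (in_chart \<phi> d) (snd d p) = 0"
    proof (rule diff_vecI)
      show "(in_chart \<phi> d has_derivative (\<lambda>v. v \<bullet> 0)) (at (snd d p))"
        by (rule has_derivative_transform_within_open[OF _ W _ zero]) (use p d in auto)
    qed
    then show "inner_grad \<phi> u p = 0" using inner_grad_eq[OF \<phi> u1 d] by simp
  qed
  finally show ?thesis .
qed

text \<open>Both chart expressions of the Laplacian have the same integral against every bump function supported
  in the overlap, because the right-hand side of the integration by parts does not depend on the chart.\<close>

lemma lap_chart_independent: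
  assumes u: "smooth_fun A u" and c: "c \<in> A" and d: "d \<in> A" and p: "p \<in> fst c" "p \<in> fst d"
  shows "lap c u (snd c p) = lap d u (snd d p)"
proof (rule ccontr)
  assume neq: "lap c u (snd c p) \<noteq> lap d u (snd d p)"
  let ?O = "snd c ` (fst c \<inter> fst d)"
  have O: "open ?O" by (rule open_overlap[OF c d])
  have OV: "?O \<subseteq> chart_image c" by (auto simp: chart_image_def)
  define D where "D x = lap c u x - lap d u (transition c d x)" for x
  have "continuous_on ?O (\<lambda>x. lap d u (transition c d x))"
    by (rule continuous_on_compose2[OF continuous_lap[OF u d] C1_on_continuous[OF C1_on_transition[OF c d]]])
       (use c in \<open>auto simp: transition_def\<close>)
  then have cD: "continuous_on ?O D"
    unfolding D_def[abs_def] by (intro continuous_on_diff continuous_on_subset[OF continuous_lap[OF u c] OV])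
  \<comment> \<open>The sign makes the discrepancy \<open>s * D\<close> positive at the point, hence
    by continuity on a small ball. A bump supported in that ball then gives a positive integral,
    whereas integration by parts gives zero.\<close>
  define s where "s = sgn (D (snd c p))"
  have xO: "snd c p \<in> ?O" using p by auto
  have s: "s * D (snd c p) > 0" using neq c p by (simp add: s_def D_def transition_def sgn_if split: if_splits)
  have "continuous_on ?O (\<lambda>x. s * D x)" by (intro continuous_on_mult continuous_on_const cD)
  then have "open ((\<lambda>x. s * D x) -` {0<..} \<inter> ?O)"
    using continuous_on_open_vimage[OF O] open_greaterThan by blast
  then obtain \<rho> where \<rho>: "0 < \<rho>" "cball (snd c p) \<rho> \<subseteq> (\<lambda>x. s * D x) -` {0<..} \<inter> ?O"
    using s xO open_contains_cball by (metis (no_types, lifting) IntI greaterThan_iff vimageI)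
  let ?K = "cball (snd c p) \<rho>" and ?b = "(c, snd c p, \<rho>)"
  have KO: "?K \<subseteq> ?O" and KV: "?K \<subseteq> chart_image c" using \<rho>(2) OV by auto
  define \<phi> where "\<phi> = bump ?b"
  have \<phi>1: "C1_fun \<phi>" unfolding \<phi>_def by (rule C1_fun_bump[OF c \<rho>(1) KV])
  have \<phi>0: "\<phi> q = 0" if "\<not> (q \<in> fst c \<and> snd c q \<in> ball (snd c p) \<rho>)" for q
  proof -
    have "\<not> 0 < \<phi> q" unfolding \<phi>_def using bump_pos[OF refl \<rho>(1)] that by (simp add: patch_def)
    then show ?thesis using bump_nonneg[of ?b q] by (simp add: \<phi>_def)
  qed
  have \<phi>c: "\<phi> q = 0" if "\<not> (q \<in> fst c \<and> snd c q \<in> ?K)" for q using \<phi>0[of q] that by (simp add: less_imp_le) (meson less_imp_le)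
  have \<phi>d: "\<phi> q = 0" if "\<not> (q \<in> fst d \<and> snd d q \<in> transition c d ` ?K)" for q
  proof (rule ccontr)
    assume "\<phi> q \<noteq> 0"
    then have q: "q \<in> fst c" "snd c q \<in> ?K" using \<phi>c by blast+
    then obtain r where "r \<in> fst c \<inter> fst d" "snd c q = snd c r" using KO by blast
    then have "q \<in> fst d" using q inj_chart[OF c] by (metis IntD1 IntD2 inj_onD)
    moreover have "snd d q = transition c d (snd c q)" using q c by (simp add: transition_def)
    ultimately show False using that q by blast
  qed
  have cpt: "compact (transition c d ` ?K)"
    by (intro compact_continuous_image continuous_on_subset[OF C1_on_continuous[OF C1_on_transition[OF c d]] KO]) simp
  have subd: "transition c d ` ?K \<subseteq> chart_image d"
    using KO transition_in[OF c d] by (fastforce simp: chart_image_def)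
  let ?L = "\<lambda>e q. if q \<in> fst e then lap e u (snd e q) else 0"
  \<comment> \<open>The integrand for the Laplacian of chart \<open>e\<close>, but always written in
    the coordinates of \<open>c\<close>, so that the cases \<open>e = c\<close> and
    \<open>e = d\<close> can be subtracted pointwise.\<close>
  define N where "N e x = (if x \<in> chart_image c then \<phi> (chart_inv c x) * ?L e (chart_inv c x) * vol (g c) x else 0)" for e x
  have "integral\<^sup>L \<mu> (\<lambda>q. \<phi> q * ?L c q) = integral\<^sup>L \<mu> (\<lambda>q. \<phi> q * ?L d q)"
    using integral_lap_by_parts[OF c compact_cball KV \<phi>1 \<phi>c u] integral_lap_by_parts[OF d cpt subd \<phi>1 \<phi>d u] by simp
  moreover have "integral\<^sup>L \<mu> (\<lambda>q. \<phi> q * ?L e q)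
      = (LBINT x. N e x)" if "e \<in> A" for e
    unfolding N_def by (rule integral_supported_in_chart[OF c borel_measurable_times[OF measurable_cont_fun[OF C1_fun_cont_fun[OF \<phi>1]]
          measurable_chart_fun[OF that continuous_lap[OF u that]]]]) (use \<phi>c in auto)
  ultimately have eq: "(LBINT x. N c x) = (LBINT x. N d x)"
    using c d by simp
  have int: "integrable lborel (N e)"
    if e: "e = c \<or> e = d" for e
  proof (rule integrable_compact_support[OF compact_cball[of "snd c p" \<rho>]])
    have cont: "continuous_on ?K (\<lambda>x. in_chart \<phi> c x * lap e u (transition c e x) * vol (g c) x)"
    proof (intro continuous_on_mult)
      show "continuous_on ?K (in_chart \<phi> c)"
        using C1_fun_cont_fun[OF \<phi>1] c KV by (auto simp: cont_fun_def intro: continuous_on_subset)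
      show "continuous_on ?K (vol (g c))" by (rule continuous_on_subset[OF continuous_vol[OF c] KV])
      have eA: "e \<in> A" and Ke: "?K \<subseteq> snd c ` (fst c \<inter> fst e)" using e c d KO by auto
      show "continuous_on ?K (\<lambda>x. lap e u (transition c e x))"
        by (rule continuous_on_compose2[OF continuous_lap[OF u eA] continuous_on_subset[OF C1_on_continuous[OF C1_on_transition[OF c eA]] Ke]])
           (use Ke c in \<open>force simp: transition_def\<close>)
    qed
    have "N e x = in_chart \<phi> c x * lap e u (transition c e x) * vol (g c) x" if "x \<in> ?K" for x
    proof -
      have "x \<in> chart_image c" "chart_inv c x \<in> fst e" using that KO KV overlap_iff[OF c, of x d] e by auto
      then show ?thesis by (simp add: N_def in_chart_def transition_def)
    qed
    then show "continuous_on ?K (N e)"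
      by (rule continuous_on_cong[THEN iffD2, OF refl _ cont])
    show "N e x = 0" if "x \<notin> ?K" for x
    proof -
      have "\<phi> (chart_inv c x) = 0" if "x \<in> chart_image c" using \<phi>c[of "chart_inv c x"] that \<open>x \<notin> ?K\<close> by simp
      then show ?thesis by (simp add: N_def)
    qed
  qed
  define F where "F x = s * (N c x - N d x)" for x
  have "integral\<^sup>L lborel F = 0"
    unfolding F_def[abs_def] using int[of c] int[of d] eq by (simp add: Bochner_Integration.integral_diff)
  moreover have "integrable lborel F"
    unfolding F_def[abs_def] using int[of c] int[of d] by (intro integrable_mult_right Bochner_Integration.integrable_diff) auto
  moreover have F: "F x = in_chart \<phi> c x * (s * D x) * vol (g c) x" if "x \<in> ?K" for x
  proof -
    have "x \<in> chart_image c" "chart_inv c x \<in> fst d" using that KO KV overlap_iff[OF c, of x d] by auto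
    then show ?thesis by (simp add: F_def N_def D_def in_chart_def transition_def algebra_simps)
  qed
  have "0 \<le> F x" for x
  proof (cases "x \<in> ?K")
    case True
    then have "0 < s * D x" "0 < vol (g c) x" using \<rho>(2) KV vol_pos[OF c] by auto
    moreover have "0 \<le> in_chart \<phi> c x" by (simp add: in_chart_def \<phi>_def)
    ultimately show ?thesis unfolding F[OF True] by (intro mult_nonneg_nonneg[OF mult_nonneg_nonneg]; linarith)
  next
    case False
    then have "\<phi> (chart_inv c x) = 0" if "x \<in> chart_image c" using \<phi>c[of "chart_inv c x"] that by simp
    then show ?thesis by (simp add: F_def N_def)
  qed
  moreover have "0 < F x" if x: "x \<in> ball (snd c p) \<rho>" for x
  proof -
    have xK: "x \<in> ?K" using x by simp
    then have "0 < s * D x" "0 < vol (g c) x" and xV: "x \<in> chart_image c" using \<rho>(2) KV vol_pos[OF c] by auto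
    moreover have "0 < in_chart \<phi> c x"
      using bump_pos[OF refl \<rho>(1), of c "snd c p" "chart_inv c x"] x xV by (simp add: in_chart_def \<phi>_def patch_def)
    ultimately show ?thesis unfolding F[OF xK] by simp
  qed
  ultimately show False using integral_nonzero_if_pos_on_open[of F "ball (snd c p) \<rho>"] \<rho>(1) by simp
qed

lemma Laplace_eq: "smooth_fun A u \<Longrightarrow> c \<in> A \<Longrightarrow> p \<in> fst c \<Longrightarrow> Laplace A g u p = lap c u (snd c p)"
  unfolding Laplace_def by (rule at_point_eq) (rule lap_chart_independent)

lemma cont_fun_Laplace: "smooth_fun A u \<Longrightarrow> cont_fun (Laplace A g u)"
  by (rule cont_funI[OF continuous_lap Laplace_eq])

end

section \<open>Partitions of unity and Green's identity\<close>

context closed_mfd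
begin

text \<open>The compact sets \<open>K b\<close> lie in coordinate space. Extended by zero, each
  weight is therefore a compactly supported function there, and the data involve no metric.\<close>

definition partition_of_unity ::
  "'i set \<Rightarrow> ('i \<Rightarrow> ('a, 'n) chart) \<Rightarrow> ('i \<Rightarrow> (real^'n) set) \<Rightarrow> ('i \<Rightarrow> 'a \<Rightarrow> real) \<Rightarrow> bool" where
  "partition_of_unity I c K \<theta> \<longleftrightarrow> finite I \<and> (\<forall>p\<in>topspace X. (\<Sum>b\<in>I. \<theta> b p) = 1) \<and>
     (\<forall>b\<in>I. c b \<in> A \<and> compact (K b) \<and> K b \<subseteq> chart_image (c b) \<and> C1_fun (\<theta> b) \<and>
        (\<forall>p. \<not> (p \<in> fst (c b) \<and> snd (c b) p \<in> K b) \<longrightarrow> \<theta> b p = 0))"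

lemma partition_of_unityD:
  assumes "partition_of_unity I c K \<theta>"
  shows "finite I" "p \<in> topspace X \<Longrightarrow> (\<Sum>b\<in>I. \<theta> b p) = 1"
    and "b \<in> I \<Longrightarrow> c b \<in> A" "b \<in> I \<Longrightarrow> compact (K b)" "b \<in> I \<Longrightarrow> K b \<subseteq> chart_image (c b)" "b \<in> I \<Longrightarrow> C1_fun (\<theta> b)"
    and "b \<in> I \<Longrightarrow> \<not> (p \<in> fst (c b) \<and> snd (c b) p \<in> K b) \<Longrightarrow> \<theta> b p = 0"
  using assms unfolding partition_of_unity_def by blast+

lemma partition_weight:
  assumes P: "partition_of_unity I c K \<theta>" and b: "b \<in> I"
  shows "continuous_on (K b) (ext (c b) (\<theta> b))" "x \<notin> K b \<Longrightarrow> ext (c b) (\<theta> b) x = 0"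
proof -
  note D = partition_of_unityD[OF P]
  have "C1_on (chart_image (c b)) (in_chart (\<theta> b) (c b))" using D(3,6)[OF b] unfolding C1_fun_def by blast
  from continuous_on_subset[OF C1_on_continuous[OF this] D(5)[OF b]]
  show "continuous_on (K b) (ext (c b) (\<theta> b))"
    by (rule continuous_on_cong[THEN iffD2, OF refl, rotated]) (use D(5)[OF b] ext_in_chart in blast)
  show "x \<notin> K b \<Longrightarrow> ext (c b) (\<theta> b) x = 0"
    using D(7)[OF b, of "chart_inv (c b) x"] by (simp add: ext_def)
qed

text \<open>Bumps on a finite cover by patches, divided by their sum. The sum is positive everywhere
  because the patches cover the manifold.\<close>

lemma ex_partition_of_unity:
  obtains I :: "(('a, 'n) chart \<times> (real^'n) \<times> real) set" and c K \<theta> where "partition_of_unity I c K \<theta>"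
proof -
  obtain I where I: "finite I" "\<And>c a \<rho>. (c, a, \<rho>) \<in> I \<Longrightarrow> c \<in> A \<and> 0 < \<rho> \<and> cball a \<rho> \<subseteq> chart_image c"
    "(\<Union>b\<in>I. patch b) = topspace X" by (rule finite_patches) blast
  define S where "S p = (\<Sum>b\<in>I. bump b p)" for p
  have C1b: "C1_fun (bump b)" if "b \<in> I" for b
  proof -
    obtain c a \<rho> where e: "b = (c, a, \<rho>)" by (cases b)
    then show ?thesis using I(2)[of c a \<rho>] that C1_fun_bump[of c \<rho> a] by simp
  qed
  have Spos: "0 < S p" if "p \<in> topspace X" for p
  proof -
    have "p \<in> (\<Union>b\<in>I. patch b)" unfolding I(3) by (rule that)
    then obtain b where b: "b \<in> I" "p \<in> patch b" by blast
    then have "0 < bump b p" using I(2) bump_pos by (cases b) blast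
    then show ?thesis unfolding S_def using b I(1) by (intro sum_pos2[of I b]) auto
  qed
  have C1S: "C1_fun S" unfolding S_def[abs_def] by (rule C1_fun_sum[OF C1b])
  have "partition_of_unity I fst (\<lambda>b. cball (fst (snd b)) (snd (snd b))) (\<lambda>b p. bump b p / S p)"
    unfolding partition_of_unity_def
  proof (intro conjI ballI allI impI I(1))
    show "(\<Sum>b\<in>I. bump b p / S p) = 1" if "p \<in> topspace X" for p
      using Spos[OF that] by (simp add: sum_divide_distrib[symmetric] S_def)
    fix b assume b: "b \<in> I"
    obtain c a \<rho> where e: "b = (c, a, \<rho>)" by (cases b)
    note Ib = I(2)[OF b[unfolded e]]
    show "fst b \<in> A" "cball (fst (snd b)) (snd (snd b)) \<subseteq> chart_image (fst b)" using Ib by (auto simp: e)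
    show "C1_fun (\<lambda>p. bump b p / S p)" using Spos by (intro C1_fun_divide C1b b C1S) force
    show "bump b p / S p = 0" if "\<not> (p \<in> fst (fst b) \<and> snd (fst b) p \<in> cball (fst (snd b)) (snd (snd b)))" for p
    proof -
      have "\<not> p \<in> patch b" using that by (auto simp: patch_def e)
      then have "\<not> 0 < bump b p" using bump_pos[OF e] Ib by blast
      then show ?thesis using bump_nonneg[of b p] by simp
    qed
  qed simp
  then show ?thesis by (rule that)
qed

end

context riem_mfd
begin

text \<open>Splitting \<open>v\<close> by a partition of unity reduces the claim to test functions
  supported in one chart. The pieces add up again because the gradient of a sum is the sum of the
  gradients.\<close>

theorem Green_identity:
  assumes u: "smooth_fun A u" and v: "C1_fun v"
  shows "integral\<^sup>L \<mu> (\<lambda>p. Laplace A g u p * v p) = - integral\<^sup>L \<mu> (inner_grad v u)"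
proof -
  obtain I :: "(('a, 'n) chart \<times> (real^'n) \<times> real) set" and c K \<theta> where P: "partition_of_unity I c K \<theta>"
    by (rule ex_partition_of_unity)
  note D = partition_of_unityD[OF P]
  have u1: "C1_fun u" by (rule smooth_fun_C1_fun[OF u])
  define w where "w b p = \<theta> b p * v p" for b p
  have w1: "C1_fun (w b)" if "b \<in> I" for b
    unfolding w_def[abs_def] by (intro C1_fun_mult D(6) that v)
  have vw: "v p = (\<Sum>b\<in>I. w b p)" if "p \<in> topspace X" for p
    using D(2)[OF that] by (simp add: w_def sum_distrib_right[symmetric])
  have part: "integral\<^sup>L \<mu> (\<lambda>p. Laplace A g u p * w b p) = - integral\<^sup>L \<mu> (inner_grad (w b) u)" if b: "b \<in> I" for b
  proof -
    have supp: "w b p = 0" if "\<not> (p \<in> fst (c b) \<and> snd (c b) p \<in> K b)" for p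
      using D(7)[OF b that] by (simp add: w_def)
    have "integral\<^sup>L \<mu> (\<lambda>p. Laplace A g u p * w b p) = integral\<^sup>L \<mu> (\<lambda>p. w b p * (if p \<in> fst (c b) then lap (c b) u (snd (c b) p) else 0))"
      by (rule Bochner_Integration.integral_cong) (use supp Laplace_eq[OF u D(3)[OF b]] in auto)
    also have "\<dots> = - integral\<^sup>L \<mu> (inner_grad (w b) u)"
      by (rule integral_lap_by_parts[OF D(3-5)[OF b] w1[OF b] supp u])
    finally show ?thesis .
  qed
  have "integral\<^sup>L \<mu> (\<lambda>p. Laplace A g u p * v p) = integral\<^sup>L \<mu> (\<lambda>p. \<Sum>b\<in>I. Laplace A g u p * w b p)"
    by (rule Bochner_Integration.integral_cong) (use vw in \<open>auto simp: sum_distrib_left\<close>)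
  also have "\<dots> = (\<Sum>b\<in>I. integral\<^sup>L \<mu> (\<lambda>p. Laplace A g u p * w b p))"
    by (intro Bochner_Integration.integral_sum integrable_cont_fun cont_fun_mult cont_fun_Laplace u C1_fun_cont_fun w1)
  also have "\<dots> = - (\<Sum>b\<in>I. integral\<^sup>L \<mu> (inner_grad (w b) u))"
    by (simp add: part sum_negf)
  also have "(\<Sum>b\<in>I. integral\<^sup>L \<mu> (inner_grad (w b) u)) = integral\<^sup>L \<mu> (\<lambda>p. \<Sum>b\<in>I. inner_grad (w b) u p)"
    by (intro Bochner_Integration.integral_sum[symmetric] integrable_cont_fun cont_fun_inner_grad w1 u1)
  also have "\<dots> = integral\<^sup>L \<mu> (inner_grad v u)"
    by (rule Bochner_Integration.integral_cong) (use inner_grad_sum[OF w1 u1 v vw] in auto)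
  finally show ?thesis .
qed

end

section \<open>Evolving metrics and eigenfunctions\<close>

lemma has_vector_derivative_quotient_tendsto:
  assumes d: "(\<Phi> has_vector_derivative D) (at t within {t..t + \<delta>})"
    and s: "\<And>k. s k \<in> {t<..t + \<delta>}" "s \<longlonglongrightarrow> t"
  shows "(\<lambda>k. (\<Phi> (s k) - \<Phi> t) /\<^sub>R (s k - t)) \<longlonglongrightarrow> D"
proof -
  have "((\<lambda>y. (1 / norm (y - t)) *\<^sub>R (\<Phi> y - (\<Phi> t + (y - t) *\<^sub>R D))) \<longlongrightarrow> 0) (at t within {t..t + \<delta>})"
    using d unfolding has_vector_derivative_def has_derivative_within by blast
  moreover have "filterlim s (at t within {t..t + \<delta>}) sequentially"
    using s by (auto simp: filterlim_at intro!: always_eventually less_imp_le)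
  ultimately have "(\<lambda>k. (1 / norm (s k - t)) *\<^sub>R (\<Phi> (s k) - (\<Phi> t + (s k - t) *\<^sub>R D))) \<longlonglongrightarrow> 0"
    by (rule filterlim_compose)
  moreover have "(1 / norm (s k - t)) *\<^sub>R (\<Phi> (s k) - (\<Phi> t + (s k - t) *\<^sub>R D)) = (\<Phi> (s k) - \<Phi> t) /\<^sub>R (s k - t) - D" for k
  proof -
    have "s k - t > 0" using s(1)[of k] by simp
    then show ?thesis by (simp add: divide_inverse scaleR_diff_right scaleR_add_right)
  qed
  ultimately have "(\<lambda>k. (\<Phi> (s k) - \<Phi> t) /\<^sub>R (s k - t) - D) \<longlonglongrightarrow> 0" by simp
  then show ?thesis by (simp add: LIM_zero_iff)
qed

text \<open>Mean value inequality with the maximum of the time derivative over a compact set. It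
  provides the uniform bound needed for dominated convergence.\<close>

lemma difference_quotient_bounded:
  fixes \<Phi> :: "real \<Rightarrow> 'x::topological_space \<Rightarrow> 'b::real_normed_vector"
  assumes d: "\<And>s x. s \<in> {t..t + \<delta>} \<Longrightarrow> x \<in> K \<Longrightarrow> ((\<lambda>s. \<Phi> s x) has_vector_derivative \<Phi>' s x) (at s within {t..t + \<delta>})"
    and cont: "continuous_on ({t..t + \<delta>} \<times> K) (\<lambda>z. \<Phi>' (fst z) (snd z))" and K: "compact K"
  shows "\<exists>C. \<forall>x\<in>K. \<forall>s\<in>{t<..t + \<delta>}. norm ((\<Phi> s x - \<Phi> t x) /\<^sub>R (s - t)) \<le> C"
proof -
  have "bounded ((\<lambda>z. \<Phi>' (fst z) (snd z)) ` ({t..t + \<delta>} \<times> K))"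
    by (intro compact_imp_bounded compact_continuous_image cont compact_Times K compact_Icc)
  then obtain C where C: "\<And>z. z \<in> {t..t + \<delta>} \<times> K \<Longrightarrow> norm (\<Phi>' (fst z) (snd z)) \<le> C"
    unfolding bounded_iff by blast
  have "norm ((\<Phi> s x - \<Phi> t x) /\<^sub>R (s - t)) \<le> C" if x: "x \<in> K" and s: "s \<in> {t<..t + \<delta>}" for x s
  proof -
    have "norm (\<Phi> s x - \<Phi> t x) \<le> C * norm (s - t)"
    proof (rule differentiable_bound[OF convex_real_interval(5)])
      show "((\<lambda>s. \<Phi> s x) has_derivative (\<lambda>r. r *\<^sub>R \<Phi>' u x)) (at u within {t..t + \<delta>})" if "u \<in> {t..t + \<delta>}" for u
        using d[OF that x] by (simp add: has_vector_derivative_def)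
      show "onorm (\<lambda>r. r *\<^sub>R \<Phi>' u x) \<le> C" if "u \<in> {t..t + \<delta>}" for u
      proof (rule onorm_bound)
        show "0 \<le> C" using C[of "(u, x)"] that x norm_ge_zero[of "\<Phi>' u x"] by (simp del: norm_ge_zero)
        show "norm (r *\<^sub>R \<Phi>' u x) \<le> C * norm r" for r
          using C[of "(u, x)"] that x by (simp add: mult.commute[of C] mult_left_mono)
      qed
    qed (use s in auto)
    then show ?thesis using s by (simp add: divide_simps mult.commute)
  qed
  then show ?thesis by blast
qed

text \<open>The weight \<open>w\<close> vanishes off \<open>K\<close>, so convergence and bounds
  matter on \<open>K\<close> only. The bound is asked eventually, as it comes from a uniform limit;
  the initial segment before \<open>N\<close> is skipped.\<close>

lemma tendsto_integral_compact_support: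
  fixes \<phi> :: "nat \<Rightarrow> 'a::euclidean_space \<Rightarrow> real"
  assumes K: "compact K" and w: "continuous_on K w" "\<And>x. x \<notin> K \<Longrightarrow> w x = 0"
    and c: "\<And>k. continuous_on K (\<phi> k)" "continuous_on K \<psi>"
    and lim: "\<And>x. x \<in> K \<Longrightarrow> (\<lambda>k. \<phi> k x) \<longlonglongrightarrow> \<psi> x"
    and bd: "\<forall>\<^sub>F k in sequentially. \<forall>x\<in>K. \<bar>\<phi> k x\<bar> \<le> C"
  shows "(\<lambda>k. (LBINT x. w x * \<phi> k x)) \<longlonglongrightarrow> (LBINT x. w x * \<psi> x)"
proof -
  obtain N where N: "\<And>k x. k \<ge> N \<Longrightarrow> x \<in> K \<Longrightarrow> \<bar>\<phi> k x\<bar> \<le> C" using bd unfolding eventually_sequentially by blast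
  have int: "integrable lborel (\<lambda>x. w x * \<phi> k x)" "integrable lborel (\<lambda>x. w x * \<psi> x)" for k
    by (rule integrable_compact_support[OF K]; simp add: w continuous_on_mult c)+
  have iw: "integrable lborel (\<lambda>x. C * \<bar>w x\<bar>)"
    using integrable_compact_support[OF K w] by simp
  have "(\<lambda>k. (LBINT x. w x * \<phi> (k + N) x)) \<longlonglongrightarrow> (LBINT x. w x * \<psi> x)"
  proof (rule integral_dominated_convergence[OF _ _ iw])
    show "AE x in lborel. (\<lambda>k. w x * \<phi> (k + N) x) \<longlonglongrightarrow> w x * \<psi> x"
    proof (rule AE_I2)
      fix x
      show "(\<lambda>k. w x * \<phi> (k + N) x) \<longlonglongrightarrow> w x * \<psi> x"
        using lim[of x] w(2)[of x] by (cases "x \<in> K") (auto intro!: tendsto_mult_left LIMSEQ_ignore_initial_segment)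
    qed
    show "AE x in lborel. norm (w x * \<phi> (k + N) x) \<le> C * \<bar>w x\<bar>" for k
    proof (rule AE_I2)
      fix x
      show "norm (w x * \<phi> (k + N) x) \<le> C * \<bar>w x\<bar>"
        using N[of "k + N" x] w(2)[of x] by (cases "x \<in> K") (auto simp: abs_mult mult.commute[of C] intro: mult_left_mono)
    qed
  qed (use int in auto)
  then show ?thesis by (rule LIMSEQ_offset)
qed

section \<open>Coordinate integrals and the weak eigenvalue equation\<close>

context riem_mfd
begin

text \<open>The weights do not depend on the metric. For a moving metric the same partition serves
  at all times, and the domains of integration stay fixed.\<close>

lemma integral_partition:
  assumes P: "partition_of_unity I c K \<theta>" and h: "cont_fun h"
  shows "integral\<^sup>L \<mu> h = (\<Sum>b\<in>I. LBINT x. ext (c b) (\<theta> b) x * (in_chart h (c b) x * vol (g (c b)) x))"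
proof -
  note D = partition_of_unityD[OF P]
  have \<theta>h: "cont_fun (\<lambda>p. \<theta> b p * h p)" if "b \<in> I" for b
    by (intro cont_fun_mult C1_fun_cont_fun D(6) h that)
  have "integral\<^sup>L \<mu> h = integral\<^sup>L \<mu> (\<lambda>p. \<Sum>b\<in>I. \<theta> b p * h p)"
    by (rule Bochner_Integration.integral_cong) (use D(2) in \<open>auto simp: sum_distrib_right[symmetric]\<close>)
  also have "\<dots> = (\<Sum>b\<in>I. integral\<^sup>L \<mu> (\<lambda>p. \<theta> b p * h p))"
    by (intro Bochner_Integration.integral_sum integrable_cont_fun \<theta>h)
  also have "\<dots> = (\<Sum>b\<in>I. LBINT x. ext (c b) (\<theta> b) x * (in_chart h (c b) x * vol (g (c b)) x))"
  proof (rule sum.cong[OF refl])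
    fix b assume b: "b \<in> I"
    have "integral\<^sup>L \<mu> (\<lambda>p. \<theta> b p * h p)
        = (LBINT x. (if x \<in> chart_image (c b) then \<theta> b (chart_inv (c b) x) * h (chart_inv (c b) x) * vol (g (c b)) x else 0))"
      by (rule integral_supported_in_chart[OF D(3)[OF b] measurable_cont_fun[OF \<theta>h[OF b]]]) (use D(7)[OF b] in simp)
    also have "\<dots> = (LBINT x. ext (c b) (\<theta> b) x * (in_chart h (c b) x * vol (g (c b)) x))"
      by (rule Bochner_Integration.integral_cong) (auto simp: ext_def in_chart_def)
    finally show "integral\<^sup>L \<mu> (\<lambda>p. \<theta> b p * h p) = (LBINT x. ext (c b) (\<theta> b) x * (in_chart h (c b) x * vol (g (c b)) x))" .
  qed
  finally show ?thesis .
qed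

lemma inner_grad_commute:
  assumes "C1_fun u" "C1_fun v" "p \<in> topspace X"
  shows "inner_grad u v p = inner_grad v u p"
proof -
  have "p \<in> (\<Union>c\<in>A. fst c)" unfolding cover by (rule assms)
  then obtain c where c: "c \<in> A" "p \<in> fst c" by blast
  have "transpose (matrix_inv (g c (snd c p))) = matrix_inv (g c (snd c p))"
    by (intro pos_def_inv pos_def_metric c chart_image_in)
  then show ?thesis
    using assms c by (simp only: inner_grad_eq) (metis inner_matrix_vector inner_commute)
qed

lemma grad_norm_sq_eq:
  assumes "p \<in> topspace X"
  shows "grad_norm_sq A g u p = inner_grad u u p"
proof -
  have "p \<in> (\<Union>c\<in>A. fst c)" unfolding cover by (rule assms)
  then have ex: "\<exists>c. c \<in> A \<and> p \<in> fst c" by blast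
  define c where "c = (SOME c. c \<in> A \<and> p \<in> fst c)"
  have c: "c \<in> A" "p \<in> fst c" using someI_ex[OF ex] by (auto simp: c_def)
  have "g c (snd c p) ** matrix_inv (g c (snd c p)) = mat 1"
    by (intro pos_def_inv pos_def_metric c chart_image_in)
  then show ?thesis
    unfolding grad_norm_sq_def inner_grad_def at_point_def Let_def c_def[symmetric]
    by (simp add: bilin_def gradient_def diff_vec_def[symmetric] matrix_vector_mul_assoc inner_commute)
qed

lemma eigenfunction_weak_form:
  assumes u: "smooth_fun A u" and v: "C1_fun v"
    and eig: "\<And>p. p \<in> topspace X \<Longrightarrow> Laplace A g u p + \<Lambda> * u p = 0"
  shows "integral\<^sup>L \<mu> (inner_grad v u) = \<Lambda> * integral\<^sup>L \<mu> (\<lambda>p. u p * v p)"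
proof -
  have "- integral\<^sup>L \<mu> (inner_grad v u) = integral\<^sup>L \<mu> (\<lambda>p. Laplace A g u p * v p)"
    by (rule Green_identity[OF u v, symmetric])
  also have "\<dots> = integral\<^sup>L \<mu> (\<lambda>p. - \<Lambda> * (u p * v p))"
  proof (rule Bochner_Integration.integral_cong[OF refl])
    fix p assume "p \<in> space \<mu>"
    then have "Laplace A g u p = - \<Lambda> * u p" using eig[of p] by simp
    then show "Laplace A g u p * v p = - \<Lambda> * (u p * v p)" by simp
  qed
  also have "\<dots> = - \<Lambda> * integral\<^sup>L \<mu> (\<lambda>p. u p * v p)" by (rule integral_mult_right_zero)
  finally show ?thesis by simp
qed

end

text \<open>Working to the right of \<open>t\<close> treats the initial time and later times alike;
  there is always room because \<open>T\<close> is excluded.\<close>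

lemma time_interval_right:
  assumes "t \<in> time_interval T"
  obtains \<delta> where "0 < \<delta>" "{t..t + \<delta>} \<subseteq> time_interval T"
proof -
  have t: "0 \<le> t" "ereal t < T" using assms by (auto simp: time_interval_def)
  then obtain u where u: "t < u" "ereal u < T"
    using ereal_dense2[OF t(2)] by (metis less_ereal.simps(1))
  have "ereal s < T" if "s \<le> u" for s using that u(2) by (meson ereal_less_eq(3) order_le_less_trans)
  then have "{t..t + (u - t)} \<subseteq> time_interval T" using t(1) by (auto simp: time_interval_def)
  then show ?thesis using that[of "u - t"] u(1) by simp
qed

lemma iter_partial_axis:
  assumes "open V" "x \<in> V"
  shows "iter_partial V [axis j 1] u x = pderiv_at j u x"
  by (simp add: pderiv_at_def at_within_open[OF assms(2,1)])

lemma norm_le_of_components: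
  fixes v :: "real^'n::finite"
  assumes "\<And>j. \<bar>v $ j\<bar> \<le> C j"
  shows "norm v \<le> (\<Sum>j\<in>UNIV. C j)"
  using norm_le_l1_cart[of v] sum_mono[of UNIV "\<lambda>j. \<bar>v $ j\<bar>" C] assms by force

text \<open>Isolates what the variation of the integrals uses: a curve of metrics with a jointly
  continuous time derivative \<open>H\<close>. The curvature form of \<open>H\<close> enters only in
  \<open>ricci_eigen_curve\<close>.\<close>

locale metric_curve = closed_mfd X A for X :: "'a topology" and A :: "('a, 'n::finite) chart set" +
  fixes g :: "real \<Rightarrow> ('a, 'n) metric" and H :: "real \<Rightarrow> ('a, 'n) metric" and t \<delta> :: real
  assumes \<delta>: "0 < \<delta>"
    and riem: "\<And>s. s \<in> {t..t + \<delta>} \<Longrightarrow> riem_mfd X A (g s)"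
    and cont_g: "\<And>c. c \<in> A \<Longrightarrow> continuous_on ({t..t + \<delta>} \<times> chart_image c) (\<lambda>z. g (fst z) c (snd z))"
    and cont_H: "\<And>c. c \<in> A \<Longrightarrow> continuous_on ({t..t + \<delta>} \<times> chart_image c) (\<lambda>z. H (fst z) c (snd z))"
    and deriv_g: "\<And>c s x. c \<in> A \<Longrightarrow> s \<in> {t..t + \<delta>} \<Longrightarrow> x \<in> chart_image c \<Longrightarrow>
      ((\<lambda>s. g s c x) has_vector_derivative H s c x) (at s within {t..t + \<delta>})"
begin

abbreviation "J \<equiv> {t..t + \<delta>}"

sublocale riem_mfd X A "g t"
  using riem \<delta> by auto

lemma pos_def_g: "c \<in> A \<Longrightarrow> s \<in> J \<Longrightarrow> x \<in> chart_image c \<Longrightarrow> pos_def (g s c x)"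
  using riem_mfd.pos_def_metric[OF riem] by blast

lemma derivative_unique:
  assumes "(F has_vector_derivative D) (at t within J)" "(F has_vector_derivative E) (at t within J)"
  shows "D = E"
  using vector_derivative_unique_within[OF _ assms] \<delta> by (simp add: trivial_limit_within islimpt_Icc)

text \<open>The transformation law of \<open>g\<close> can be differentiated, since the Jacobians do not depend on time.\<close>

lemma H_transform:
  assumes cd: "c \<in> A" "d \<in> A" "p \<in> fst c" "p \<in> fst d"
  shows "H t c (snd c p) = transpose (Jac c d p) ** H t d (snd d p) ** Jac c d p"
proof (rule derivative_unique)
  let ?J = "Jac c d p"
  show "((\<lambda>s. g s c (snd c p)) has_vector_derivative H t c (snd c p)) (at t within J)"
    using deriv_g[OF cd(1)] cd \<delta> by simp
  have "((\<lambda>s. transpose ?J ** g s d (snd d p) ** ?J) has_vector_derivative (transpose ?J ** H t d (snd d p) ** ?J)) (at t within J)"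
    by (intro bounded_linear.has_vector_derivative[OF bounded_bilinear.bounded_linear_left[OF bounded_bilinear_matrix_mult]]
        bounded_linear.has_vector_derivative[OF bounded_bilinear.bounded_linear_right[OF bounded_bilinear_matrix_mult]] deriv_g cd chart_image_in)
      (use \<delta> in simp)
  then show "((\<lambda>s. g s c (snd c p)) has_vector_derivative (transpose ?J ** H t d (snd d p) ** ?J)) (at t within J)"
    by (rule has_vector_derivative_transform[rotated 2])
       (use riem_mfd.metric_transform[OF riem cd] \<delta> in auto)
qed

text \<open>The time derivative of the Riemannian density by Jacobi's formula: half the trace of
  \<open>H\<close> with respect to the metric, times the density.\<close>

definition vol' :: "('a, 'n) chart \<Rightarrow> real \<Rightarrow> real^'n \<Rightarrow> real" where
  "vol' c s x = vol (g s c) x / 2 * trace (matrix_inv (g s c x) ** H s c x)"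

text \<open>The coefficient matrix of the Dirichlet energy in coordinates: the integrand for two
  functions is the inner product of one differential with \<open>W\<close> applied to the other,
  density included. It carries the whole time dependence of the energy form.\<close>

definition W :: "('a, 'n) chart \<Rightarrow> real \<Rightarrow> real^'n \<Rightarrow> real^'n^'n" where
  "W c s x = vol (g s c) x *\<^sub>R matrix_inv (g s c x)"

definition W' :: "('a, 'n) chart \<Rightarrow> real \<Rightarrow> real^'n \<Rightarrow> real^'n^'n" where
  "W' c s x = vol (g s c) x *\<^sub>R (- (matrix_inv (g s c x) ** H s c x ** matrix_inv (g s c x))) + vol' c s x *\<^sub>R matrix_inv (g s c x)"

lemma vol_deriv:
  assumes "c \<in> A" "s \<in> J" "x \<in> chart_image c"
  shows "((\<lambda>s. vol (g s c) x) has_vector_derivative vol' c s x) (at s within J)"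
proof -
  have "((\<lambda>s. g s c x) has_derivative (\<lambda>r. r *\<^sub>R H s c x)) (at s within J)"
    using deriv_g[OF assms] by (simp add: has_vector_derivative_def)
  from has_derivative_sqrt_det[OF this pos_def_g[OF assms]]
  show ?thesis unfolding has_vector_derivative_def
    by (rule has_derivative_eq_rhs)
       (simp add: fun_eq_iff vol'_def bounded_bilinear.scaleR_right[OF bounded_bilinear_matrix_mult]
          linear_scale[OF bounded_linear.linear[OF bounded_linear_trace]])
qed

lemma W_deriv:
  assumes "c \<in> A" "s \<in> J" "x \<in> chart_image c"
  shows "((\<lambda>s. W c s x) has_vector_derivative W' c s x) (at s within J)"
proof -
  have "((\<lambda>s. g s c x) has_derivative (\<lambda>r. r *\<^sub>R H s c x)) (at s within J)"
    using deriv_g[OF assms] by (simp add: has_vector_derivative_def)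
  from has_derivative_matrix_inv_comp[OF this pos_def_g[OF assms]]
  have "((\<lambda>s. matrix_inv (g s c x)) has_vector_derivative - (matrix_inv (g s c x) ** H s c x ** matrix_inv (g s c x))) (at s within J)"
    unfolding has_vector_derivative_def
    by (rule has_derivative_eq_rhs)
       (simp add: fun_eq_iff bounded_bilinear.scaleR_right[OF bounded_bilinear_matrix_mult] bounded_bilinear.scaleR_left[OF bounded_bilinear_matrix_mult])
  from has_derivative_scaleR[OF vol_deriv[OF assms, unfolded has_vector_derivative_def] this[unfolded has_vector_derivative_def]]
  show ?thesis unfolding W_def[abs_def] has_vector_derivative_def
    by (rule has_derivative_eq_rhs) (simp add: fun_eq_iff W'_def algebra_simps)
qed

lemma continuous_on_JV:
  assumes c: "c \<in> A"
  shows "continuous_on (J \<times> chart_image c) (\<lambda>z. vol (g (fst z) c) (snd z))"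
    and "continuous_on (J \<times> chart_image c) (\<lambda>z. vol' c (fst z) (snd z))"
    and "continuous_on (J \<times> chart_image c) (\<lambda>z. W c (fst z) (snd z))"
    and "continuous_on (J \<times> chart_image c) (\<lambda>z. W' c (fst z) (snd z))"
proof -
  let ?S = "J \<times> chart_image c"
  show 1: "continuous_on ?S (\<lambda>z. vol (g (fst z) c) (snd z))"
    by (rule continuous_on_sqrt_det[OF cont_g[OF c]])
  have 2: "continuous_on ?S (\<lambda>z. matrix_inv (g (fst z) c (snd z)))"
    by (rule continuous_on_matrix_inv[OF cont_g[OF c]]) (use pos_def_g[OF c] in auto)
  have 3: "continuous_on ?S (\<lambda>z. matrix_inv (g (fst z) c (snd z)) ** H (fst z) c (snd z))"
    by (rule continuous_on_matrix_mult[OF 2 cont_H[OF c]])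
  show 4: "continuous_on ?S (\<lambda>z. vol' c (fst z) (snd z))"
    unfolding vol'_def by (intro continuous_intros 1 bounded_linear.continuous_on[OF bounded_linear_trace] 3) auto
  show "continuous_on ?S (\<lambda>z. W c (fst z) (snd z))"
    unfolding W_def by (rule continuous_on_scaleR[OF 1 2])
  show "continuous_on ?S (\<lambda>z. W' c (fst z) (snd z))"
    unfolding W'_def
    by (intro continuous_on_add continuous_on_scaleR continuous_on_minus 1 2 4
        continuous_on_matrix_mult[OF 3 2])
qed

lemma continuous_on_slice:
  assumes "continuous_on (J \<times> V) (\<lambda>z. F (fst z) (snd z))" "s \<in> J" "K \<subseteq> V"
  shows "continuous_on K (F s)"
proof -
  have "continuous_on K (\<lambda>x. (\<lambda>z. F (fst z) (snd z)) (s, x))"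
    by (rule continuous_on_compose2[OF assms(1)]) (use assms in \<open>auto intro!: continuous_intros\<close>)
  then show ?thesis by simp
qed

lemma bounded_on_JK:
  assumes "continuous_on (J \<times> V) (\<lambda>z. F (fst z) (snd z))" "compact K" "K \<subseteq> V"
  shows "\<exists>C. \<forall>s\<in>J. \<forall>x\<in>K. norm (F s x) \<le> C"
proof -
  have "bounded ((\<lambda>z. F (fst z) (snd z)) ` (J \<times> K))"
    by (intro compact_imp_bounded compact_continuous_image continuous_on_subset[OF assms(1)] compact_Times compact_Icc)
       (use assms in auto)
  then obtain C where "\<And>z. z \<in> J \<times> K \<Longrightarrow> norm (F (fst z) (snd z)) \<le> C" unfolding bounded_iff by blast
  then have "\<forall>s\<in>J. \<forall>x\<in>K. norm (F s x) \<le> C" by force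
  then show ?thesis by blast
qed

end

lemma abs_bilinear_le:
  fixes a b :: "real^'n::finite" and M :: "real^'n^'n"
  assumes "norm a \<le> C1" "norm M \<le> C2" "norm b \<le> C3" and L: "\<And>M b. norm ((M :: real^'n^'n) *v b) \<le> norm M * norm b * L" "0 \<le> L"
  shows "\<bar>a \<bullet> (M *v b)\<bar> \<le> C1 * (C2 * C3 * L)"
proof -
  have "\<bar>a \<bullet> (M *v b)\<bar> \<le> norm a * norm (M *v b)" by (rule Cauchy_Schwarz_ineq2)
  also have "\<dots> \<le> C1 * (C2 * C3 * L)"
  proof (rule mult_mono[OF assms(1)])
    have "norm (M *v b) \<le> norm M * norm b * L" by (rule L)
    also have "\<dots> \<le> C2 * C3 * L"
      using assms L(2) by (intro mult_right_mono mult_mono) (auto intro: order_trans[OF norm_ge_zero])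
    finally show "norm (M *v b) \<le> C2 * C3 * L" .
  qed (use assms(1) order_trans[OF norm_ge_zero] in auto)
  finally show ?thesis .
qed

text \<open>The C1 dependence of the eigenfunctions enters through the convergence of their
  difference quotients at \<open>t\<close>. The eigenvalue equation is kept for all times in the
  interval, since it is tested at both \<open>s\<close> and \<open>t\<close>.\<close>

locale eigen_curve = metric_curve X A g H t \<delta>
  for X :: "'a topology" and A :: "('a, 'n::finite) chart set" and g H t \<delta> +
  fixes f :: "real \<Rightarrow> 'a \<Rightarrow> real" and l :: "real \<Rightarrow> real" and l' :: real
  assumes smooth_f: "\<And>s. s \<in> {t..t + \<delta>} \<Longrightarrow> smooth_fun A (f s)"
    and eigen: "\<And>s p. s \<in> {t..t + \<delta>} \<Longrightarrow> p \<in> topspace X \<Longrightarrow> Laplace A (g s) (f s) p + l s * f s p = 0"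
    and normalized: "(\<integral>p. (f t p)\<^sup>2 \<partial>riemannian_measure X A (g t)) = 1"
    and deriv_l: "(l has_real_derivative l') (at t within {t..t + \<delta>})"
    and deriv_f: "\<exists>k. smooth_fun A k \<and> smooth_tendsto A (\<lambda>s p. (f s p - f t p) / (s - t)) k (at t within {t..t + \<delta>})"
begin

definition s :: "nat \<Rightarrow> real" where "s k = t + \<delta> * inverse (real (Suc k))"

lemma s_in: "s k \<in> {t<..t + \<delta>}" and s_in_J: "s k \<in> J" and s_tendsto: "s \<longlonglongrightarrow> t" and s_diff: "0 < s k - t" "s k - t \<le> \<delta>"
proof -
  have i: "0 < inverse (real (Suc k))" "inverse (real (Suc k)) \<le> 1" by (auto simp: divide_simps)
  then show 1: "s k \<in> {t<..t + \<delta>}" using \<delta> mult_left_mono[OF i(2), of \<delta>] by (simp add: s_def)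
  then show "s k \<in> J" "0 < s k - t" "s k - t \<le> \<delta>" by auto
  have "(\<lambda>k. t + \<delta> * inverse (real (Suc k))) \<longlonglongrightarrow> t + \<delta> * 0"
    by (intro tendsto_intros LIMSEQ_inverse_real_of_nat)
  then show "s \<longlonglongrightarrow> t" by (simp add: s_def[abs_def])
qed

lemma t_in_J: "t \<in> J" using \<delta> by simp

text \<open>\<open>P k\<close> and \<open>Q\<close> stand for one and the same partial derivative of
  the eigenfunctions at \<open>s k\<close> and at \<open>t\<close>. Their difference quotients
  converge uniformly to a limit bounded by \<open>C0\<close>, so eventually they are bounded by
  \<open>C0 + 1\<close>. This gives the difference a rate of order \<open>s k - t\<close>, hence
  both the convergence and the bound.\<close>

lemma f_partial_limit:
  assumes c: "c \<in> A" and K: "compact K" "K \<subseteq> chart_image c" and vs: "set vs \<subseteq> Basis"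
    and lin: "\<And>k x. x \<in> K \<Longrightarrow> iter_partial (chart_image c) vs (in_chart (\<lambda>p. (f (s k) p - f t p) / (s k - t)) c) x = (P k x - Q x) / (s k - t)"
    and Qc: "continuous_on K Q"
  shows "\<And>x. x \<in> K \<Longrightarrow> (\<lambda>k. P k x) \<longlonglongrightarrow> Q x" "\<exists>C. \<forall>\<^sub>F k in sequentially. \<forall>x\<in>K. \<bar>P k x\<bar> \<le> C"
proof -
  let ?V = "chart_image c"
  obtain r where r: "smooth_fun A r" "smooth_tendsto A (\<lambda>s p. (f s p - f t p) / (s - t)) r (at t within J)"
    using deriv_f by blast
  let ?R = "iter_partial ?V vs (in_chart r c)"
  have "filterlim s (at t within J) sequentially"
  proof -
    have "s k \<in> J" "s k \<noteq> t" for k using s_in_J[of k] s_diff(1)[of k] by auto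
    then show ?thesis using s_tendsto by (simp add: filterlim_at)
  qed
  moreover have "uniform_limit K (\<lambda>s. iter_partial ?V vs (in_chart (\<lambda>p. (f s p - f t p) / (s - t)) c)) ?R (at t within J)"
    using r(2) c K vs unfolding smooth_tendsto_def by blast
  ultimately have "uniform_limit K (\<lambda>k. iter_partial ?V vs (in_chart (\<lambda>p. (f (s k) p - f t p) / (s k - t)) c)) ?R sequentially"
    by (rule filterlim_compose[rotated])
  then have ul: "uniform_limit K (\<lambda>k x. (P k x - Q x) / (s k - t)) ?R sequentially"
    using lin by (simp cong: uniform_limit_cong')
  have "smooth_on ?V (in_chart r c)" using r(1) c by (simp add: smooth_fun_def)
  then have "iter_partial ?V vs (in_chart r c) differentiable_on ?V" using vs unfolding smooth_on_def by blast
  then have "continuous_on K ?R" using K(2) by (meson continuous_on_subset differentiable_imp_continuous_on)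
  then have "bounded (?R ` K)" by (intro compact_imp_bounded compact_continuous_image K)
  then obtain C0 where C0: "\<And>x. x \<in> K \<Longrightarrow> \<bar>?R x\<bar> \<le> C0" unfolding bounded_iff by (metis image_eqI real_norm_def)
  have "bounded (Q ` K)" by (intro compact_imp_bounded compact_continuous_image K Qc)
  then obtain C1 where C1: "\<And>x. x \<in> K \<Longrightarrow> \<bar>Q x\<bar> \<le> C1" unfolding bounded_iff by (metis image_eqI real_norm_def)
  have ev: "\<forall>\<^sub>F k in sequentially. \<forall>x\<in>K. dist ((P k x - Q x) / (s k - t)) (?R x) < 1"
    using ul unfolding uniform_limit_iff by (meson zero_less_one)
  have close: "\<forall>\<^sub>F k in sequentially. \<forall>x\<in>K. \<bar>P k x - Q x\<bar> \<le> (C0 + 1) * (s k - t)"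
    using ev
  proof eventually_elim
    case (elim k)
    show ?case
    proof
      fix x assume x: "x \<in> K"
      have "\<bar>(P k x - Q x) / (s k - t)\<bar> \<le> C0 + 1" 
      proof -
        have "\<bar>(P k x - Q x) / (s k - t) - ?R x\<bar> < 1" using elim x unfolding dist_real_def by blast
        then show ?thesis using C0[OF x] by linarith
      qed
      then show "\<bar>P k x - Q x\<bar> \<le> (C0 + 1) * (s k - t)" using s_diff(1)[of k] by (simp add: divide_simps)
    qed
  qed
  show "(\<lambda>k. P k x) \<longlonglongrightarrow> Q x" if x: "x \<in> K" for x
  proof -
    have "(\<lambda>k. (C0 + 1) * (s k - t)) \<longlonglongrightarrow> (C0 + 1) * (t - t)" by (intro tendsto_intros s_tendsto)
    then have "(\<lambda>k. P k x - Q x) \<longlonglongrightarrow> 0"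
      by (intro Lim_null_comparison[of "\<lambda>k. P k x - Q x" "\<lambda>k. (C0 + 1) * (s k - t)"])
         (use close x in \<open>auto elim!: eventually_mono\<close>)
    then show ?thesis by (simp add: LIM_zero_iff)
  qed
  show "\<exists>C. \<forall>\<^sub>F k in sequentially. \<forall>x\<in>K. \<bar>P k x\<bar> \<le> C"
  proof (intro exI[of _ "\<bar>C0 + 1\<bar> * \<delta> + C1"])
    show "\<forall>\<^sub>F k in sequentially. \<forall>x\<in>K. \<bar>P k x\<bar> \<le> \<bar>C0 + 1\<bar> * \<delta> + C1"
      using close
    proof eventually_elim
      case (elim k)
      show ?case
      proof
        fix x assume x: "x \<in> K"
        have "(C0 + 1) * (s k - t) \<le> \<bar>C0 + 1\<bar> * \<delta>" using s_diff[of k] by (intro mult_mono) auto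
        then show "\<bar>P k x\<bar> \<le> \<bar>C0 + 1\<bar> * \<delta> + C1" using elim x C1[OF x] by fastforce
      qed
    qed
  qed
qed

abbreviation F :: "('a, 'n) chart \<Rightarrow> real \<Rightarrow> real^'n \<Rightarrow> real" where "F c u \<equiv> in_chart (f u) c"

lemma C1_f: "u \<in> J \<Longrightarrow> C1_fun (f u)"
  by (intro smooth_fun_C1_fun smooth_f)

lemma C1_F: "c \<in> A \<Longrightarrow> u \<in> J \<Longrightarrow> C1_on (chart_image c) (F c u)"
  using C1_f unfolding C1_fun_def by blast

lemma F_limit:
  assumes c: "c \<in> A" and K: "compact K" "K \<subseteq> chart_image c"
  shows "\<And>x. x \<in> K \<Longrightarrow> (\<lambda>k. F c (s k) x) \<longlonglongrightarrow> F c t x" "\<exists>C. \<forall>\<^sub>F k in sequentially. \<forall>x\<in>K. \<bar>F c (s k) x\<bar> \<le> C"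
proof -
  have cF: "continuous_on K (F c t)" using continuous_on_subset[OF C1_on_continuous[OF C1_F[OF c t_in_J]] K(2)] .
  have "iter_partial (chart_image c) [] (in_chart (\<lambda>p. (f (s k) p - f t p) / (s k - t)) c) x = (F c (s k) x - F c t x) / (s k - t)" for k x
    by (simp add: in_chart_def)
  from f_partial_limit[OF c K, of "[]", OF _ this cF]
  show "\<And>x. x \<in> K \<Longrightarrow> (\<lambda>k. F c (s k) x) \<longlonglongrightarrow> F c t x" "\<exists>C. \<forall>\<^sub>F k in sequentially. \<forall>x\<in>K. \<bar>F c (s k) x\<bar> \<le> C" by auto
qed

lemma dF_limit:
  assumes c: "c \<in> A" and K: "compact K" "K \<subseteq> chart_image c"
  shows "\<And>x. x \<in> K \<Longrightarrow> (\<lambda>k. diff_vec (F c (s k)) x) \<longlonglongrightarrow> diff_vec (F c t) x"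
    "\<exists>C. \<forall>\<^sub>F k in sequentially. \<forall>x\<in>K. norm (diff_vec (F c (s k)) x) \<le> C"
proof -
  have "iter_partial (chart_image c) [axis j 1] (in_chart (\<lambda>p. (f (s k) p - f t p) / (s k - t)) c) x
      = (pderiv_at j (F c (s k)) x - pderiv_at j (F c t) x) / (s k - t)" if x: "x \<in> K" for j k x
  proof -
    have xV: "x \<in> chart_image c" using x K by blast
    obtain D E where D: "(F c (s k) has_derivative D) (at x)" and E: "(F c t has_derivative E) (at x)"
      using C1_F[OF c s_in_J] C1_F[OF c t_in_J] xV unfolding C1_on_def by metis
    have "((\<lambda>y. (F c (s k) y - F c t y) / (s k - t)) has_derivative (\<lambda>v. (D v - E v) / (s k - t))) (at x)"
      by (rule bounded_linear.has_derivative[OF bounded_linear_divide has_derivative_diff[OF D E]])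
    moreover have "in_chart (\<lambda>p. (f (s k) p - f t p) / (s k - t)) c = (\<lambda>y. (F c (s k) y - F c t y) / (s k - t))"
      by (simp add: in_chart_def fun_eq_iff)
    ultimately show ?thesis
      using iter_partial_axis[OF open_chart_image[OF c] xV] pderiv_at_eq D E by (metis (no_types, lifting))
  qed
  moreover have "continuous_on K (pderiv_at j (F c t))" for j
    using continuous_on_subset[OF C1_on_pderiv_continuous[OF C1_F[OF c t_in_J]] K(2)] .
  moreover have "set [axis j 1 :: real^'n] \<subseteq> Basis" for j by (auto simp: Basis_vec_def)
  ultimately have
    1: "\<And>x. x \<in> K \<Longrightarrow> (\<lambda>k. pderiv_at j (F c (s k)) x) \<longlonglongrightarrow> pderiv_at j (F c t) x" and
    2: "\<exists>C. \<forall>\<^sub>F k in sequentially. \<forall>x\<in>K. \<bar>pderiv_at j (F c (s k)) x\<bar> \<le> C" for j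
    using f_partial_limit[OF c K, of "[axis j 1]" "\<lambda>k. pderiv_at j (F c (s k))" "pderiv_at j (F c t)"] by auto
  show "(\<lambda>k. diff_vec (F c (s k)) x) \<longlonglongrightarrow> diff_vec (F c t) x" if "x \<in> K" for x
    unfolding diff_vec_def by (rule vec_tendstoI) (simp add: 1[OF that])
  have "\<forall>j. \<exists>C. \<forall>\<^sub>F k in sequentially. \<forall>x\<in>K. \<bar>pderiv_at j (F c (s k)) x\<bar> \<le> C" using 2 by blast
  from choice[OF this] obtain C where "\<And>j. \<forall>\<^sub>F k in sequentially. \<forall>x\<in>K. \<bar>pderiv_at j (F c (s k)) x\<bar> \<le> C j" by blast
  then have "\<forall>\<^sub>F k in sequentially. \<forall>j\<in>UNIV. \<forall>x\<in>K. \<bar>pderiv_at j (F c (s k)) x\<bar> \<le> C j"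
    by (intro eventually_ball_finite) auto
  then have "\<forall>\<^sub>F k in sequentially. \<forall>x\<in>K. norm (diff_vec (F c (s k)) x) \<le> (\<Sum>j\<in>UNIV. C j)"
    by eventually_elim (auto intro!: norm_le_of_components simp: diff_vec_def)
  then show "\<exists>C. \<forall>\<^sub>F k in sequentially. \<forall>x\<in>K. norm (diff_vec (F c (s k)) x) \<le> C" by blast
qed

text \<open>Applied twice: with \<open>v k\<close> the density at time \<open>s k\<close>, and with
  \<open>v k\<close> the difference quotient of the density.\<close>

lemma product_limit:
  assumes c: "c \<in> A" and K: "compact K" "K \<subseteq> chart_image c" and w: "continuous_on K w" "\<And>x. x \<notin> K \<Longrightarrow> w x = 0"
    and v: "\<And>k. continuous_on K (v k)" "continuous_on K v\<^sub>0" "\<And>x. x \<in> K \<Longrightarrow> (\<lambda>k. v k x) \<longlonglongrightarrow> v\<^sub>0 x" "\<And>k x. x \<in> K \<Longrightarrow> \<bar>v k x\<bar> \<le> C"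
  shows "(\<lambda>k. LBINT x. w x * (F c (s k) x * F c t x * v k x)) \<longlonglongrightarrow> (LBINT x. w x * ((F c t x)\<^sup>2 * v\<^sub>0 x))"
proof -
  note cF = continuous_on_subset[OF C1_on_continuous[OF C1_F[OF c]] K(2)]
  obtain C1 where C1: "\<forall>\<^sub>F k in sequentially. \<forall>x\<in>K. \<bar>F c (s k) x\<bar> \<le> C1" using F_limit(2)[OF c K] by blast
  have "bounded (F c t ` K)" by (intro compact_imp_bounded compact_continuous_image K cF t_in_J)
  then obtain C2 where C2: "\<And>x. x \<in> K \<Longrightarrow> \<bar>F c t x\<bar> \<le> C2" unfolding bounded_iff by (metis image_eqI real_norm_def)
  have bd: "\<bar>a * b * d\<bar> \<le> C1 * C2 * C" if "\<bar>a\<bar> \<le> C1" "\<bar>b\<bar> \<le> C2" "\<bar>d\<bar> \<le> C" for a b d :: real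
    using that unfolding abs_mult by (intro mult_mono) auto
  show ?thesis
  proof (rule tendsto_integral_compact_support[OF K(1) w])
    show "continuous_on K (\<lambda>x. F c (s k) x * F c t x * v k x)" for k
      by (intro continuous_on_mult cF v s_in_J t_in_J)
    show "continuous_on K (\<lambda>x. (F c t x)\<^sup>2 * v\<^sub>0 x)"
      by (intro continuous_on_mult continuous_on_power cF v t_in_J)
    show "(\<lambda>k. F c (s k) x * F c t x * v k x) \<longlonglongrightarrow> (F c t x)\<^sup>2 * v\<^sub>0 x" if "x \<in> K" for x
      unfolding power2_eq_square by (intro tendsto_mult F_limit(1)[OF c K that] tendsto_const v(3) that)
    show "\<forall>\<^sub>F k in sequentially. \<forall>x\<in>K. \<bar>F c (s k) x * F c t x * v k x\<bar> \<le> C1 * C2 * C"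
      using C1 by eventually_elim (use bd C2 v(4) in blast)
  qed
qed

lemma mass_limit:
  assumes c: "c \<in> A" and K: "compact K" "K \<subseteq> chart_image c" and w: "continuous_on K w" "\<And>x. x \<notin> K \<Longrightarrow> w x = 0"
  shows "(\<lambda>k. LBINT x. w x * (F c (s k) x * F c t x * vol (g (s k) c) x)) \<longlonglongrightarrow> (LBINT x. w x * ((F c t x)\<^sup>2 * vol (g t c) x))"
    and "(\<lambda>k. LBINT x. w x * (F c (s k) x * F c t x * ((vol (g (s k) c) x - vol (g t c) x) / (s k - t))))
      \<longlonglongrightarrow> (LBINT x. w x * ((F c t x)\<^sup>2 * vol' c t x))"
proof -
  note cvol = continuous_on_slice[OF continuous_on_JV(1)[OF c] _ K(2)]
  have ne: "s k - t \<noteq> 0" for k using s_diff(1)[of k] by simp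
  have vlim: "(\<lambda>k. (vol (g (s k) c) x - vol (g t c) x) / (s k - t)) \<longlonglongrightarrow> vol' c t x" if "x \<in> K" for x
    using has_vector_derivative_quotient_tendsto[OF vol_deriv[OF c t_in_J] s_in s_tendsto] that K(2)
    by (auto simp: divide_inverse mult.commute)
  have vlim0: "(\<lambda>k. vol (g (s k) c) x) \<longlonglongrightarrow> vol (g t c) x" if x: "x \<in> K" for x
  proof -
    have "(\<lambda>k. (vol (g (s k) c) x - vol (g t c) x) / (s k - t) * (s k - t) + vol (g t c) x) \<longlonglongrightarrow> vol' c t x * (t - t) + vol (g t c) x"
      by (intro tendsto_intros vlim x s_tendsto)
    then show ?thesis using ne by simp
  qed
  obtain C3 where C3: "\<And>u x. u \<in> J \<Longrightarrow> x \<in> K \<Longrightarrow> \<bar>vol (g u c) x\<bar> \<le> C3"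
    using bounded_on_JK[OF continuous_on_JV(1)[OF c] K] by (metis real_norm_def)
  obtain C4 where C4: "\<And>u x. x \<in> K \<Longrightarrow> u \<in> {t<..t + \<delta>} \<Longrightarrow> norm ((vol (g u c) x - vol (g t c) x) /\<^sub>R (u - t)) \<le> C4"
    using difference_quotient_bounded[of t \<delta> K "\<lambda>u x. vol (g u c) x" "vol' c", OF vol_deriv[OF c] continuous_on_subset[OF continuous_on_JV(2)[OF c]] K(1)] K(2)
    by blast
  show "(\<lambda>k. LBINT x. w x * (F c (s k) x * F c t x * vol (g (s k) c) x)) \<longlonglongrightarrow> (LBINT x. w x * ((F c t x)\<^sup>2 * vol (g t c) x))"
    by (rule product_limit[OF c K w cvol[OF s_in_J] cvol[OF t_in_J] vlim0 C3[OF s_in_J]])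
  show "(\<lambda>k. LBINT x. w x * (F c (s k) x * F c t x * ((vol (g (s k) c) x - vol (g t c) x) / (s k - t))))
      \<longlonglongrightarrow> (LBINT x. w x * ((F c t x)\<^sup>2 * vol' c t x))"
  proof (rule product_limit[OF c K w])
    show "continuous_on K (\<lambda>x. (vol (g (s k) c) x - vol (g t c) x) / (s k - t))" for k
      by (intro continuous_on_divide continuous_on_diff continuous_on_const cvol s_in_J t_in_J ballI ne)
    show "continuous_on K (vol' c t)" by (rule continuous_on_slice[OF continuous_on_JV(2)[OF c] t_in_J K(2)])
    show "\<bar>(vol (g (s k) c) x - vol (g t c) x) / (s k - t)\<bar> \<le> C4" if "x \<in> K" for k x
      using C4[OF that s_in[of k]] by (simp add: divide_inverse mult.commute)
  qed (use vlim in auto)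
qed

lemma energy_limit:
  assumes c: "c \<in> A" and K: "compact K" "K \<subseteq> chart_image c" and w: "continuous_on K w" "\<And>x. x \<notin> K \<Longrightarrow> w x = 0"
  shows "(\<lambda>k. (LBINT x. w x * (diff_vec (F c t) x \<bullet> (((W c (s k) x - W c t x) /\<^sub>R (s k - t)) *v diff_vec (F c (s k)) x))))
      \<longlonglongrightarrow> (LBINT x. w x * (diff_vec (F c t) x \<bullet> (W' c t x *v diff_vec (F c t) x)))"
proof -
  note cd = continuous_on_subset[OF C1_on_diff_vec_continuous[OF C1_F[OF c]] K(2)]
  note cW = continuous_on_slice[OF continuous_on_JV(3)[OF c] _ K(2)]
  note cW' = continuous_on_slice[OF continuous_on_JV(4)[OF c] t_in_J K(2)]
  note mv = continuous_on_matrix_vector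
  obtain C1 where C1: "\<forall>\<^sub>F k in sequentially. \<forall>x\<in>K. norm (diff_vec (F c (s k)) x) \<le> C1" using dF_limit(2)[OF c K] by blast
  have "bounded (diff_vec (F c t) ` K)" by (intro compact_imp_bounded compact_continuous_image K cd t_in_J)
  then obtain C2 where C2: "\<And>x. x \<in> K \<Longrightarrow> norm (diff_vec (F c t) x) \<le> C2" unfolding bounded_iff by blast
  obtain C3 where C3: "\<And>u x. x \<in> K \<Longrightarrow> u \<in> {t<..t + \<delta>} \<Longrightarrow> norm ((W c u x - W c t x) /\<^sub>R (u - t)) \<le> C3"
    using difference_quotient_bounded[of t \<delta> K "W c" "W' c", OF W_deriv[OF c] continuous_on_subset[OF continuous_on_JV(4)[OF c]] K(1)] K(2)
    by blast
  obtain L where L: "0 \<le> L" "\<And>M b. norm ((M :: real^'n^'n) *v b) \<le> norm M * norm b * L"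
    using bounded_bilinear.nonneg_bounded[OF bounded_bilinear_matrix_vector] by metis
  show ?thesis
  proof (rule tendsto_integral_compact_support[OF K(1) w, where C="C2 * (C3 * C1 * L)"])
  show "continuous_on K (\<lambda>x. diff_vec (F c t) x \<bullet> (((W c (s k) x - W c t x) /\<^sub>R (s k - t)) *v diff_vec (F c (s k)) x))" for k
    by (intro continuous_on_inner mv continuous_on_scaleR continuous_on_const continuous_on_diff cW cd s_in_J t_in_J)
  show "continuous_on K (\<lambda>x. diff_vec (F c t) x \<bullet> (W' c t x *v diff_vec (F c t) x))"
    by (intro continuous_on_inner mv cW' cd t_in_J)
  show "(\<lambda>k. diff_vec (F c t) x \<bullet> (((W c (s k) x - W c t x) /\<^sub>R (s k - t)) *v diff_vec (F c (s k)) x))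
      \<longlonglongrightarrow> diff_vec (F c t) x \<bullet> (W' c t x *v diff_vec (F c t) x)" if x: "x \<in> K" for x
    by (intro tendsto_inner tendsto_const bounded_bilinear.tendsto[OF bounded_bilinear_matrix_vector]
        has_vector_derivative_quotient_tendsto[OF W_deriv[OF c t_in_J] s_in s_tendsto] dF_limit(1)[OF c K x] subsetD[OF K(2) x])
  show "\<forall>\<^sub>F k in sequentially. \<forall>x\<in>K. \<bar>diff_vec (F c t) x \<bullet> (((W c (s k) x - W c t x) /\<^sub>R (s k - t)) *v diff_vec (F c (s k)) x)\<bar> \<le> C2 * (C3 * C1 * L)"
    using C1 by eventually_elim (use abs_bilinear_le[OF C2 C3[OF _ s_in] _ L(2,1)] in blast)
  qed
qed

end

section \<open>First variation of the eigenvalue\<close>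

context eigen_curve
begin

text \<open>The difference of the two weak equations, divided by \<open>s k - t\<close>, is passed
  to the limit in coordinates. The coefficient of the quotient of \<open>l\<close> is a mixed mass
  term, which tends to 1 by the normalization at \<open>t\<close>.\<close>

lemma first_variation_local:
  assumes P: "partition_of_unity I c K \<theta>"
  defines "w \<equiv> \<lambda>b. ext (c b) (\<theta> b)"
  shows "(\<Sum>b\<in>I. LBINT x. w b x * (diff_vec (F (c b) t) x \<bullet> (W' (c b) t x *v diff_vec (F (c b) t) x)))
    = l' + l t * (\<Sum>b\<in>I. LBINT x. w b x * ((F (c b) t x)\<^sup>2 * vol' (c b) t x))"
proof -
  note D = partition_of_unityD[OF P]
  have w: "continuous_on (K b) (w b)" "\<And>x. x \<notin> K b \<Longrightarrow> w b x = 0" if "b \<in> I" for b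
    using partition_weight[OF P that] by (auto simp: w_def)
  have wd: "w b = ext (c b) (\<theta> b)" for b by (simp add: w_def)
  have w0: "w b x = 0" if "x \<notin> chart_image (c b)" for b x using that by (simp add: w_def ext_def)
  \<comment> \<open>In \<open>e\<close>, \<open>m\<close>, \<open>E\<close> and \<open>M\<close> the
    index \<open>u\<close> is the time of the metric and \<open>v\<close> the time of one
    eigenfunction; the other eigenfunction is always the one at \<open>t\<close>.\<close>
  define e where "e b u v x = w b x * (diff_vec (F (c b) t) x \<bullet> (W (c b) u x *v diff_vec (F (c b) v) x))" for b u v x
  define m where "m b u v x = w b x * (F (c b) v x * F (c b) t x * vol (g u (c b)) x)" for b u v x
  define E where "E u v = (\<Sum>b\<in>I. LBINT x. e b u v x)" for u v
  define M where "M u v = (\<Sum>b\<in>I. LBINT x. m b u v x)" for u v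
  have E: "integral\<^sup>L (riemannian_measure X A (g u)) (riem_mfd.inner_grad A (g u) (f t) (f v)) = E u v" if u: "u \<in> J" and v: "v \<in> J" for u v
    unfolding riem_mfd.integral_partition[OF riem[OF u] P riem_mfd.cont_fun_inner_grad[OF riem[OF u] C1_f[OF t_in_J] C1_f[OF v]]]
      E_def e_def wd[symmetric]
  proof (intro sum.cong[OF refl] Bochner_Integration.integral_cong[OF refl])
    fix b x assume b: "b \<in> I"
    show "w b x * (in_chart (riem_mfd.inner_grad A (g u) (f t) (f v)) (c b) x * vol (g u (c b)) x)
      = w b x * (diff_vec (F (c b) t) x \<bullet> (W (c b) u x *v diff_vec (F (c b) v) x))"
    proof (cases "x \<in> chart_image (c b)")
      case True
      then show ?thesis
        using riem_mfd.inner_grad_eq[OF riem[OF u] C1_f[OF t_in_J] C1_f[OF v] D(3)[OF b] chart_inv_in[OF True]]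
        by (simp add: in_chart_def[of "riem_mfd.inner_grad A (g u) (f t) (f v)"] W_def scaleR_matrix_vector_assoc[symmetric])
    qed (simp add: w0)
  qed
  have M: "integral\<^sup>L (riemannian_measure X A (g u)) (\<lambda>p. f v p * f t p) = M u v" if u: "u \<in> J" and v: "v \<in> J" for u v
    unfolding riem_mfd.integral_partition[OF riem[OF u] P cont_fun_mult[OF C1_fun_cont_fun[OF C1_f[OF v]] C1_fun_cont_fun[OF C1_f[OF t_in_J]]]]
      M_def m_def wd[symmetric] by (simp add: in_chart_def)
  have weak1: "E u u = l u * M u u" if u: "u \<in> J" for u
    using riem_mfd.eigenfunction_weak_form[OF riem[OF u] smooth_f[OF u] C1_f[OF t_in_J] eigen[OF u]]
    unfolding E[OF u u] M[OF u u] .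
  have weak2: "E t u = l t * M t u" if u: "u \<in> J" for u
  proof -
    have "E t u = integral\<^sup>L \<mu> (inner_grad (f u) (f t))"
      unfolding E[OF t_in_J u, symmetric]
      by (rule Bochner_Integration.integral_cong) (use inner_grad_commute C1_f u t_in_J in auto)
    also have "\<dots> = l t * integral\<^sup>L \<mu> (\<lambda>p. f t p * f u p)"
      by (rule eigenfunction_weak_form[OF smooth_f[OF t_in_J] C1_f[OF u] eigen[OF t_in_J]])
    also have "\<dots> = l t * M t u" unfolding M[OF t_in_J u, symmetric] by (simp add: mult.commute)
    finally show ?thesis .
  qed
  have int: "integrable lborel (e b u v)" "integrable lborel (m b u v)" if u: "u \<in> J" and v: "v \<in> J" and b: "b \<in> I" for b u v
  proof -
    note sub = D(5)[OF b] and cb = D(3)[OF b]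
    have "continuous_on (K b) (e b u v)" "continuous_on (K b) (m b u v)"
      unfolding e_def[abs_def] m_def[abs_def]
      by (intro continuous_on_mult w(1)[OF b] continuous_on_inner continuous_on_matrix_vector u v t_in_J
          continuous_on_subset[OF C1_on_diff_vec_continuous[OF C1_F[OF cb]] sub] continuous_on_slice[OF continuous_on_JV(3)[OF cb] u sub]
          continuous_on_subset[OF C1_on_continuous[OF C1_F[OF cb]] sub] continuous_on_slice[OF continuous_on_JV(1)[OF cb] u sub])+
    from this[THEN integrable_compact_support[OF D(4)[OF b]]]
    show "integrable lborel (e b u v)" "integrable lborel (m b u v)" by (simp_all add: e_def m_def w(2)[OF b])
  qed
  \<comment> \<open>The two energies to be subtracted differ only in the time of the metric, so the
    quotient falls on \<open>W\<close> alone; in \<open>DM\<close> it likewise falls on the density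
    alone.\<close>
  define DE where "DE k = (\<Sum>b\<in>I. LBINT x. w b x * (diff_vec (F (c b) t) x \<bullet>
      (((W (c b) (s k) x - W (c b) t x) /\<^sub>R (s k - t)) *v diff_vec (F (c b) (s k)) x)))" for k
  define DM where "DM k = (\<Sum>b\<in>I. LBINT x. w b x * (F (c b) (s k) x * F (c b) t x *
      ((vol (g (s k) (c b)) x - vol (g t (c b)) x) / (s k - t))))" for k
  have DE: "DE k = (E (s k) (s k) - E t (s k)) / (s k - t)" for k
  proof -
    have "w b x * (diff_vec (F (c b) t) x \<bullet> (((W (c b) (s k) x - W (c b) t x) /\<^sub>R (s k - t)) *v diff_vec (F (c b) (s k)) x))
      = (e b (s k) (s k) x - e b t (s k) x) / (s k - t)" for b x
      by (simp add: e_def scaleR_matrix_vector_assoc[symmetric] matrix_vector_mult_diff_rdistrib inner_diff_right divide_inverse algebra_simps)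
    then show ?thesis
      unfolding DE_def E_def sum_subtractf[symmetric] sum_divide_distrib
      by (simp only: integral_divide_zero Bochner_Integration.integral_diff int(1) s_in_J t_in_J cong: sum.cong)
  qed
  have DM: "DM k = (M (s k) (s k) - M t (s k)) / (s k - t)" for k
  proof -
    have "w b x * (F (c b) (s k) x * F (c b) t x * ((vol (g (s k) (c b)) x - vol (g t (c b)) x) / (s k - t)))
      = (m b (s k) (s k) x - m b t (s k) x) / (s k - t)" for b x
      by (simp add: m_def diff_divide_distrib algebra_simps)
    then show ?thesis
      unfolding DM_def M_def sum_subtractf[symmetric] sum_divide_distrib
      by (simp only: integral_divide_zero Bochner_Integration.integral_diff int(2) s_in_J t_in_J cong: sum.cong)
  qed
  have eq: "DE k = (l (s k) - l t) / (s k - t) * M (s k) (s k) + l t * DM k" for k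
    unfolding DE DM weak1[OF s_in_J] weak2[OF s_in_J]
    by (simp add: diff_divide_distrib algebra_simps)
  have limM: "(\<lambda>k. M (s k) (s k)) \<longlonglongrightarrow> 1"
  proof -
    have "(\<lambda>k. M (s k) (s k)) \<longlonglongrightarrow> (\<Sum>b\<in>I. LBINT x. w b x * ((F (c b) t x)\<^sup>2 * vol (g t (c b)) x))"
      unfolding M_def m_def by (intro tendsto_sum) (rule mass_limit(1)[OF D(3-5) w])
    also have "(\<Sum>b\<in>I. LBINT x. w b x * ((F (c b) t x)\<^sup>2 * vol (g t (c b)) x)) = M t t"
      unfolding M_def m_def by (simp add: power2_eq_square)
    also have "M t t = 1" unfolding M[OF t_in_J t_in_J, symmetric] using normalized by (simp add: power2_eq_square)
    finally show ?thesis .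
  qed
  have limDM: "DM \<longlonglongrightarrow> (\<Sum>b\<in>I. LBINT x. w b x * ((F (c b) t x)\<^sup>2 * vol' (c b) t x))"
    unfolding DM_def[abs_def] by (intro tendsto_sum) (rule mass_limit(2)[OF D(3-5) w])
  have limDE: "DE \<longlonglongrightarrow> (\<Sum>b\<in>I. LBINT x. w b x * (diff_vec (F (c b) t) x \<bullet> (W' (c b) t x *v diff_vec (F (c b) t) x)))"
    unfolding DE_def[abs_def] by (intro tendsto_sum) (rule energy_limit[OF D(3-5) w])
  have "(\<lambda>k. (l (s k) - l t) / (s k - t)) \<longlonglongrightarrow> l'"
  proof -
    have "(l has_vector_derivative l') (at t within J)"
      using deriv_l by (simp add: has_real_derivative_iff_has_vector_derivative)
    from has_vector_derivative_quotient_tendsto[OF this s_in s_tendsto] show ?thesis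
      by (simp add: divide_inverse mult.commute)
  qed
  from tendsto_add[OF tendsto_mult[OF this limM] tendsto_mult[OF tendsto_const[of "l t"] limDM]]
  have "DE \<longlonglongrightarrow> l' * 1 + l t * (\<Sum>b\<in>I. LBINT x. w b x * ((F (c b) t x)\<^sup>2 * vol' (c b) t x))"
    unfolding eq[symmetric] .
  from LIMSEQ_unique[OF limDE this] show ?thesis by simp
qed

lemma eigenfunction_energy: "integral\<^sup>L \<mu> (inner_grad (f t) (f t)) = l t"
  using eigenfunction_weak_form[OF smooth_f[OF t_in_J] C1_f[OF t_in_J] eigen[OF t_in_J]] normalized
  by (simp add: power2_eq_square)

end

text \<open>\<open>\<kappa>\<close> stands for (2/n) r at time \<open>t\<close>, a number
  independent of the point. The flow equation is used at the single time \<open>t\<close>.\<close>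

locale ricci_eigen_curve = eigen_curve X A g H t \<delta> f l l'
  for X :: "'a topology" and A :: "('a, 'n::finite) chart set" and g H t \<delta> f l l' +
  fixes \<kappa> :: real
  assumes H_ricci: "\<And>c x. c \<in> A \<Longrightarrow> x \<in> chart_image c \<Longrightarrow> H t c x = \<kappa> *\<^sub>R g t c x - 2 *\<^sub>R ricci (g t c) x"
begin

lemma ricci_eq: "c \<in> A \<Longrightarrow> x \<in> chart_image c \<Longrightarrow> ricci (g t c) x = (1/2) *\<^sub>R (\<kappa> *\<^sub>R g t c x - H t c x)"
  by (simp add: H_ricci)

text \<open>That the Ricci curvature is a tensor is read off from the flow equation, not computed from Christoffel symbols.\<close>

lemma ricci_transform:
  assumes "c \<in> A" "d \<in> A" "p \<in> fst c" "p \<in> fst d"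
  shows "ricci (g t c) (snd c p) = transpose (Jac c d p) ** ricci (g t d) (snd d p) ** Jac c d p"
proof -
  note mm = bounded_bilinear_matrix_mult
  show ?thesis
    using assms by (simp only: ricci_eq chart_image_in H_transform[OF assms] metric_transform[OF assms]
        bounded_bilinear.scaleR_left[OF mm] bounded_bilinear.scaleR_right[OF mm]
        bounded_bilinear.diff_left[OF mm] bounded_bilinear.diff_right[OF mm])
qed

text \<open>Continuity comes from the flow equation as well: Ricci is a combination of the metric
  and of its continuous time derivative.\<close>

lemma continuous_ricci:
  assumes c: "c \<in> A"
  shows "continuous_on (chart_image c) (ricci (g t c))"
proof -
  have "continuous_on (chart_image c) (\<lambda>x. (1/2) *\<^sub>R (\<kappa> *\<^sub>R g t c x - H t c x))"
    using continuous_on_slice[OF cont_H[OF c] t_in_J order_refl]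
      C1_on_continuous[OF C1_on_metric[OF c]] by (intro continuous_intros) auto
  then show ?thesis using ricci_eq[OF c] by (simp cong: continuous_on_cong)
qed

lemma Scal_eq:
  assumes c: "c \<in> A" "p \<in> fst c"
  shows "Scal A (g t) p = scalar_curv (g t c) (snd c p)"
  unfolding Scal_def
proof (rule at_point_eq[OF _ c])
  fix c d assume cd: "c \<in> A" "d \<in> A" "p \<in> fst c" "p \<in> fst d"
  show "scalar_curv (g t c) (snd c p) = scalar_curv (g t d) (snd d p)"
    unfolding scalar_curv_def ricci_transform[OF cd]
    by (rule trace_wrt_congruence[OF pos_def_metric pos_def_metric metric_transform[OF cd]]) (use cd in auto)
qed

lemma gradient_eq: "gradient (g t c) u x = matrix_inv (g t c x) *v diff_vec u x"
  by (simp add: gradient_def diff_vec_def)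

lemma Ric_grad_eq:
  assumes u: "C1_fun u" and c: "c \<in> A" "p \<in> fst c"
  shows "Ric_grad A (g t) u p = bilin (ricci (g t c) (snd c p)) (matrix_inv (g t c (snd c p)) *v diff_vec (in_chart u c) (snd c p))
      (matrix_inv (g t c (snd c p)) *v diff_vec (in_chart u c) (snd c p))"
  unfolding Ric_grad_def gradient_eq
proof (rule at_point_eq[OF _ c])
  fix c d assume cd: "c \<in> A" "d \<in> A" "p \<in> fst c" "p \<in> fst d"
  let ?J = "Jac c d p"
  have "?J *v (matrix_inv (g t c (snd c p)) *v diff_vec (in_chart u c) (snd c p)) = matrix_inv (g t d (snd d p)) *v diff_vec (in_chart u d) (snd d p)"
    unfolding diff_vec_transform[OF cd u] matrix_inv_metric_transform[OF cd, symmetric]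
    by (simp only: matrix_vector_mul_assoc matrix_mul_assoc)
  then show "bilin (ricci (g t c) (snd c p)) (matrix_inv (g t c (snd c p)) *v diff_vec (in_chart u c) (snd c p))
        (matrix_inv (g t c (snd c p)) *v diff_vec (in_chart u c) (snd c p))
      = bilin (ricci (g t d) (snd d p)) (matrix_inv (g t d (snd d p)) *v diff_vec (in_chart u d) (snd d p))
        (matrix_inv (g t d (snd d p)) *v diff_vec (in_chart u d) (snd d p))"
    unfolding ricci_transform[OF cd] bilin_congruence by simp
qed

lemma continuous_matrix_inv_metric: "c \<in> A \<Longrightarrow> continuous_on (chart_image c) (\<lambda>x. matrix_inv (g t c x))"
  by (intro continuous_on_matrix_inv C1_on_continuous[OF C1_on_metric] pos_def_metric)

lemma scalar_curv_eq_trace: "c \<in> A \<Longrightarrow> x \<in> chart_image c \<Longrightarrow> scalar_curv (g t c) x = trace (matrix_inv (g t c x) ** ricci (g t c) x)"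
  unfolding scalar_curv_def by (rule trace_wrt_eq[OF pos_def_inv(3)[OF pos_def_metric]])

lemma cont_fun_Scal: "cont_fun (Scal A (g t))"
proof (rule cont_funI)
  show "continuous_on (chart_image c) (\<lambda>x. trace (matrix_inv (g t c x) ** ricci (g t c) x))" if "c \<in> A" for c
    by (intro bounded_linear.continuous_on[OF bounded_linear_trace] continuous_on_matrix_mult
        continuous_matrix_inv_metric continuous_ricci that)
  show "Scal A (g t) p = trace (matrix_inv (g t c (snd c p)) ** ricci (g t c) (snd c p))" if "c \<in> A" "p \<in> fst c" for c p
    using Scal_eq[OF that] scalar_curv_eq_trace[OF that(1) chart_image_in[OF that(2)]] by simp
qed

lemma cont_fun_Ric_grad:
  assumes u: "C1_fun u"
  shows "cont_fun (Ric_grad A (g t) u)"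
proof (rule cont_funI)
  show "Ric_grad A (g t) u p = bilin (ricci (g t c) (snd c p)) (matrix_inv (g t c (snd c p)) *v diff_vec (in_chart u c) (snd c p))
      (matrix_inv (g t c (snd c p)) *v diff_vec (in_chart u c) (snd c p))" if "c \<in> A" "p \<in> fst c" for c p
    by (rule Ric_grad_eq[OF u that])
  fix c assume c: "c \<in> A"
  have "C1_on (chart_image c) (in_chart u c)" using u c unfolding C1_fun_def by blast
  then show "continuous_on (chart_image c) (\<lambda>x. bilin (ricci (g t c) x) (matrix_inv (g t c x) *v diff_vec (in_chart u c) x)
      (matrix_inv (g t c x) *v diff_vec (in_chart u c) x))"
    unfolding bilin_def
    by (intro continuous_on_inner continuous_on_matrix_vector
        continuous_matrix_inv_metric continuous_ricci C1_on_diff_vec_continuous c)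
qed

lemma trace_H:
  assumes "c \<in> A" "x \<in> chart_image c"
  shows "trace (matrix_inv (g t c x) ** H t c x) = \<kappa> * real CARD('n) - 2 * scalar_curv (g t c) x"
proof -
  note mm = bounded_bilinear_matrix_mult and tr = bounded_linear.linear[OF bounded_linear_trace]
  show ?thesis
    unfolding H_ricci[OF assms] scalar_curv_eq_trace[OF assms]
    by (simp add: bounded_bilinear.diff_right[OF mm] bounded_bilinear.scaleR_right[OF mm] linear_diff[OF tr] linear_scale[OF tr]
        pos_def_inv(2)[OF pos_def_metric[OF assms]] trace_I)
qed

lemma vol'_eq:
  assumes "c \<in> A" "x \<in> chart_image c"
  shows "vol' c t x = (\<kappa> * real CARD('n) / 2 - Scal A (g t) (chart_inv c x)) * vol (g t c) x"
  unfolding vol'_def trace_H[OF assms] Scal_eq[OF assms(1) chart_inv_in[OF assms(2)]] chart_inv_right[OF assms(2)]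
  by (simp add: field_simps)

text \<open>The inverse metric applied to \<open>d\<close> is the gradient, so the conjugated
  \<open>H\<close> evaluates the time derivative of the metric on gradients. The flow equation turns
  this into \<kappa> times the squared gradient minus twice Ricci. It enters with a minus sign,
  coming from the derivative of the inverse.\<close>

lemma W'_eq:
  assumes c: "c \<in> A" "x \<in> chart_image c" and u: "C1_fun u"
  defines "d \<equiv> diff_vec (in_chart u c) x" and "p \<equiv> chart_inv c x"
  shows "d \<bullet> (W' c t x *v d) = ((\<kappa> * real CARD('n) / 2 - Scal A (g t) p) * inner_grad u u p
      - \<kappa> * inner_grad u u p + 2 * Ric_grad A (g t) u p) * vol (g t c) x"
proof -
  let ?B = "matrix_inv (g t c x)"
  note mv = bounded_bilinear_matrix_vector
  have pd: "pos_def (g t c x)" by (rule pos_def_metric[OF c])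
  have p: "p \<in> fst c" "snd c p = x" using c by (auto simp: p_def)
  have ig: "inner_grad u u p = d \<bullet> (?B *v d)" using inner_grad_eq[OF u u c(1) p(1)] by (simp add: p(2) d_def)
  have rg: "Ric_grad A (g t) u p = (?B *v d) \<bullet> (ricci (g t c) x *v (?B *v d))"
    using Ric_grad_eq[OF u c(1) p(1)] by (simp add: p(2) d_def bilin_def)
  have "d \<bullet> ((?B ** H t c x ** ?B) *v d) = (?B *v d) \<bullet> (H t c x *v (?B *v d))"
    using inner_matrix_vector[of ?B d "H t c x *v (?B *v d)"] pos_def_inv(3)[OF pd]
    by (simp only: matrix_vector_mul_assoc matrix_mul_assoc)
  also have "\<dots> = \<kappa> * ((?B *v d) \<bullet> (g t c x *v (?B *v d))) - 2 * Ric_grad A (g t) u p"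
    unfolding H_ricci[OF c] rg
    by (simp add: bounded_bilinear.diff_left[OF mv] bounded_bilinear.scaleR_left[OF mv] inner_diff_right)
  also have "(?B *v d) \<bullet> (g t c x *v (?B *v d)) = inner_grad u u p"
    unfolding ig by (simp add: matrix_vector_mul_assoc pos_def_inv(1)[OF pd] inner_commute)
  finally have h: "d \<bullet> ((?B ** H t c x ** ?B) *v d) = \<kappa> * inner_grad u u p - 2 * Ric_grad A (g t) u p" .
  have "d \<bullet> (W' c t x *v d) = vol (g t c) x * - (d \<bullet> ((?B ** H t c x ** ?B) *v d)) + vol' c t x * inner_grad u u p"
    unfolding W'_def ig
    by (simp add: bounded_bilinear.add_left[OF mv] bounded_bilinear.scaleR_left[OF mv] bounded_bilinear.minus_left[OF mv] bounded_bilinear.diff_left[OF mv] inner_diff_right inner_add_right)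
  then show ?thesis unfolding h vol'_eq[OF c] by (simp add: p_def algebra_simps)
qed

text \<open>Half the trace of \<open>H\<close> is \<kappa> n/2 minus the scalar curvature. Its
  constant part contributes (\<kappa> n/2) l both to the energy and to l times the mass, because f
  has energy l and mass one, and so it cancels. What remains of \<kappa> comes from the metric part
  of \<open>H\<close> on gradients.\<close>

theorem eigenvalue_derivative:
  "l' = - \<kappa> * l t + l t * integral\<^sup>L \<mu> (\<lambda>p. (f t p)\<^sup>2 * Scal A (g t) p)
      - integral\<^sup>L \<mu> (\<lambda>p. Scal A (g t) p * grad_norm_sq A (g t) (f t) p) + 2 * integral\<^sup>L \<mu> (Ric_grad A (g t) (f t))"
proof -
  obtain I :: "(('a, 'n) chart \<times> (real^'n) \<times> real) set" and c K \<theta> where P: "partition_of_unity I c K \<theta>"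
    by (rule ex_partition_of_unity)
  note cA = partition_of_unityD(3)[OF P]
  let ?r = "\<kappa> * real CARD('n) / 2"
  define \<Phi> where "\<Phi> = inner_grad (f t) (f t)"
  define R where "R = Scal A (g t)"
  define Q where "Q = Ric_grad A (g t) (f t)"
  note f1 = C1_f[OF t_in_J]
  have cf: "cont_fun (f t)" "cont_fun \<Phi>" "cont_fun R" "cont_fun Q"
    unfolding \<Phi>_def R_def Q_def by (intro C1_fun_cont_fun f1 cont_fun_inner_grad cont_fun_Scal cont_fun_Ric_grad)+
  have i: "integrable \<mu> \<Phi>" "integrable \<mu> Q" "integrable \<mu> (\<lambda>p. R p * \<Phi> p)" "integrable \<mu> (\<lambda>p. f t p * f t p)"
    "integrable \<mu> (\<lambda>p. R p * (f t p * f t p))"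
    by (intro integrable_cont_fun cont_fun_mult cf)+
  have c_const: "cont_fun (\<lambda>p. k)" for k by (simp add: cont_fun_def in_chart_def o_def)
  have c_add: "cont_fun (\<lambda>p. h p + k p)" "cont_fun (\<lambda>p. h p - k p)" if "cont_fun h" "cont_fun k" for h k
    using that unfolding cont_fun_def in_chart_def o_def by (auto intro: continuous_on_add continuous_on_diff)
  let ?h1 = "\<lambda>p. (?r - R p) * \<Phi> p - \<kappa> * \<Phi> p + 2 * Q p" and ?h2 = "\<lambda>p. (?r - R p) * (f t p * f t p)"
  have h: "cont_fun ?h1" "cont_fun ?h2" by (intro c_add cont_fun_mult c_const cf)+
  have "integral\<^sup>L \<mu> ?h1 = (\<Sum>b\<in>I. (LBINT x. ext (c b) (\<theta> b) x * (in_chart ?h1 (c b) x * vol (g t (c b)) x)))"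
    by (rule integral_partition[OF P h(1)])
  also have "\<dots> = (\<Sum>b\<in>I. (LBINT x. ext (c b) (\<theta> b) x * (diff_vec (F (c b) t) x \<bullet> (W' (c b) t x *v diff_vec (F (c b) t) x))))"
  proof (intro sum.cong[OF refl] Bochner_Integration.integral_cong[OF refl])
    fix b x assume "b \<in> I"
    moreover have "in_chart ?h1 (c b) x = ?h1 (chart_inv (c b) x)" by (simp add: in_chart_def)
    ultimately show "ext (c b) (\<theta> b) x * (in_chart ?h1 (c b) x * vol (g t (c b)) x)
      = ext (c b) (\<theta> b) x * (diff_vec (F (c b) t) x \<bullet> (W' (c b) t x *v diff_vec (F (c b) t) x))"
      using W'_eq[OF cA _ f1, of b x] by (cases "x \<in> chart_image (c b)") (simp_all add: \<Phi>_def R_def Q_def ext_def)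
  qed
  also have "\<dots> = l' + l t * (\<Sum>b\<in>I. (LBINT x. ext (c b) (\<theta> b) x * ((F (c b) t x)\<^sup>2 * vol' (c b) t x)))"
    by (rule first_variation_local[OF P])
  also have "(\<Sum>b\<in>I. (LBINT x. ext (c b) (\<theta> b) x * ((F (c b) t x)\<^sup>2 * vol' (c b) t x)))
      = (\<Sum>b\<in>I. (LBINT x. ext (c b) (\<theta> b) x * (in_chart ?h2 (c b) x * vol (g t (c b)) x)))"
  proof (intro sum.cong[OF refl] Bochner_Integration.integral_cong[OF refl])
    fix b x assume "b \<in> I"
    then show "ext (c b) (\<theta> b) x * ((F (c b) t x)\<^sup>2 * vol' (c b) t x)
      = ext (c b) (\<theta> b) x * (in_chart ?h2 (c b) x * vol (g t (c b)) x)"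
      using vol'_eq[OF cA, of b x] by (cases "x \<in> chart_image (c b)") (simp_all add: in_chart_def R_def ext_def power2_eq_square)
  qed
  also have "\<dots> = integral\<^sup>L \<mu> ?h2"
    by (rule integral_partition[OF P h(2), symmetric])
  finally have l': "l' = integral\<^sup>L \<mu> ?h1 - l t * integral\<^sup>L \<mu> ?h2" by simp
  have h1: "integral\<^sup>L \<mu> ?h1 = ?r * l t - integral\<^sup>L \<mu> (\<lambda>p. R p * \<Phi> p) - \<kappa> * l t + 2 * integral\<^sup>L \<mu> Q"
    using i eigenfunction_energy by (simp add: left_diff_distrib \<Phi>_def)
  have h2: "integral\<^sup>L \<mu> ?h2 = ?r - integral\<^sup>L \<mu> (\<lambda>p. R p * (f t p * f t p))"
    using i normalized by (simp add: left_diff_distrib power2_eq_square)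
  have R1: "integral\<^sup>L \<mu> (\<lambda>p. Scal A (g t) p * grad_norm_sq A (g t) (f t) p) = integral\<^sup>L \<mu> (\<lambda>p. R p * \<Phi> p)"
    by (rule Bochner_Integration.integral_cong) (auto simp: R_def \<Phi>_def grad_norm_sq_eq)
  have R2: "integral\<^sup>L \<mu> (\<lambda>p. (f t p)\<^sup>2 * Scal A (g t) p) = integral\<^sup>L \<mu> (\<lambda>p. R p * (f t p * f t p))"
    by (simp add: R_def power2_eq_square mult.commute)
  show ?thesis unfolding l' h1 h2 R1 R2 unfolding Q_def by (simp add: algebra_simps)
qed

end

section \<open>Application to the normalized Ricci flow\<close>

theorem proposition2p2:
  fixes X :: "'a topology"
    and A :: "('a, 'n::finite) chart set"
    and T :: ereal
    and g\<^sub>0 :: "('a, 'n) metric"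
    and g :: "real \<Rightarrow> ('a, 'n) metric"
    and l :: "real \<Rightarrow> real"
    and f :: "real \<Rightarrow> 'a \<Rightarrow> real"
    and t :: real
  assumes "closed_manifold X A"
    and "0 < T"
    and "riemannian_metric A g\<^sub>0"
    and "normalized_ricci_flow X A T g\<^sub>0 g"
    and "evolving_eigenvalue X A (time_interval T) g l f"
    and "t \<in> time_interval T"
  shows "(l has_real_derivative
      - (2 / real CARD('n)) * mean_scal X A (g t) * l t
      + l t * (\<integral>p. (f t p)\<^sup>2 * Scal A (g t) p \<partial>riemannian_measure X A (g t))
      - (\<integral>p. Scal A (g t) p * grad_norm_sq A (g t) (f t) p \<partial>riemannian_measure X A (g t))
      + 2 * (\<integral>p. Ric_grad A (g t) (f t) p \<partial>riemannian_measure X A (g t)))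
      (at t within time_interval T)"
proof -
  let ?I = "time_interval T"
  obtain \<delta> where J: "0 < \<delta>" "{t..t + \<delta>} \<subseteq> ?I" by (rule time_interval_right[OF assms(6)])
  note flow = assms(4)[unfolded normalized_ricci_flow_def]
  note eig = assms(5)[unfolded evolving_eigenvalue_def]
  obtain l1 where l1: "\<And>s. s \<in> ?I \<Longrightarrow> (l has_real_derivative l1 s) (at s within ?I)"
    using eig unfolding C1_curve_real_def by blast
  obtain k where k: "\<And>s. s \<in> ?I \<Longrightarrow> smooth_fun A (k s)"
    "\<And>s. s \<in> ?I \<Longrightarrow> smooth_tendsto A (\<lambda>u p. (f u p - f s p) / (u - s)) (k s) (at s within ?I)"
    using eig unfolding C1_curve_smooth_def by blast
  interpret M: closed_mfd X A by standard (rule assms(1))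
  \<comment> \<open>The time derivative is taken from the joint smoothness as the derivative in
    direction (1, 0). In this form it is jointly continuous in time and space; only afterwards is it
    identified with the right-hand side of the flow equation.\<close>
  define D where "D c z = frechet_derivative (\<lambda>(s, x). g s c x) (at z within ?I \<times> chart_image c)" for c z
  define H where "H s c x = D c (s, x) (1, 0)" for s c x
  have sm: "smooth_on (?I \<times> chart_image c) (\<lambda>(s, x). g s c x)" if "c \<in> A" for c using flow that by blast
  have Der: "((\<lambda>(s, x). g s c x) has_derivative D c z) (at z within ?I \<times> chart_image c)"
    if "c \<in> A" "z \<in> ?I \<times> chart_image c" for c z
  proof -
    have "iter_partial (?I \<times> chart_image c) [] (\<lambda>(s, x). g s c x) differentiable_on ?I \<times> chart_image c"
      using sm[OF that(1)] unfolding smooth_on_def by (metis empty_set empty_subsetI)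
    then show ?thesis using that(2) unfolding D_def differentiable_on_def iter_partial.simps frechet_derivative_works by blast
  qed
  have H: "((\<lambda>s. g s c x) has_vector_derivative H s c x) (at s within ?I)"
    if "c \<in> A" "s \<in> ?I" "x \<in> chart_image c" for c s x
  proof -
    have "((\<lambda>u. (\<lambda>(s, x). g s c x) (u, x)) has_derivative (\<lambda>r. D c (s, x) (r, 0))) (at s within ?I)"
    proof (rule has_derivative_in_compose2[of "?I \<times> chart_image c" _ "D c" "\<lambda>u. (u, x)"])
      show "((\<lambda>u. (u, x)) has_derivative (\<lambda>r. (r, 0))) (at s within ?I)"
        by (intro derivative_eq_intros) auto
    qed (use Der that in auto)
    moreover have "D c (s, x) (r, 0) = r *\<^sub>R H s c x" for r
    proof -
      have "linear (D c (s, x))" using Der[OF that(1)] that(2,3) by (intro has_derivative_linear) blast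
      from linear_scale[OF this, of r "(1, 0)"] show ?thesis by (simp add: H_def)
    qed
    ultimately show ?thesis by (simp add: has_vector_derivative_def)
  qed
  have cont: "continuous_on (?I \<times> chart_image c) (\<lambda>z. g (fst z) c (snd z))" "continuous_on (?I \<times> chart_image c) (\<lambda>z. H (fst z) c (snd z))"
    if "c \<in> A" for c
  proof -
    have "iter_partial (?I \<times> chart_image c) vs (\<lambda>(s, x). g s c x) differentiable_on ?I \<times> chart_image c" if "set vs \<subseteq> Basis" for vs
      using sm[OF \<open>c \<in> A\<close>] that unfolding smooth_on_def by blast
    from differentiable_imp_continuous_on[OF this]
    have ip: "continuous_on (?I \<times> chart_image c) (iter_partial (?I \<times> chart_image c) vs (\<lambda>(s, x). g s c x))" if "set vs \<subseteq> Basis" for vs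
      using that .
    show "continuous_on (?I \<times> chart_image c) (\<lambda>z. g (fst z) c (snd z))"
      using ip[of "[]"] by (simp add: case_prod_beta')
    have "(1 :: real, 0 :: real^'n) \<in> Basis" by (simp add: Basis_prod_def)
    then show "continuous_on (?I \<times> chart_image c) (\<lambda>z. H (fst z) c (snd z))"
      using ip[of "[(1, 0)]"] by (simp add: H_def D_def case_prod_beta')
  qed
  let ?J = "{t..t + \<delta>}"
  interpret metric_curve X A g H t \<delta>
  proof (intro metric_curve.intro M.closed_mfd_axioms metric_curve_axioms.intro)
    show "riem_mfd X A (g s)" if "s \<in> ?J" for s
      using flow that J(2) by (intro riem_mfd.intro M.closed_mfd_axioms riem_mfd_axioms.intro) blast
    show "continuous_on (?J \<times> chart_image c) (\<lambda>z. g (fst z) c (snd z))" if "c \<in> A" for c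
      by (rule continuous_on_subset[OF cont(1)[OF that]]) (use J(2) in blast)
    show "continuous_on (?J \<times> chart_image c) (\<lambda>z. H (fst z) c (snd z))" if "c \<in> A" for c
      by (rule continuous_on_subset[OF cont(2)[OF that]]) (use J(2) in blast)
    show "((\<lambda>s. g s c x) has_vector_derivative H s c x) (at s within ?J)" if "c \<in> A" "s \<in> ?J" "x \<in> chart_image c" for c s x
      by (rule has_vector_derivative_within_subset[OF H J(2)]) (use that J(2) in auto)
  qed (rule J(1))
  interpret ricci_eigen_curve X A g H t \<delta> f l "l1 t" "2 / real CARD('n) * mean_scal X A (g t)"
  proof
    show "smooth_fun A (f s)" if "s \<in> ?J" for s using eig that J(2) unfolding C1_curve_smooth_def by blast
    show "Laplace A (g s) (f s) p + l s * f s p = 0" if "s \<in> ?J" "p \<in> topspace X" for s p using eig that J(2) by blast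
    show "(\<integral>p. (f t p)\<^sup>2 \<partial>riemannian_measure X A (g t)) = 1" using eig assms(6) by blast
    show "(l has_real_derivative l1 t) (at t within ?J)" by (rule DERIV_subset[OF l1[OF assms(6)] J(2)])
    show "\<exists>k. smooth_fun A k \<and> smooth_tendsto A (\<lambda>s p. (f s p - f t p) / (s - t)) k (at t within ?J)"
    proof (intro exI conjI)
      show "smooth_fun A (k t)" by (rule k(1)[OF assms(6)])
      show "smooth_tendsto A (\<lambda>s p. (f s p - f t p) / (s - t)) (k t) (at t within ?J)"
        using k(2)[OF assms(6)] filterlim_mono[OF _ order_refl at_le[OF J(2)]]
        unfolding smooth_tendsto_def by blast
    qed
    show "H t c x = (2 / real CARD('n) * mean_scal X A (g t)) *\<^sub>R g t c x - 2 *\<^sub>R ricci (g t c) x" if "c \<in> A" "x \<in> chart_image c" for c x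
    proof (rule derivative_unique)
      show "((\<lambda>s. g s c x) has_vector_derivative H t c x) (at t within ?J)"
        by (rule has_vector_derivative_within_subset[OF H[OF that(1) assms(6) that(2)] J(2)])
      have "((\<lambda>s. g s c x) has_vector_derivative (2 / real CARD('n) * mean_scal X A (g t)) *\<^sub>R g t c x - 2 *\<^sub>R ricci (g t c) x) (at t within ?I)"
        using flow that assms(6) by blast
      then show "((\<lambda>s. g s c x) has_vector_derivative (2 / real CARD('n) * mean_scal X A (g t)) *\<^sub>R g t c x - 2 *\<^sub>R ricci (g t c) x) (at t within ?J)"
        by (rule has_vector_derivative_within_subset[OF _ J(2)])
    qed
  qed
  \<comment> \<open>The hypothesis provides the derivative within the whole time interval; the
    computation to the right of \<open>t\<close> has determined its value
    \<open>l1 t\<close>.\<close>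
  show ?thesis using l1[OF assms(6)] eigenvalue_derivative by simp
qed

end
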